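(* Let $d\ge 1$. Given any sequence $(\widetilde{\mu_n\nu_n})_n$ in $\widetilde{\mathcal M}_1^\otimes$, there is a subsequence that converges, in the metric $\mathbf D^\otimes$, to a limit in $\widetilde{\mathcal X}^\otimes$. Furthermore, the set of orbits $\widetilde{\mathcal M}_1^\otimes$ is dense in $\widetilde{\mathcal X}^\otimes$. Hence $\widetilde{\mathcal X}^\otimes$ is a compactification of $\widetilde{\mathcal M}_1^\otimes$. It is then also the completion under the metric $\mathbf D^\otimes$ of the totally bounded space $\widetilde{\mathcal M}_1^\otimes$.
   Context: $\mathcal M_1=\mathcal M_1(\mathbb R^d)$ (resp. $\mathcal M_{\le 1}$) is the space of probability (resp. sub-probability) measures on $\mathbb R^d$. For $\mu,\nu\in\mathcal M_{\le 1}$ write $\mu\nu=\mu\otimes\nu$ for the product measure, and $\widetilde{\mu\nu}=\{(\mu\star\delta_x)\otimes(\nu\star\delta_x):x\in\mathbb R^d\}$ for its diagonal orbit under translations ($\star$ is convolution). $\widetilde{\mathcal M}_1^\otimes$ is the set of all diagonal orbits $\widetilde{\mu\nu}$ with $\mu,\nu\in\mathcal M_1$. $\widetilde{\mathcal X}^\otimes$ is the set of all empty, finite or countable collections $\xi^\otimes=\{\widetilde{\alpha_i\beta_i}\}_{i\in I}$ of diagonal orbits with $\alpha_i,\beta_i\in\mathcal M_{\le 1}$, $\sum_i\alpha_i(\mathbb R^d)\le 1$, $\sum_i\beta_i(\mathbb R^d)\le 1$. An orbit $\widetilde{\mu\nu}\in\widetilde{\mathcal M}_1^\otimes$ is identified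 with the one-element collection $\{\widetilde{\mu\nu}\}$. For $k\ge 1$, $\mathcal F_k^\otimes$ is the space of continuous $f:(\mathbb R^{2d})^k\to\mathbb R$ that are diagonally translation invariant, $f(x_1+a,y_1+a,\dots,x_k+a,y_k+a)=f(x_1,y_1,\dots,x_k,y_k)$ for all $a\in\mathbb R^d$, and vanish at infinity in the sense that $f(x_1,y_1,\dots,x_k,y_k)\to 0$ as $\max_{i,j}\{|x_i-y_j|,|x_i-x_j|,|y_i-y_j|\}\to\infty$. Put $\mathcal F^\otimes=\bigcup_{k\ge1}\mathcal F_k^\otimes$. For $f\in\mathcal F_k^\otimes$ and $\xi^\otimes\in\widetilde{\mathcal X}^\otimes$, $$\Lambda^\otimes(f,\xi^\otimes)=\sum_{\widetilde{\alpha\beta}\in\xi^\otimes}\int f(x_1,y_1,\dots,x_k,y_k)\prod_{i=1}^k(\alpha\otimes\beta)(\mathrm dx_i\,\mathrm dy_i).$$ Fix a sequence $(f_r)_{r\in\mathbb N}$ dense in $\mathcal F^\otimes$ (for the uniform norm in each $\mathcal F_k^\otimes$). The metric on $\widetilde{\mathcal X}^\otimes$ is $$\mathbf D^\otimes(\xi_1^\otimes,\xi_2^\otimes)=\sum_{r=1}^\infty\frac1{2^r}\frac1{1+\|f_r\|_\infty}\big|\Lambda^\otimes(f_r,\xi_1^\otimes)-\Lambda^\otimes(f_r,\xi_2^\otimes)\big|.$$ Thus $\xi^\otimes_n\to\xi^\otimes$ iff $\Lambda^\otimes(f,\xi_n^\otimes)\to\Lambda^\otimes(f,\xi^\otimes)$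 for every $f\in\mathcal F^\otimes$. *)

theory Defs
  imports "HOL-Probability.Probability"
begin

section \<open>Orbits of product measures\<close>

definition prob_measures :: "(real^'d) measure set" where
  "prob_measures = {\<mu>. sets \<mu> = sets borel \<and> prob_space \<mu>}"

definition subprob_measures :: "(real^'d) measure set" where
  "subprob_measures = {\<mu>. sets \<mu> = sets borel \<and> subprob_space \<mu>}"

type_synonym 'd orbit = "((real^'d) \<times> (real^'d)) measure set"

definition diag_orbit :: "(real^'d) measure \<Rightarrow> (real^'d) measure \<Rightarrow> 'd orbit" where
  "diag_orbit \<mu> \<nu> = {(\<mu> \<star> return borel x) \<Otimes>\<^sub>M (\<nu> \<star> return borel x) | x. True}"

definition prob_orbits :: "'d::finite orbit set" where
  "prob_orbits = {diag_orbit \<mu> \<nu> | \<mu> \<nu>. \<mu> \<in> prob_measures \<and> \<nu> \<in> prob_measures}"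

text \<open>The orbit of the product measure with total mass zero.\<close>
definition trivial_orbit :: "'d::finite orbit" where
  "trivial_orbit = diag_orbit (null_measure borel) (null_measure borel)"


section \<open>Collections of orbits\<close>

text \<open>
  A countable collection of orbits may contain the same orbit several times; it is encoded by its
  multiplicity function.  The trivial orbit contributes zero to every functional below, so
  collections that differ only in the trivial orbit are identified (otherwise the distance below
  would not be a metric).  For a family with \<open>\<Sum>\<^sub>i \<alpha>\<^sub>i(\<real>\<^sup>d) \<le> 1\<close> and \<open>\<Sum>\<^sub>i \<beta>\<^sub>i(\<real>\<^sup>d) \<le> 1\<close>, the
  Cauchy-Schwarz inequality gives \<open>\<Sum>\<^sub>i sqrt (\<alpha>\<^sub>i(\<real>\<^sup>d) \<beta>\<^sub>i(\<real>\<^sup>d)) \<le> 1\<close>, so a nontrivial orbit occurs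
  only finitely often and the cardinality below is the one of a finite set.
\<close>
type_synonym 'd orbit_collection = "'d orbit \<Rightarrow> nat"

definition collection_of ::
    "nat set \<Rightarrow> (nat \<Rightarrow> (real^'d) measure) \<Rightarrow> (nat \<Rightarrow> (real^'d) measure) \<Rightarrow> 'd orbit_collection" where
  "collection_of I \<alpha> \<beta> =
     (\<lambda>p. if p = trivial_orbit then 0 else card {i\<in>I. diag_orbit (\<alpha> i) (\<beta> i) = p})"

text \<open>The index set is an arbitrary set of naturals: empty, finite or countably infinite.\<close>
definition orbit_collections :: "'d::finite orbit_collection set" where
  "orbit_collections = {collection_of I \<alpha> \<beta> | I \<alpha> \<beta>.
     (\<forall>i\<in>I. \<alpha> i \<in> subprob_measures \<and> \<beta> i \<in> subprob_measures) \<and>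
     (\<Sum>\<^sub>\<infinity>i\<in>I. emeasure (\<alpha> i) UNIV) \<le> 1 \<and>
     (\<Sum>\<^sub>\<infinity>i\<in>I. emeasure (\<beta> i) UNIV) \<le> 1}"

definition single_orbit :: "'d orbit \<Rightarrow> 'd orbit_collection" where
  "single_orbit p = (\<lambda>q. if q = p then 1 else 0)"


section \<open>Test functions\<close>

text \<open>
  A point of \<open>(\<real>\<^sup>2\<^sup>d)\<^sup>k\<close> is an extensional function \<open>z\<close> on \<open>{..<k}\<close> with \<open>z i = (x\<^sub>i, y\<^sub>i)\<close>.
  The values of a test function outside this domain are irrelevant.
\<close>
type_synonym 'd config = "nat \<Rightarrow> (real^'d) \<times> (real^'d)"

definition configs :: "nat \<Rightarrow> 'd config set" where
  "configs k = PiE {..<k} (\<lambda>_. UNIV)"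

definition spread :: "nat \<Rightarrow> 'd::finite config \<Rightarrow> real" where
  "spread k z = Max (\<Union>i<k. \<Union>j<k.
     {norm (fst (z i) - snd (z j)), norm (fst (z i) - fst (z j)), norm (snd (z i) - snd (z j))})"

definition test_functions :: "nat \<Rightarrow> ('d::finite config \<Rightarrow> real) set" where
  "test_functions k = {f.
     continuous_map (product_topology (\<lambda>_. euclidean) {..<k}) euclidean f \<and>
     (\<forall>z\<in>configs k. \<forall>a. f (\<lambda>i\<in>{..<k}. (fst (z i) + a, snd (z i) + a)) = f z) \<and>
     (\<forall>\<epsilon>>0. \<exists>R. \<forall>z\<in>configs k. spread k z \<ge> R \<longrightarrow> \<bar>f z\<bar> < \<epsilon>)}"

definition sup_norm :: "nat \<Rightarrow> ('d config \<Rightarrow> real) \<Rightarrow> real" where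
  "sup_norm k f = (SUP z\<in>configs k. \<bar>f z\<bar>)"

text \<open>The union of the spaces of test functions is disjoint, as the domains differ.\<close>
definition all_test_functions :: "(nat \<times> ('d::finite config \<Rightarrow> real)) set" where
  "all_test_functions = (SIGMA k:{1..}. test_functions k)"

definition dense_test_sequence :: "(nat \<Rightarrow> nat \<times> ('d::finite config \<Rightarrow> real)) \<Rightarrow> bool" where
  "dense_test_sequence F \<longleftrightarrow>
     range F \<subseteq> all_test_functions \<and>
     (\<forall>(k, g)\<in>all_test_functions. \<forall>\<epsilon>>0.
        \<exists>r. fst (F r) = k \<and> sup_norm k (\<lambda>z. snd (F r) z - g z) < \<epsilon>)"


section \<open>The functional and the distance\<close>

text \<open>By translation invariance, the choice of the representative of the orbit does not matter.\<close>
definition orbit_integral :: "nat \<Rightarrow> ('d config \<Rightarrow> real) \<Rightarrow> 'd::finite orbit \<Rightarrow> real" where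
  "orbit_integral k f p = (let \<gamma> = (SOME \<gamma>. \<gamma> \<in> p) in \<integral>z. f z \<partial>(PiM {..<k} (\<lambda>_. \<gamma>)))"

definition Lambda :: "nat \<times> ('d::finite config \<Rightarrow> real) \<Rightarrow> 'd orbit_collection \<Rightarrow> real" where
  "Lambda = (\<lambda>(k, f) \<xi>. \<Sum>\<^sub>\<infinity>p. real (\<xi> p) * orbit_integral k f p)"

text \<open>
  The sequence is indexed from 0, hence the weight \<open>1/2 ^ Suc r\<close>.  On \<open>orbit_collections\<close> the series
  converges absolutely; \<open>infsum\<close> instead of \<open>suminf\<close> makes the distance nonnegative also
  outside the carrier, which the locale \<open>Metric_space\<close> requires.
\<close>
definition orbit_dist ::
    "(nat \<Rightarrow> nat \<times> ('d::finite config \<Rightarrow> real)) \<Rightarrow> 'd orbit_collection \<Rightarrow> 'd orbit_collection \<Rightarrow> real" where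
  "orbit_dist F \<xi>1 \<xi>2 = (\<Sum>\<^sub>\<infinity>r. (1 / 2 ^ Suc r) * (1 / (1 + sup_norm (fst (F r)) (snd (F r)))) *
     \<bar>Lambda (F r) \<xi>1 - Lambda (F r) \<xi>2\<bar>)"

text \<open>The metric on probability orbits, each identified with its one-element collection.\<close>
definition prob_orbit_dist ::
    "(nat \<Rightarrow> nat \<times> ('d::finite config \<Rightarrow> real)) \<Rightarrow> 'd orbit \<Rightarrow> 'd orbit \<Rightarrow> real" where
  "prob_orbit_dist F p q = orbit_dist F (single_orbit p) (single_orbit q)"


section \<open>Compactification and completion\<close>

definition is_compactification :: "'a topology \<Rightarrow> 'b topology \<Rightarrow> ('a \<Rightarrow> 'b) \<Rightarrow> bool" where
  "is_compactification X Y h \<longleftrightarrow>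
     compact_space Y \<and> Hausdorff_space Y \<and> embedding_map X Y h \<and>
     Y closure_of (h ` topspace X) = topspace Y"

definition is_metric_completion ::
    "'a set \<Rightarrow> ('a \<Rightarrow> 'a \<Rightarrow> real) \<Rightarrow> 'b set \<Rightarrow> ('b \<Rightarrow> 'b \<Rightarrow> real) \<Rightarrow> ('a \<Rightarrow> 'b) \<Rightarrow> bool" where
  "is_metric_completion A d B e h \<longleftrightarrow>
     Metric_space A d \<and> Metric_space B e \<and> Metric_space.mcomplete B e \<and>
     h \<in> A \<rightarrow> B \<and> (\<forall>x\<in>A. \<forall>y\<in>A. e (h x) (h y) = d x y) \<and>
     Metric_space.mtopology B e closure_of (h ` A) = B"

end

theory Submission
  imports Defs
begin

text \<open>
  The functionals separate points: for a test function that depends on all points only relative to \<open>x\<close>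
  of a base point \<open>(x, y)\<close>, the functional of an orbit is an integral over the base point of a monomial in
  the profile of the measure seen from \<open>x\<close>. If two collections had the same functionals, the orbits in
  their difference would form a signed measure on profiles that vanishes on all polynomials; powers of a
  polynomial that is maximal at one profile isolate the orbit having that profile.

  For compactness, the unit cells of the integer lattice are ranked, for each \<open>n\<close>, by decreasing mass of
  \<open>\<mu> n + \<nu> n\<close> in their neighbourhoods, so that the mass near the cell of rank \<open>i\<close> is of order
  \<open>1 / (i + 1)\<close> uniformly in \<open>n\<close>. Along a diagonal subsequence the measures seen from the cell of each rank
  converge vaguely, and the cells of two ranks either keep a constant displacement or drift apart. One
  limit for each class of ranks at constant displacement gives the limit collection: the functionals are
  sums over cells, their tails are uniformly small because of the ranking, and the terms converge.

  For density, the members of a collection are placed at mutual distances that tend to infinity.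
\<close>

section \<open>Powers of finite measures\<close>

text \<open>The obstacle is the translation group: a test function is constant along diagonal
  translations and so does not vanish at infinity, and vague limits of \<mu> n and \<nu> n say
  nothing about its integrals. A lattice partition of unity in x of the first pair of a
  configuration repairs this: each piece of a test function vanishes at infinity, and the piece at a
  cell only sees the measures recentred there. It remains to control infinitely many pieces
  uniformly in n. Where the points of a configuration are far apart, the test function is small;
  otherwise y lies in a fixed neighbourhood of the cell of x, and the mass of \<nu> n there is small
  once the rank of the cell is large. This is why the ranking uses neighbourhoods of cells and both
  measures at once. Mass that no limit captures drifts to cells of ever higher rank and contributes
  nothing, which is why the limits are sub-probability measures. Vague limits are realised by
  couplings in which every point either converges or escapes to infinity, so that integrals converge
  by dominated convergence.\<close>

definition power_integral :: "nat \<Rightarrow> ((nat \<Rightarrow> 'a) \<Rightarrow> real) \<Rightarrow> 'a measure \<Rightarrow> real" where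
  "power_integral k f \<gamma> = (\<integral>z. f z \<partial>(PiM {..<k} (\<lambda>_. \<gamma>)))"

lemma prod_indicator_eq:
  "finite I \<Longrightarrow> (\<Prod>i\<in>I. indicator (A i) (x i)) = (indicator {x. \<forall>i\<in>I. x i \<in> A i} x :: 'b::comm_semiring_1)"
  by (induction I rule: finite_induct) (auto simp: indicator_def split: if_splits)

lemma product_sigma_finite_const:
  "finite_measure \<gamma> \<Longrightarrow> product_sigma_finite (\<lambda>_. \<gamma>)"
  by (simp add: product_sigma_finite_def finite_measure.axioms(1))

lemma emeasure_PiM_space_const:
  assumes "finite_measure \<gamma>"
  shows "emeasure (PiM {..<k} (\<lambda>_. \<gamma>)) (space (PiM {..<k} (\<lambda>_. \<gamma>))) = emeasure \<gamma> (space \<gamma>) ^ k"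
proof -
  interpret product_sigma_finite "\<lambda>_. \<gamma>" by (rule product_sigma_finite_const) fact
  show ?thesis by (simp add: space_PiM emeasure_PiM)
qed

lemma finite_measure_PiM_const:
  fixes k :: nat
  assumes "finite_measure \<gamma>"
  shows "finite_measure (PiM {..<k} (\<lambda>_. \<gamma>))"
proof
  have "emeasure \<gamma> (space \<gamma>) ^ k < \<infinity>"
    using finite_measure.emeasure_finite[OF assms]
    by (induction k) (auto simp: ennreal_mult_eq_top_iff less_top[symmetric])
  then show "emeasure (PiM {..<k} (\<lambda>_. \<gamma>)) (space (PiM {..<k} (\<lambda>_. \<gamma>))) \<noteq> \<infinity>"
    unfolding emeasure_PiM_space_const[OF assms] by simp
qed

lemma measure_PiM_space_const:
  assumes "finite_measure \<gamma>"
  shows "measure (PiM {..<k} (\<lambda>_. \<gamma>)) (space (PiM {..<k} (\<lambda>_. \<gamma>))) = measure \<gamma> (space \<gamma>) ^ k"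
  using emeasure_PiM_space_const[OF assms, of k]
  by (simp add: finite_measure.emeasure_eq_measure[OF assms] ennreal_power
      finite_measure.emeasure_eq_measure[OF finite_measure_PiM_const[OF assms]])

text \<open>A measure restricted to C and pushed forward by Z is the common shape of the measures
  below: vague limits lose the mass outside C, a labelled measure is cut down to one label, and C =
  \<open>space N\<close> gives plain images.\<close>

lemma emeasure_distr_density:
  assumes [measurable]: "C \<in> sets N" "Z \<in> measurable N B" "A \<in> sets B"
  shows "emeasure (distr (density N (indicator C)) B Z) A = emeasure N (C \<inter> (Z -` A \<inter> space N))"
proof -
  have "emeasure (distr (density N (indicator C)) B Z) A = (\<integral>\<^sup>+w. indicator C w * indicator (Z -` A \<inter> space N) w \<partial>N)"
    by (subst emeasure_distr, simp, simp, subst emeasure_density) auto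
  also have "\<dots> = emeasure N (C \<inter> (Z -` A \<inter> space N))"
    by (subst indicator_inter_arith[symmetric], subst nn_integral_indicator) auto
  finally show ?thesis .
qed

lemma finite_measure_distr_density:
  assumes N: "finite_measure N" and [measurable]: "C \<in> sets N" "Z \<in> measurable N B"
  shows "finite_measure (distr (density N (indicator C)) B Z)"
proof
  show "emeasure (distr (density N (indicator C)) B Z) (space (distr (density N (indicator C)) B Z)) \<noteq> \<infinity>"
    using N by (subst emeasure_distr_density) (simp_all add: finite_measure.emeasure_finite)
qed

text \<open>Both sides agree on boxes: the restriction to C turns into a product of indicators, one
  per coordinate, and Fubini factorises it. Integrals against powers of \<gamma> thereby become
  integrals over powers of the fixed space N, where different restrictions and maps can be compared
  pointwise.\<close>

lemma PiM_distr_density: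
  fixes N :: "'a measure" and B :: "'b measure"
  assumes N: "finite_measure N" and C: "C \<in> sets N" and Z: "Z \<in> measurable N B" and I: "finite I"
  defines "\<gamma> \<equiv> distr (density N (indicator C)) B Z"
  shows "PiM I (\<lambda>_. \<gamma>) =
    distr (density (PiM I (\<lambda>_. N)) (\<lambda>w. \<Prod>i\<in>I. indicator C (w i))) (PiM I (\<lambda>_. B)) (\<lambda>w. \<lambda>i\<in>I. Z (w i))"
proof -
  note [measurable] = C Z
  interpret N: finite_measure N by fact
  interpret PN: product_sigma_finite "\<lambda>_. N" by (rule product_sigma_finite_const) fact
  have em: "emeasure \<gamma> A = emeasure N (C \<inter> (Z -` A \<inter> space N))" if [measurable]: "A \<in> sets B" for A
    unfolding \<gamma>_def by (rule emeasure_distr_density) measurable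
  have fin: "finite_measure \<gamma>"
    unfolding \<gamma>_def using N C Z by (rule finite_measure_distr_density)
  interpret P: product_sigma_finite "\<lambda>_. \<gamma>" by (rule product_sigma_finite_const) fact
  have sB: "sets \<gamma> = sets B" by (simp add: \<gamma>_def)
  have m[measurable]: "(\<lambda>w. \<lambda>i\<in>I. Z (w i)) \<in> measurable (PiM I (\<lambda>_. N)) (PiM I (\<lambda>_. B))"
    by (rule measurable_restrict) measurable
  show ?thesis
  proof (rule P.PiM_eqI[symmetric])
    show "sets (distr (density (PiM I (\<lambda>_. N)) (\<lambda>w. \<Prod>i\<in>I. indicator C (w i))) (PiM I (\<lambda>_. B)) (\<lambda>w. \<lambda>i\<in>I. Z (w i)))
      = sets (PiM I (\<lambda>_. \<gamma>))"
      by (simp cong: sets_PiM_cong add: sB)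
    fix A :: "_ \<Rightarrow> 'b set" assume "\<And>i. i \<in> I \<Longrightarrow> A i \<in> sets \<gamma>"
    then have A[measurable]: "\<And>i. i \<in> I \<Longrightarrow> A i \<in> sets B" by (simp add: sB)
    have [measurable]: "Pi\<^sub>E I A \<in> sets (PiM I (\<lambda>_. B))" using A I by (auto intro: sets_PiM_I_finite)
    have "emeasure (distr (density (PiM I (\<lambda>_. N)) (\<lambda>w. \<Prod>i\<in>I. indicator C (w i))) (PiM I (\<lambda>_. B)) (\<lambda>w. \<lambda>i\<in>I. Z (w i))) (Pi\<^sub>E I A)
      = (\<integral>\<^sup>+w. (\<Prod>i\<in>I. indicator C (w i)) * indicator ((\<lambda>w. \<lambda>i\<in>I. Z (w i)) -` Pi\<^sub>E I A \<inter> space (PiM I (\<lambda>_. N))) w \<partial>PiM I (\<lambda>_. N))"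
      by (subst emeasure_distr, simp, simp, subst emeasure_density) (auto intro!: borel_measurable_prod_ennreal)
    also have "\<dots> = (\<integral>\<^sup>+w. (\<Prod>i\<in>I. indicator (C \<inter> (Z -` A i \<inter> space N)) (w i)) \<partial>PiM I (\<lambda>_. N))"
      by (rule nn_integral_cong) (use I in \<open>auto simp: prod_indicator_eq indicator_def space_PiM PiE_iff\<close>)
    also have "\<dots> = (\<Prod>i\<in>I. emeasure N (C \<inter> (Z -` A i \<inter> space N)))"
      using I by (subst PN.product_nn_integral_prod) (auto intro!: prod.cong)
    finally show "emeasure (distr (density (PiM I (\<lambda>_. N)) (\<lambda>w. \<Prod>i\<in>I. indicator C (w i))) (PiM I (\<lambda>_. B)) (\<lambda>w. \<lambda>i\<in>I. Z (w i))) (Pi\<^sub>E I A) = (\<Prod>i\<in>I. emeasure \<gamma> (A i))"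
      by (simp add: em A)
  qed fact
qed

lemma integral_PiM_distr_density:
  fixes N :: "'a measure" and B :: "'b measure" and f :: "_ \<Rightarrow> real"
  assumes N: "finite_measure N" and C: "C \<in> sets N" and Z: "Z \<in> measurable N B" and I: "finite I"
    and f: "f \<in> borel_measurable (PiM I (\<lambda>_. B))"
  shows "(\<integral>z. f z \<partial>PiM I (\<lambda>_. distr (density N (indicator C)) B Z)) =
    (\<integral>w. (\<Prod>i\<in>I. indicator C (w i)) * f (\<lambda>i\<in>I. Z (w i)) \<partial>PiM I (\<lambda>_. N))"
proof -
  note [measurable] = C Z f
  have m[measurable]: "(\<lambda>w. \<lambda>i\<in>I. Z (w i)) \<in> measurable (PiM I (\<lambda>_. N)) (PiM I (\<lambda>_. B))"
    by (rule measurable_restrict) measurable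
  have ind: "(\<Prod>i\<in>I. indicator C (w i)) = ennreal (\<Prod>i\<in>I. indicator C (w i))" for w
    by (simp add: prod_ennreal[symmetric] ennreal_indicator)
  show ?thesis
    unfolding PiM_distr_density[OF N C Z I] ind
    by (subst integral_distr, simp, simp, subst integral_density) (auto intro!: prod_nonneg)
qed

text \<open>The same reduction for the product of two marginals; agreement on rectangles suffices
  because both factors are sigma-finite.\<close>

lemma pair_distr_density:
  assumes M: "finite_measure M" and N: "finite_measure N" and A: "A \<in> sets M" and B: "B \<in> sets N"
    and X: "X \<in> measurable M S" and Y: "Y \<in> measurable N T"
  shows "distr (density M (indicator A)) S X \<Otimes>\<^sub>M distr (density N (indicator B)) T Y =
    distr (density (M \<Otimes>\<^sub>M N) (indicator (A \<times> B))) (S \<Otimes>\<^sub>M T) (\<lambda>(a, b). (X a, Y b))"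
proof -
  note [measurable] = A B X Y
  interpret M: finite_measure M by fact
  interpret N: finite_measure N by fact
  have em: "emeasure (distr (density M (indicator A)) S X) U = emeasure M (A \<inter> (X -` U \<inter> space M))" if [measurable]: "U \<in> sets S" for U
    by (rule emeasure_distr_density) measurable
  have en: "emeasure (distr (density N (indicator B)) T Y) U = emeasure N (B \<inter> (Y -` U \<inter> space N))" if [measurable]: "U \<in> sets T" for U
    by (rule emeasure_distr_density) measurable
  have f1: "finite_measure (distr (density M (indicator A)) S X)"
    using M A X by (rule finite_measure_distr_density)
  have f2: "finite_measure (distr (density N (indicator B)) T Y)"
    using N B Y by (rule finite_measure_distr_density)
  show ?thesis
  proof (rule pair_measure_eqI)
    show "sigma_finite_measure (distr (density M (indicator A)) S X)" "sigma_finite_measure (distr (density N (indicator B)) T Y)"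
      using f1 f2 by (auto simp: finite_measure_def)
    show "sets (distr (density M (indicator A)) S X \<Otimes>\<^sub>M distr (density N (indicator B)) T Y) =
      sets (distr (density (M \<Otimes>\<^sub>M N) (indicator (A \<times> B))) (S \<Otimes>\<^sub>M T) (\<lambda>(a, b). (X a, Y b)))"
      unfolding sets_distr by (rule sets_pair_measure_cong) simp_all
    fix U V assume "U \<in> sets (distr (density M (indicator A)) S X)" "V \<in> sets (distr (density N (indicator B)) T Y)"
    then have [measurable]: "U \<in> sets S" "V \<in> sets T" by auto
    have "emeasure (distr (density (M \<Otimes>\<^sub>M N) (indicator (A \<times> B))) (S \<Otimes>\<^sub>M T) (\<lambda>(a, b). (X a, Y b))) (U \<times> V)
      = (\<integral>\<^sup>+w. indicator (A \<times> B) w * indicator ((\<lambda>(a, b). (X a, Y b)) -` (U \<times> V) \<inter> space (M \<Otimes>\<^sub>M N)) w \<partial>(M \<Otimes>\<^sub>M N))"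
      by (subst emeasure_distr, simp, simp, subst emeasure_density) auto
    also have "\<dots> = (\<integral>\<^sup>+w. indicator ((A \<inter> (X -` U \<inter> space M)) \<times> (B \<inter> (Y -` V \<inter> space N))) w \<partial>(M \<Otimes>\<^sub>M N))"
      by (rule nn_integral_cong) (auto simp: indicator_def space_pair_measure)
    also have "\<dots> = emeasure M (A \<inter> (X -` U \<inter> space M)) * emeasure N (B \<inter> (Y -` V \<inter> space N))"
      by (subst nn_integral_indicator) (auto simp: N.emeasure_pair_measure_Times)
    finally show "emeasure (distr (density M (indicator A)) S X) U * emeasure (distr (density N (indicator B)) T Y) V =
      emeasure (distr (density (M \<Otimes>\<^sub>M N) (indicator (A \<times> B))) (S \<Otimes>\<^sub>M T) (\<lambda>(a, b). (X a, Y b))) (U \<times> V)"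
      by (simp add: em en)
  qed
qed

text \<open>Presents an unrestricted image as the case C = \<open>space M\<close> of the preceding
  lemmas.\<close>

lemma density_indicator_space: "density M (indicator (space M)) = M"
proof (rule measure_eqI)
  fix A assume "A \<in> sets (density M (indicator (space M)))"
  then have [measurable]: "A \<in> sets M" by simp
  have "emeasure (density M (indicator (space M))) A = (\<integral>\<^sup>+x. indicator A x \<partial>M)"
    by (subst emeasure_density) (measurable, intro nn_integral_cong, simp add: indicator_def)
  then show "emeasure (density M (indicator (space M))) A = emeasure M A" by simp
qed simp

section \<open>Test functions and orbits\<close>

type_synonym 'd pt = "(real^'d) \<times> (real^'d)"

definition shift_pair :: "real^'d \<Rightarrow> 'd pt \<Rightarrow> 'd::finite pt" where
  "shift_pair a = (\<lambda>(x, y). (x + a, y + a))"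

lemma measurable_shift_pair[measurable]: "shift_pair a \<in> borel_measurable borel"
proof -
  have "continuous_on UNIV (shift_pair a)"
    unfolding shift_pair_def case_prod_unfold by (intro continuous_intros)
  then show ?thesis by (rule borel_measurable_continuous_onI)
qed

text \<open>Precomposition with the restriction to \<open>{..<k}\<close> extends f to a continuous
  function of all sequences. Points of the power of the Borel space are constantly
  \<open>undefined\<close> beyond k, so the restriction does not change them, and their inclusion
  into the sequences is measurable coordinate by coordinate.\<close>

lemma continuous_map_imp_borel_measurable_PiM:
  fixes f :: "(nat \<Rightarrow> 'a::second_countable_topology) \<Rightarrow> real"
  assumes f: "continuous_map (product_topology (\<lambda>_. euclidean) {..<k}) euclidean f"
  shows "f \<in> borel_measurable (PiM {..<k} (\<lambda>_. borel))"
proof -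
  have r: "continuous_map euclidean (product_topology (\<lambda>_. euclidean) {..<k}) (\<lambda>w::nat \<Rightarrow> 'a. restrict w {..<k})"
    unfolding continuous_map_componentwise euclidean_product_topology[symmetric]
    by (auto intro!: continuous_intros simp: continuous_on_product_coordinates)
  have "continuous_on UNIV (\<lambda>w. f (restrict w {..<k}))"
    using continuous_map_compose[OF r f] by (simp add: o_def)
  then have [measurable]: "(\<lambda>w. f (restrict w {..<k})) \<in> borel_measurable borel"
    by (rule borel_measurable_continuous_onI)
  have [measurable]: "(\<lambda>z. z) \<in> measurable (PiM {..<k} (\<lambda>_. borel)) (borel :: (nat \<Rightarrow> 'a) measure)"
  proof (rule measurable_coordinatewise_then_product)
    fix i
    show "(\<lambda>z. z i) \<in> borel_measurable (PiM {..<k} (\<lambda>_. borel :: 'a measure))"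
    proof (cases "i < k")
      case False
      then have "z i = undefined" if "z \<in> space (PiM {..<k} (\<lambda>_. borel :: 'a measure))" for z
        using that by (auto simp: space_PiM PiE_def extensional_def)
      then show ?thesis by (subst measurable_cong[where g="\<lambda>_. undefined"]) auto
    qed simp
  qed
  have "(\<lambda>z. f (restrict z {..<k})) \<in> borel_measurable (PiM {..<k} (\<lambda>_. borel))" by measurable
  then show ?thesis
    by (subst measurable_cong[where g="\<lambda>z. f (restrict z {..<k})"]) (auto simp: space_PiM PiE_restrict)
qed

lemma finite_spread_set:
  fixes z :: "'d::finite config"
  shows "finite (\<Union>i<k. \<Union>j<k.
     {norm (fst (z i) - snd (z j)), norm (fst (z i) - fst (z j)), norm (snd (z i) - snd (z j))})"
  by auto

lemma spread_ge:
  fixes z :: "'d::finite config"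
  assumes "i < k" "j < k"
  shows "norm (fst (z i) - snd (z j)) \<le> spread k z"
    and "norm (fst (z i) - fst (z j)) \<le> spread k z"
    and "norm (snd (z i) - snd (z j)) \<le> spread k z"
  unfolding spread_def by (rule Max_ge[OF finite_spread_set]; use assms in blast)+

text \<open>Where the spread is at least R, vanishing at infinity gives the bound 1. Elsewhere a
  diagonal translation moves the first x to the origin and all points into the ball of radius R, so
  that compactness applies.\<close>

lemma test_function_bounded:
  fixes f :: "'d::finite config \<Rightarrow> real"
  assumes f: "f \<in> test_functions k"
  obtains B where "B > 0" "\<And>z. z \<in> configs k \<Longrightarrow> \<bar>f z\<bar> \<le> B"
\<comment> \<open>For k = 0 the \<open>Max\<close> in \<open>spread\<close> is over the empty set
  and there is no first point to move to the origin, but there is only one configuration.\<close>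
proof (cases "k = 0")
  case True
  then have "(configs k :: 'd config set) = {\<lambda>_. undefined}" by (simp add: configs_def)
  then show ?thesis by (intro that[of "\<bar>f (\<lambda>_. undefined)\<bar> + 1"]) auto
next
  case False
  then have k: "0 < k" by simp
  have cont: "continuous_map (product_topology (\<lambda>_. euclidean) {..<k}) euclidean f"
    and inv: "\<And>z a. z \<in> configs k \<Longrightarrow> f (\<lambda>i\<in>{..<k}. (fst (z i) + a, snd (z i) + a)) = f z"
    and van: "\<And>\<epsilon>. \<epsilon> > 0 \<Longrightarrow> \<exists>R. \<forall>z\<in>configs k. spread k z \<ge> R \<longrightarrow> \<bar>f z\<bar> < \<epsilon>"
    using f unfolding test_functions_def by auto
  obtain R where R: "\<And>z. z \<in> configs k \<Longrightarrow> spread k z \<ge> R \<Longrightarrow> \<bar>f z\<bar> < 1" using van[of 1] by auto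
  define K :: "'d config set" where "K = PiE {..<k} (\<lambda>_. cball 0 R \<times> cball 0 R)"
  have "compactin (product_topology (\<lambda>_. euclidean) {..<k}) K"
    unfolding K_def using compact_Times[OF compact_cball compact_cball, of "0::real^'d" R "0::real^'d" R]
    by (simp only: compactin_PiE compactin_euclidean_iff simp_thms ball_triv) blast?
  then have "compactin euclidean (f ` K)" by (rule image_compactin) (fact cont)
  then have "bounded (f ` K)" by (simp add: compact_imp_bounded)
  then obtain B where B: "\<And>z. z \<in> K \<Longrightarrow> \<bar>f z\<bar> \<le> B" by (auto simp: bounded_iff)
  show ?thesis
  proof (rule that[of "max B 1"])
    fix z :: "'d config" assume z: "z \<in> configs k"
    show "\<bar>f z\<bar> \<le> max B 1"
    proof (cases "spread k z \<ge> R")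
      case True then show ?thesis using R[OF z] by auto
    next
      case False
      have "(\<lambda>i\<in>{..<k}. (fst (z i) + - fst (z 0), snd (z i) + - fst (z 0))) \<in> K"
      proof -
        have "norm (fst (z i) - fst (z 0)) \<le> R" "norm (snd (z i) - fst (z 0)) \<le> R" if "i < k" for i
          using spread_ge(2)[OF that k, of z] spread_ge(1)[OF k that, of z] False
          by (auto simp: norm_minus_commute)
        then show ?thesis by (auto simp: K_def)
      qed
      from B[OF this] show ?thesis using inv[OF z, of "- fst (z 0)"] by auto
    qed
  qed simp
qed

lemma test_function_measurable:
  "f \<in> test_functions k \<Longrightarrow> f \<in> borel_measurable (PiM {..<k} (\<lambda>_. borel))"
  unfolding test_functions_def by (auto intro: continuous_map_imp_borel_measurable_PiM)

lemma abs_le_sup_norm: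
  assumes "f \<in> test_functions k" "z \<in> configs k"
  shows "\<bar>f z\<bar> \<le> sup_norm k f"
  unfolding sup_norm_def
proof (rule cSUP_upper[OF assms(2)])
  obtain B where "B > 0" "\<And>z. z \<in> configs k \<Longrightarrow> \<bar>f z\<bar> \<le> B" using test_function_bounded[OF assms(1)] by blast
  then show "bdd_above ((\<lambda>z. \<bar>f z\<bar>) ` configs k)" by (auto intro!: bdd_aboveI[of _ B])
qed

lemma space_PiM_borel: "sets \<gamma> = sets borel \<Longrightarrow> space (PiM {..<k} (\<lambda>_. \<gamma>)) = configs k"
  using sets_eq_imp_space_eq[of \<gamma> borel] by (simp add: space_PiM configs_def)

text \<open>The integral is at most B times the k-th power of the mass. For k \<ge> 1 and mass at
  most 1 this is linear in the mass, which makes the sums over a whole collection converge.\<close>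

lemma power_integral_bound:
  fixes \<gamma> :: "'d::finite pt measure"
  assumes \<gamma>: "finite_measure \<gamma>" "sets \<gamma> = sets borel" "measure \<gamma> UNIV \<le> 1" and "k \<ge> 1" and "B \<ge> 0"
    and B: "\<And>z. z \<in> configs k \<Longrightarrow> \<bar>f z\<bar> \<le> B"
  shows "\<bar>power_integral k f \<gamma>\<bar> \<le> B * measure \<gamma> UNIV"
proof -
  let ?P = "PiM {..<k} (\<lambda>_. \<gamma>)"
  interpret P: finite_measure ?P by (rule finite_measure_PiM_const) fact
  have sp: "space \<gamma> = UNIV" using sets_eq_imp_space_eq[OF \<gamma>(2)] by simp
  have "\<bar>power_integral k f \<gamma>\<bar> \<le> (\<integral>z. B \<partial>?P)"
  \<comment> \<open>f is an arbitrary bounded function here; if it is not integrable, its integral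
    is 0 by convention.\<close>
  proof (cases "integrable ?P f")
    case True
    have "\<bar>power_integral k f \<gamma>\<bar> \<le> (\<integral>z. \<bar>f z\<bar> \<partial>?P)"
      unfolding power_integral_def by (rule integral_abs_bound)
    also have "\<dots> \<le> (\<integral>z. B \<partial>?P)"
      using True B space_PiM_borel[OF \<gamma>(2), of k] by (intro integral_mono) auto
    finally show ?thesis .
  qed (simp add: power_integral_def not_integrable_integral_eq \<open>B \<ge> 0\<close>)
  also have "\<dots> = B * measure \<gamma> UNIV ^ k"
    using measure_PiM_space_const[OF \<gamma>(1), of k] by (simp add: sp)
  also have "\<dots> \<le> B * measure \<gamma> UNIV"
  proof -
    have "measure \<gamma> UNIV ^ k \<le> measure \<gamma> UNIV ^ 1"
      using \<gamma>(3) \<open>k \<ge> 1\<close> by (intro power_decreasing) auto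
    then show ?thesis using \<open>B \<ge> 0\<close> by (simp add: mult_left_mono)
  qed
  finally show ?thesis .
qed

text \<open>Diagonal invariance of f makes the functional independent of the representative of an
  orbit.\<close>

lemma power_integral_shift:
  fixes \<gamma> :: "'d::finite pt measure"
  assumes \<gamma>: "finite_measure \<gamma>" "sets \<gamma> = sets borel" and f: "f \<in> test_functions k"
  shows "power_integral k f (distr \<gamma> borel (shift_pair a)) = power_integral k f \<gamma>"
proof -
  have [measurable_cong]: "sets \<gamma> = sets borel" by fact
  have sp: "space \<gamma> = UNIV" using sets_eq_imp_space_eq[OF \<gamma>(2)] by simp
  have "power_integral k f (distr \<gamma> borel (shift_pair a)) =
    power_integral k f (distr (density \<gamma> (indicator (space \<gamma>))) borel (shift_pair a))"
    by (simp add: density_indicator_space)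
  also have "\<dots> = (\<integral>w. f (\<lambda>i\<in>{..<k}. shift_pair a (w i)) \<partial>PiM {..<k} (\<lambda>_. \<gamma>))"
    unfolding power_integral_def
    by (subst integral_PiM_distr_density) (auto simp: \<gamma> test_function_measurable[OF f] sp)
  also have "\<dots> = power_integral k f \<gamma>"
    unfolding power_integral_def
    by (rule Bochner_Integration.integral_cong) (use f in \<open>auto simp: space_PiM_borel[OF \<gamma>(2)] test_functions_def shift_pair_def case_prod_unfold\<close>)
  finally show ?thesis .
qed

section \<open>Sub-probability measures and their diagonal orbits\<close>

lemma subprob_measuresD:
  assumes "\<mu> \<in> subprob_measures"
  shows "finite_measure \<mu>" "sets \<mu> = sets borel" "space \<mu> = UNIV" "measure \<mu> UNIV \<le> 1"
proof -
  show s: "sets \<mu> = sets borel" and "space \<mu> = UNIV"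
    using assms sets_eq_imp_space_eq[of \<mu> borel] by (auto simp: subprob_measures_def)
  interpret subprob_space \<mu> using assms by (simp add: subprob_measures_def)
  show "finite_measure \<mu>" by unfold_locales
  show "measure \<mu> UNIV \<le> 1" by (rule subprob_measure_le_1)
qed

lemma subprob_measuresI:
  assumes "finite_measure \<mu>" "sets \<mu> = sets borel" "measure \<mu> UNIV \<le> 1"
  shows "\<mu> \<in> subprob_measures"
proof -
  have sp: "space \<mu> = UNIV" using sets_eq_imp_space_eq[OF assms(2)] by simp
  have "subprob_space \<mu>"
    by (rule subprob_spaceI) (auto simp: sp finite_measure.emeasure_eq_measure[OF assms(1)] assms(3))
  then show ?thesis using assms by (simp add: subprob_measures_def)
qed

lemma prob_measures_subprob: "prob_measures \<subseteq> subprob_measures"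
  by (auto simp: prob_measures_def subprob_measures_def prob_space_imp_subprob_space)

lemma pair_subprob:
  fixes \<mu> \<nu> :: "(real^'d::finite) measure"
  assumes "\<mu> \<in> subprob_measures" "\<nu> \<in> subprob_measures"
  shows "finite_measure (\<mu> \<Otimes>\<^sub>M \<nu>)" "sets (\<mu> \<Otimes>\<^sub>M \<nu>) = sets borel"
    "measure (\<mu> \<Otimes>\<^sub>M \<nu>) UNIV = measure \<mu> UNIV * measure \<nu> UNIV"
    "measure (\<mu> \<Otimes>\<^sub>M \<nu>) UNIV \<le> 1" "measure (\<mu> \<Otimes>\<^sub>M \<nu>) UNIV \<le> measure \<mu> UNIV"
proof -
  note m = subprob_measuresD[OF assms(1)] and n = subprob_measuresD[OF assms(2)]
  interpret \<mu>: finite_measure \<mu> by fact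
  interpret \<nu>: finite_measure \<nu> by fact
  show "finite_measure (\<mu> \<Otimes>\<^sub>M \<nu>)" using m n by (intro finite_measure_pair_measure)
  show "sets (\<mu> \<Otimes>\<^sub>M \<nu>) = sets borel"
    unfolding borel_prod[symmetric] by (rule sets_pair_measure_cong) (simp_all add: m n)
  show *: "measure (\<mu> \<Otimes>\<^sub>M \<nu>) UNIV = measure \<mu> UNIV * measure \<nu> UNIV"
    using \<nu>.emeasure_pair_measure_Times[of UNIV \<mu> UNIV] m n sets.top[of \<mu>] sets.top[of \<nu>]
    by (simp add: measure_def enn2real_mult)
  show "measure (\<mu> \<Otimes>\<^sub>M \<nu>) UNIV \<le> 1" unfolding * using m n by (simp add: mult_le_one)
  show "measure (\<mu> \<Otimes>\<^sub>M \<nu>) UNIV \<le> measure \<mu> UNIV" unfolding * using m n by (simp add: mult_left_le)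
qed

lemma convolution_return:
  fixes \<mu> :: "(real^'d::finite) measure"
  assumes "\<mu> \<in> subprob_measures"
  shows "\<mu> \<star> return borel x = distr \<mu> borel (\<lambda>a. a + x)"
proof (rule measure_eqI)
  note m = subprob_measuresD[OF assms]
  note [measurable_cong] = m(2)
  fix A assume "A \<in> sets (\<mu> \<star> return borel x)"
  then have [measurable]: "A \<in> sets borel" by simp
  have "emeasure (\<mu> \<star> return borel x) A = (\<integral>\<^sup>+a. \<integral>\<^sup>+y. indicator A (a + y) \<partial>return borel x \<partial>\<mu>)"
    by (rule convolution_emeasure') (auto simp: m intro!: prob_space.finite_measure prob_space_return)
  also have "\<dots> = (\<integral>\<^sup>+a. indicator A (a + x) \<partial>\<mu>)"
    by (intro nn_integral_cong) (simp add: nn_integral_return)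
  also have "\<dots> = (\<integral>\<^sup>+a. indicator ((\<lambda>a. a + x) -` A \<inter> space \<mu>) a \<partial>\<mu>)"
    by (intro nn_integral_cong) (auto simp: indicator_def m)
  also have "\<dots> = emeasure (distr \<mu> borel (\<lambda>a. a + x)) A"
    by (simp add: emeasure_distr)
  finally show "emeasure (\<mu> \<star> return borel x) A = emeasure (distr \<mu> borel (\<lambda>a. a + x)) A" .
qed simp

lemma diag_orbit_eq:
  fixes \<mu> \<nu> :: "(real^'d::finite) measure"
  assumes "\<mu> \<in> subprob_measures" "\<nu> \<in> subprob_measures"
  shows "diag_orbit \<mu> \<nu> = range (\<lambda>x. distr (\<mu> \<Otimes>\<^sub>M \<nu>) borel (shift_pair x))"
proof -
  note m = subprob_measuresD[OF assms(1)] and n = subprob_measuresD[OF assms(2)]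
  note [measurable_cong] = m(2) n(2)
  have "(\<mu> \<star> return borel x) \<Otimes>\<^sub>M (\<nu> \<star> return borel x) = distr (\<mu> \<Otimes>\<^sub>M \<nu>) borel (shift_pair x)" for x
  proof -
    have "distr (density \<mu> (indicator (space \<mu>))) borel (\<lambda>a. a + x) \<Otimes>\<^sub>M distr (density \<nu> (indicator (space \<nu>))) borel (\<lambda>a. a + x)
      = distr (density (\<mu> \<Otimes>\<^sub>M \<nu>) (indicator (space \<mu> \<times> space \<nu>))) (borel \<Otimes>\<^sub>M borel) (\<lambda>(a, b). (a + x, b + x))"
      by (rule pair_distr_density) (use m n in auto)
    then show ?thesis
      by (simp add: density_indicator_space space_pair_measure[symmetric] convolution_return assms borel_prod shift_pair_def)
  qed
  then show ?thesis by (auto simp: diag_orbit_def)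
qed

text \<open>Isolates the choice made inside \<open>orbit_integral\<close>; for an orbit of
  sub-probability measures it is an unknown translate of the product measure.\<close>

definition orbit_rep :: "'d orbit \<Rightarrow> 'd::finite pt measure" where
  "orbit_rep p = (SOME \<gamma>. \<gamma> \<in> p)"

lemma orbit_integral_rep: "orbit_integral k f p = power_integral k f (orbit_rep p)"
  by (simp add: orbit_integral_def power_integral_def orbit_rep_def)

lemma orbit_rep_diag_orbit:
  fixes \<mu> \<nu> :: "(real^'d::finite) measure"
  assumes "\<mu> \<in> subprob_measures" "\<nu> \<in> subprob_measures"
  obtains x where "orbit_rep (diag_orbit \<mu> \<nu>) = distr (\<mu> \<Otimes>\<^sub>M \<nu>) borel (shift_pair x)"
proof -
  have "orbit_rep (diag_orbit \<mu> \<nu>) \<in> diag_orbit \<mu> \<nu>"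
    unfolding orbit_rep_def by (rule someI_ex) (auto simp: diag_orbit_eq[OF assms])
  then show ?thesis using that by (auto simp: diag_orbit_eq[OF assms])
qed

definition orbit_mass :: "'d::finite orbit \<Rightarrow> real" where
  "orbit_mass p = measure (orbit_rep p) UNIV"

lemma
  fixes \<mu> \<nu> :: "(real^'d::finite) measure"
  assumes \<mu>: "\<mu> \<in> subprob_measures" and \<nu>: "\<nu> \<in> subprob_measures"
  shows orbit_integral_diag_orbit:
      "f \<in> test_functions k \<Longrightarrow> orbit_integral k f (diag_orbit \<mu> \<nu>) = power_integral k f (\<mu> \<Otimes>\<^sub>M \<nu>)"
    and orbit_mass_diag_orbit: "orbit_mass (diag_orbit \<mu> \<nu>) = measure \<mu> UNIV * measure \<nu> UNIV"
    and finite_measure_orbit_rep: "finite_measure (orbit_rep (diag_orbit \<mu> \<nu>))"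
    and sets_orbit_rep: "sets (orbit_rep (diag_orbit \<mu> \<nu>)) = sets borel"
proof -
  note pm = pair_subprob[OF assms]
  have [measurable_cong]: "sets (\<mu> \<Otimes>\<^sub>M \<nu>) = sets borel" by fact
  have sp: "space (\<mu> \<Otimes>\<^sub>M \<nu>) = UNIV" using sets_eq_imp_space_eq[OF pm(2)] by simp
  obtain x where x: "orbit_rep (diag_orbit \<mu> \<nu>) = distr (\<mu> \<Otimes>\<^sub>M \<nu>) borel (shift_pair x)"
    using orbit_rep_diag_orbit[OF assms] by blast
  show "f \<in> test_functions k \<Longrightarrow> orbit_integral k f (diag_orbit \<mu> \<nu>) = power_integral k f (\<mu> \<Otimes>\<^sub>M \<nu>)"
    by (simp add: orbit_integral_rep x power_integral_shift pm)
  show "orbit_mass (diag_orbit \<mu> \<nu>) = measure \<mu> UNIV * measure \<nu> UNIV"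
    by (simp add: orbit_mass_def x measure_distr sp pm)
  show "finite_measure (orbit_rep (diag_orbit \<mu> \<nu>))"
    unfolding x by (rule finite_measure.finite_measure_distr[OF pm(1)]) measurable
  show "sets (orbit_rep (diag_orbit \<mu> \<nu>)) = sets borel" by (simp add: x)
qed

lemma null_measure_subprob: "null_measure borel \<in> subprob_measures"
  by (rule subprob_measuresI) (auto intro!: finite_measureI simp: measure_def)

text \<open>Total mass is constant along an orbit, so it tells the trivial orbit apart; conversely,
  a product with a null factor is the null measure, and so are all its translates.\<close>

lemma diag_orbit_eq_trivial_iff:
  fixes \<mu> \<nu> :: "(real^'d::finite) measure"
  assumes \<mu>: "\<mu> \<in> subprob_measures" and \<nu>: "\<nu> \<in> subprob_measures"
  shows "diag_orbit \<mu> \<nu> = trivial_orbit \<longleftrightarrow> measure \<mu> UNIV * measure \<nu> UNIV = 0"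
proof
  assume "diag_orbit \<mu> \<nu> = trivial_orbit"
  then have "orbit_mass (diag_orbit \<mu> \<nu>) = orbit_mass (trivial_orbit :: 'd orbit)" by simp
  then show "measure \<mu> UNIV * measure \<nu> UNIV = 0"
    by (simp add: orbit_mass_diag_orbit assms trivial_orbit_def null_measure_subprob)
next
  have *: "distr (\<mu> \<Otimes>\<^sub>M \<nu>) borel (shift_pair x) = null_measure borel"
    if \<mu>: "\<mu> \<in> subprob_measures" and \<nu>: "\<nu> \<in> subprob_measures" and m: "measure \<mu> UNIV * measure \<nu> UNIV = 0"
    for \<mu> \<nu> :: "(real^'d) measure" and x
  proof -
    note pm = pair_subprob[OF that(1,2)]
    have [measurable_cong]: "sets (\<mu> \<Otimes>\<^sub>M \<nu>) = sets borel" by fact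
    have sp: "space (\<mu> \<Otimes>\<^sub>M \<nu>) = UNIV" using sets_eq_imp_space_eq[OF pm(2)] by simp
    interpret finite_measure "\<mu> \<Otimes>\<^sub>M \<nu>" by fact
    have "emeasure (\<mu> \<Otimes>\<^sub>M \<nu>) (space (\<mu> \<Otimes>\<^sub>M \<nu>)) = 0" using m pm(3) by (simp add: sp emeasure_eq_measure)
    then have "emeasure (\<mu> \<Otimes>\<^sub>M \<nu>) A = 0" for A
      by (metis emeasure_space le_zero_eq)
    then show ?thesis by (intro measure_eqI) (auto simp: emeasure_distr)
  qed
  assume "measure \<mu> UNIV * measure \<nu> UNIV = 0"
  then show "diag_orbit \<mu> \<nu> = trivial_orbit"
    unfolding trivial_orbit_def diag_orbit_eq[OF assms] diag_orbit_eq[OF null_measure_subprob null_measure_subprob]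
    by (subst (1 2) *) (auto simp: assms null_measure_subprob measure_def)
qed

section \<open>Collections\<close>

lemma has_sum_diff:
  fixes f g :: "'a \<Rightarrow> real"
  assumes "(f has_sum a) A" "(g has_sum b) A"
  shows "((\<lambda>x. f x - g x) has_sum (a - b)) A"
  using has_sum_add[OF assms(1) has_sum_uminusI[OF assms(2)]] by simp

text \<open>The mass bounds are put on finite partial sums of real masses, the form in which limits
  of finite sums deliver them; \<open>subprob_family_iff\<close> matches it with the extended sums
  in \<open>orbit_collections\<close>.\<close>

definition subprob_family ::
    "nat set \<Rightarrow> (nat \<Rightarrow> (real^'d::finite) measure) \<Rightarrow> (nat \<Rightarrow> (real^'d) measure) \<Rightarrow> bool" where
  "subprob_family I \<alpha> \<beta> \<longleftrightarrow> (\<forall>i\<in>I. \<alpha> i \<in> subprob_measures \<and> \<beta> i \<in> subprob_measures) \<and>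
     (\<forall>F. finite F \<longrightarrow> F \<subseteq> I \<longrightarrow>
       (\<Sum>i\<in>F. measure (\<alpha> i) UNIV) \<le> 1 \<and> (\<Sum>i\<in>F. measure (\<beta> i) UNIV) \<le> 1)"

lemma infsum_ennreal_le_1_iff:
  fixes g :: "nat \<Rightarrow> real"
  assumes g: "\<And>i. i \<in> I \<Longrightarrow> 0 \<le> g i"
  shows "(\<Sum>\<^sub>\<infinity>i\<in>I. ennreal (g i)) \<le> 1 \<longleftrightarrow> (\<forall>F. finite F \<longrightarrow> F \<subseteq> I \<longrightarrow> sum g F \<le> 1)"
proof -
  have *: "(\<Sum>i\<in>F. ennreal (g i)) \<le> 1 \<longleftrightarrow> sum g F \<le> 1" if "F \<subseteq> I" for F
    using g that by (subst sum_ennreal) auto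
  have c: "(\<lambda>i. ennreal (g i)) summable_on A" for A by (rule nonneg_summable_on_complete) simp
  have 1: "(\<Sum>i\<in>F. ennreal (g i)) \<le> (\<Sum>\<^sub>\<infinity>i\<in>I. ennreal (g i))" if "finite F" "F \<subseteq> I" for F
    unfolding infsum_finite[OF that(1), symmetric]
    by (rule infsum_mono_neutral[OF c c]) (use that(2) in auto)
  have 2: "(\<Sum>\<^sub>\<infinity>i\<in>I. ennreal (g i)) \<le> 1" if "\<And>F. finite F \<Longrightarrow> F \<subseteq> I \<Longrightarrow> (\<Sum>i\<in>F. ennreal (g i)) \<le> 1"
    by (rule infsum_le_finite_sums[OF c]) (rule that)
  show ?thesis
  proof safe
    fix F assume "(\<Sum>\<^sub>\<infinity>i\<in>I. ennreal (g i)) \<le> 1" "finite F" "F \<subseteq> I"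
    then show "sum g F \<le> 1" using 1[of F] *[of F] order_trans by blast
  next
    assume "\<forall>F. finite F \<longrightarrow> F \<subseteq> I \<longrightarrow> sum g F \<le> 1"
    then show "(\<Sum>\<^sub>\<infinity>i\<in>I. ennreal (g i)) \<le> 1" using * by (intro 2) auto
  qed
qed

lemma subprob_family_iff:
  "subprob_family I \<alpha> \<beta> \<longleftrightarrow> (\<forall>i\<in>I. \<alpha> i \<in> subprob_measures \<and> \<beta> i \<in> subprob_measures) \<and>
     (\<Sum>\<^sub>\<infinity>i\<in>I. emeasure (\<alpha> i) UNIV) \<le> 1 \<and> (\<Sum>\<^sub>\<infinity>i\<in>I. emeasure (\<beta> i) UNIV) \<le> 1"
proof (cases "\<forall>i\<in>I. \<alpha> i \<in> subprob_measures \<and> \<beta> i \<in> subprob_measures")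
  case True
  have 1: "(\<Sum>\<^sub>\<infinity>i\<in>I. emeasure (\<alpha> i) UNIV) = (\<Sum>\<^sub>\<infinity>i\<in>I. ennreal (measure (\<alpha> i) UNIV))"
    by (rule infsum_cong) (use True in \<open>simp add: finite_measure.emeasure_eq_measure subprob_measuresD(1)\<close>)
  have 2: "(\<Sum>\<^sub>\<infinity>i\<in>I. emeasure (\<beta> i) UNIV) = (\<Sum>\<^sub>\<infinity>i\<in>I. ennreal (measure (\<beta> i) UNIV))"
    by (rule infsum_cong) (use True in \<open>simp add: finite_measure.emeasure_eq_measure subprob_measuresD(1)\<close>)
  show ?thesis unfolding 1 2 subprob_family_def by (subst (1 2) infsum_ennreal_le_1_iff) auto
qed (auto simp: subprob_family_def)

lemma orbit_collections_eq: "orbit_collections = {collection_of I \<alpha> \<beta> | I \<alpha> \<beta>. subprob_family I \<alpha> \<beta>}"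
  unfolding orbit_collections_def subprob_family_iff by blast

lemma subprob_familyD:
  assumes "subprob_family I \<alpha> \<beta>"
  shows "i \<in> I \<Longrightarrow> \<alpha> i \<in> subprob_measures" "i \<in> I \<Longrightarrow> \<beta> i \<in> subprob_measures"
    "finite F \<Longrightarrow> F \<subseteq> I \<Longrightarrow> (\<Sum>i\<in>F. measure (\<alpha> i) UNIV) \<le> 1"
    "finite F \<Longrightarrow> F \<subseteq> I \<Longrightarrow> (\<Sum>i\<in>F. measure (\<beta> i) UNIV) \<le> 1"
  using assms by (auto simp: subprob_family_def)

lemma summable_on_mass:
  assumes "subprob_family I \<alpha> \<beta>"
  shows "(\<lambda>i. measure (\<alpha> i) UNIV) summable_on I" "(\<Sum>\<^sub>\<infinity>i\<in>I. measure (\<alpha> i) UNIV) \<le> 1"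
proof -
  show *: "(\<lambda>i. measure (\<alpha> i) UNIV) summable_on I"
    by (rule nonneg_bdd_above_summable_on) (auto intro!: bdd_aboveI[of _ 1] subprob_familyD(3)[OF assms])
  show "(\<Sum>\<^sub>\<infinity>i\<in>I. measure (\<alpha> i) UNIV) \<le> 1"
    by (rule infsum_le_finite_sums[OF *]) (rule subprob_familyD(3)[OF assms])
qed

text \<open>The mass of an orbit is at most that of its first factor, so more than 1 / c such
  indices would push the sum of the masses above 1. Hence \<open>card\<close> in
  \<open>collection_of\<close> never meets an infinite set at a nontrivial orbit.\<close>

lemma finite_orbit_fibre:
  assumes fam: "subprob_family I \<alpha> \<beta>" and c: "c > 0"
  shows "finite {i \<in> I. orbit_mass (diag_orbit (\<alpha> i) (\<beta> i)) \<ge> c}"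
proof (rule ccontr)
  assume inf: "infinite {i \<in> I. orbit_mass (diag_orbit (\<alpha> i) (\<beta> i)) \<ge> c}"
  obtain n :: nat where n: "real n * c > 1" using c reals_Archimedean3 by blast
  obtain F where F: "finite F" "card F = n" "F \<subseteq> {i \<in> I. orbit_mass (diag_orbit (\<alpha> i) (\<beta> i)) \<ge> c}"
    using infinite_arbitrarily_large[OF inf] by blast
  have "c \<le> measure (\<alpha> i) UNIV" if "i \<in> F" for i
  proof -
    have i: "\<alpha> i \<in> subprob_measures" "\<beta> i \<in> subprob_measures" using F that subprob_familyD(1,2)[OF fam] by auto
    have "c \<le> measure (\<alpha> i) UNIV * measure (\<beta> i) UNIV" using F that by (auto simp: orbit_mass_diag_orbit[OF i])
    also have "\<dots> \<le> measure (\<alpha> i) UNIV" using subprob_measuresD(4)[OF i(2)] by (simp add: mult_left_le)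
    finally show ?thesis .
  qed
  then have "real n * c \<le> (\<Sum>i\<in>F. measure (\<alpha> i) UNIV)"
    using sum_mono[of F "\<lambda>_. c" "\<lambda>i. measure (\<alpha> i) UNIV"] F(2) by simp
  also have "\<dots> \<le> 1" using subprob_familyD(3)[OF fam F(1)] F(3) by auto
  finally show False using n by simp
qed

lemma orbit_mass_pos:
  assumes "\<mu> \<in> subprob_measures" "\<nu> \<in> subprob_measures" "diag_orbit \<mu> \<nu> \<noteq> trivial_orbit"
  shows "orbit_mass (diag_orbit \<mu> \<nu>) > 0"
  using diag_orbit_eq_trivial_iff[OF assms(1,2)] assms(3)
  by (auto simp: orbit_mass_diag_orbit[OF assms(1,2)] zero_less_mult_iff zero_less_measure_iff)

lemma has_sum_collection_of:
  fixes g :: "'d::finite orbit \<Rightarrow> real"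
  assumes fam: "subprob_family I \<alpha> \<beta>" and triv: "g trivial_orbit = 0"
    and g: "(\<lambda>i. g (diag_orbit (\<alpha> i) (\<beta> i))) summable_on I"
  shows "((\<lambda>p. real (collection_of I \<alpha> \<beta> p) * g p) has_sum (\<Sum>\<^sub>\<infinity>i\<in>I. g (diag_orbit (\<alpha> i) (\<beta> i)))) UNIV"
proof -
  define orb where "orb i = diag_orbit (\<alpha> i) (\<beta> i)" for i
  define J where "J = {i \<in> I. orb i \<noteq> trivial_orbit}"
  have "((\<lambda>i. g (orb i)) has_sum (\<Sum>\<^sub>\<infinity>i\<in>I. g (orb i))) I"
    using g unfolding orb_def by (rule has_sum_infsum)
  then have "((\<lambda>i. g (orb i)) has_sum (\<Sum>\<^sub>\<infinity>i\<in>I. g (orb i))) J"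
    by (rule has_sum_cong_neutral[THEN iffD1, rotated -1]) (auto simp: J_def triv)
  moreover have "bij_betw snd (SIGMA p:UNIV. {i \<in> J. orb i = p}) J"
    by (rule bij_betwI[where g="\<lambda>i. (orb i, i)"]) auto
  ultimately have "((\<lambda>x. g (orb (snd x))) has_sum (\<Sum>\<^sub>\<infinity>i\<in>I. g (orb i))) (SIGMA p:UNIV. {i \<in> J. orb i = p})"
    by (subst has_sum_reindex_bij_betw)
  moreover have "((\<lambda>i. g (orb (snd (p, i)))) has_sum (real (collection_of I \<alpha> \<beta> p) * g p)) {i \<in> J. orb i = p}" for p
  proof (cases "p = trivial_orbit")
    case True
    then show ?thesis by (auto simp: J_def triv intro!: has_sum_0)
  next
    case False
    have fin: "finite {i \<in> J. orb i = p}"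
    proof (cases "\<exists>i\<in>J. orb i = p")
      case True
      then obtain i where "i \<in> I" "p = orb i" "orb i \<noteq> trivial_orbit" by (auto simp: J_def)
      then have "orbit_mass p > 0"
        unfolding orb_def using orbit_mass_pos subprob_familyD(1,2)[OF fam] by blast
      from finite_orbit_fibre[OF fam this] show ?thesis
        by (rule finite_subset[rotated]) (auto simp: J_def orb_def)
    next
      case False
      then have "{i \<in> J. orb i = p} = {}" by blast
      then show ?thesis by (metis finite.emptyI)
    qed
    have "collection_of I \<alpha> \<beta> p = card {i \<in> J. orb i = p}"
      using False by (auto simp: collection_of_def J_def orb_def intro!: arg_cong[where f=card])
    then show ?thesis
      by (intro has_sum_finiteI fin) simp
  qed
  ultimately have "((\<lambda>p. real (collection_of I \<alpha> \<beta> p) * g p) has_sum (\<Sum>\<^sub>\<infinity>i\<in>I. g (orb i))) UNIV"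
    by (rule has_sum_Sigma')
  then show ?thesis by (simp add: orb_def)
qed

lemma power_integral_family_bound:
  fixes f :: "'d::finite config \<Rightarrow> real"
  assumes fam: "subprob_family I \<alpha> \<beta>" and k: "k \<ge> 1" and B: "B \<ge> 0" "\<And>z. z \<in> configs k \<Longrightarrow> \<bar>f z\<bar> \<le> B" and i: "i \<in> I"
  shows "\<bar>power_integral k f (\<alpha> i \<Otimes>\<^sub>M \<beta> i)\<bar> \<le> B * measure (\<alpha> i) UNIV"
proof -
  have i: "\<alpha> i \<in> subprob_measures" "\<beta> i \<in> subprob_measures" using i subprob_familyD(1,2)[OF fam] by auto
  note pm = pair_subprob[OF i]
  have "\<bar>power_integral k f (\<alpha> i \<Otimes>\<^sub>M \<beta> i)\<bar> \<le> B * measure (\<alpha> i \<Otimes>\<^sub>M \<beta> i) UNIV"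
    by (rule power_integral_bound) (use pm k B in auto)
  also have "\<dots> \<le> B * measure (\<alpha> i) UNIV" using pm B by (simp add: mult_left_mono)
  finally show ?thesis .
qed

text \<open>Dominated termwise by B times the mass of \<alpha> i, and these masses add up to at most
  1.\<close>

lemma summable_on_power_integral_family:
  fixes f :: "'d::finite config \<Rightarrow> real"
  assumes fam: "subprob_family I \<alpha> \<beta>" and k: "k \<ge> 1" and B: "B \<ge> 0" "\<And>z. z \<in> configs k \<Longrightarrow> \<bar>f z\<bar> \<le> B"
  shows "(\<lambda>i. power_integral k f (\<alpha> i \<Otimes>\<^sub>M \<beta> i)) summable_on I"
    "\<bar>\<Sum>\<^sub>\<infinity>i\<in>I. power_integral k f (\<alpha> i \<Otimes>\<^sub>M \<beta> i)\<bar> \<le> B"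
proof -
  have s: "(\<lambda>i. B * measure (\<alpha> i) UNIV) summable_on I"
    by (rule summable_on_cmult_right) (rule summable_on_mass(1)[OF fam])
  have a: "(\<lambda>i. norm (power_integral k f (\<alpha> i \<Otimes>\<^sub>M \<beta> i))) summable_on I"
    by (rule Infinite_Sum.abs_summable_on_comparison_test'[OF s]) (use power_integral_family_bound[OF assms] in auto)
  then show "(\<lambda>i. power_integral k f (\<alpha> i \<Otimes>\<^sub>M \<beta> i)) summable_on I"
    by (rule abs_summable_summable)
  have "\<bar>\<Sum>\<^sub>\<infinity>i\<in>I. power_integral k f (\<alpha> i \<Otimes>\<^sub>M \<beta> i)\<bar> \<le> (\<Sum>\<^sub>\<infinity>i\<in>I. norm (power_integral k f (\<alpha> i \<Otimes>\<^sub>M \<beta> i)))"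
    using norm_infsum_bound[OF a] by simp
  also have "\<dots> \<le> (\<Sum>\<^sub>\<infinity>i\<in>I. B * measure (\<alpha> i) UNIV)"
    by (rule infsum_mono[OF a s]) (use power_integral_family_bound[OF assms] in auto)
  also have "\<dots> = B * (\<Sum>\<^sub>\<infinity>i\<in>I. measure (\<alpha> i) UNIV)" by (rule infsum_cmult_right')
  also have "\<dots> \<le> B" using summable_on_mass(2)[OF fam] B by (simp add: mult_left_le)
  finally show "\<bar>\<Sum>\<^sub>\<infinity>i\<in>I. power_integral k f (\<alpha> i \<Otimes>\<^sub>M \<beta> i)\<bar> \<le> B" .
qed

lemma orbit_integral_trivial:
  assumes "k \<ge> 1" "f \<in> test_functions k"
  shows "orbit_integral k f (trivial_orbit :: 'd::finite orbit) = 0"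
proof -
  obtain B where B: "B > 0" "\<And>z. z \<in> configs k \<Longrightarrow> \<bar>f z\<bar> \<le> B" using test_function_bounded[OF assms(2)] by blast
  let ?n = "null_measure borel :: (real^'d) measure"
  note pm = pair_subprob[OF null_measure_subprob null_measure_subprob]
  have "\<bar>power_integral k f (?n \<Otimes>\<^sub>M ?n)\<bar> \<le> B * measure (?n \<Otimes>\<^sub>M ?n) UNIV"
    by (rule power_integral_bound) (use pm B assms in auto)
  then show ?thesis
    by (simp add: trivial_orbit_def orbit_integral_diag_orbit null_measure_subprob assms pm(3))
qed

lemma
  fixes f :: "'d::finite config \<Rightarrow> real"
  assumes fam: "subprob_family I \<alpha> \<beta>" and k: "k \<ge> 1" and f: "f \<in> test_functions k"
  shows has_sum_Lambda_collection_of: "((\<lambda>p. real (collection_of I \<alpha> \<beta> p) * orbit_integral k f p)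
      has_sum Lambda (k, f) (collection_of I \<alpha> \<beta>)) UNIV"
    and Lambda_collection_of: "Lambda (k, f) (collection_of I \<alpha> \<beta>) = (\<Sum>\<^sub>\<infinity>i\<in>I. power_integral k f (\<alpha> i \<Otimes>\<^sub>M \<beta> i))"
proof -
  obtain B where B: "B > 0" "\<And>z. z \<in> configs k \<Longrightarrow> \<bar>f z\<bar> \<le> B" using test_function_bounded[OF f] by blast
  have eq: "orbit_integral k f (diag_orbit (\<alpha> i) (\<beta> i)) = power_integral k f (\<alpha> i \<Otimes>\<^sub>M \<beta> i)" if "i \<in> I" for i
    using subprob_familyD(1,2)[OF fam that] f by (simp add: orbit_integral_diag_orbit)
  have s: "(\<lambda>i. orbit_integral k f (diag_orbit (\<alpha> i) (\<beta> i))) summable_on I"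
    using summable_on_power_integral_family(1)[OF fam k less_imp_le[OF B(1)] B(2)]
    by (subst summable_on_cong) (auto simp: eq)
  have "((\<lambda>p. real (collection_of I \<alpha> \<beta> p) * orbit_integral k f p) has_sum
      (\<Sum>\<^sub>\<infinity>i\<in>I. orbit_integral k f (diag_orbit (\<alpha> i) (\<beta> i)))) UNIV"
    by (rule has_sum_collection_of[OF fam orbit_integral_trivial[OF k f] s])
  moreover have "(\<Sum>\<^sub>\<infinity>i\<in>I. orbit_integral k f (diag_orbit (\<alpha> i) (\<beta> i))) = (\<Sum>\<^sub>\<infinity>i\<in>I. power_integral k f (\<alpha> i \<Otimes>\<^sub>M \<beta> i))"
    by (rule infsum_cong) (rule eq)
  ultimately have h: "((\<lambda>p. real (collection_of I \<alpha> \<beta> p) * orbit_integral k f p) has_sum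
      (\<Sum>\<^sub>\<infinity>i\<in>I. power_integral k f (\<alpha> i \<Otimes>\<^sub>M \<beta> i))) UNIV" by simp
  then show L: "Lambda (k, f) (collection_of I \<alpha> \<beta>) = (\<Sum>\<^sub>\<infinity>i\<in>I. power_integral k f (\<alpha> i \<Otimes>\<^sub>M \<beta> i))"
    by (simp add: Lambda_def infsumI)
  show "((\<lambda>p. real (collection_of I \<alpha> \<beta> p) * orbit_integral k f p)
      has_sum Lambda (k, f) (collection_of I \<alpha> \<beta>)) UNIV" unfolding L by (rule h)
qed

lemma Lambda_bound:
  fixes \<xi> :: "'d::finite orbit_collection"
  assumes \<xi>: "\<xi> \<in> orbit_collections" and k: "k \<ge> 1" and B: "B \<ge> 0" "\<And>z. z \<in> configs k \<Longrightarrow> \<bar>f z\<bar> \<le> B" and f: "f \<in> test_functions k"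
  shows "\<bar>Lambda (k, f) \<xi>\<bar> \<le> B"
proof -
  obtain I \<alpha> \<beta> where "\<xi> = collection_of I \<alpha> \<beta>" and fam: "subprob_family I \<alpha> \<beta>"
    using \<xi> by (auto simp: orbit_collections_eq)
  moreover have "\<bar>\<Sum>\<^sub>\<infinity>i\<in>I. power_integral k f (\<alpha> i \<Otimes>\<^sub>M \<beta> i)\<bar> \<le> B"
    using fam k B by (rule summable_on_power_integral_family(2))
  ultimately show ?thesis by (simp add: Lambda_collection_of[OF _ k f])
qed

lemma single_orbit_eq_collection_of:
  fixes \<mu> \<nu> :: "(real^'d::finite) measure"
  assumes "\<mu> \<in> prob_measures" "\<nu> \<in> prob_measures"
  shows "single_orbit (diag_orbit \<mu> \<nu>) = collection_of {0} (\<lambda>_. \<mu>) (\<lambda>_. \<nu>)"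
    and "subprob_family {0} (\<lambda>_. \<mu>) (\<lambda>_. \<nu>)"
proof -
  have s: "\<mu> \<in> subprob_measures" "\<nu> \<in> subprob_measures" using assms prob_measures_subprob by auto
  have m: "measure \<mu> UNIV = 1" "measure \<nu> UNIV = 1"
    using assms prob_space.prob_space[of \<mu>] prob_space.prob_space[of \<nu>] sets_eq_imp_space_eq[of \<mu> borel] sets_eq_imp_space_eq[of \<nu> borel]
    by (auto simp: prob_measures_def)
  \<comment> \<open>The trivial orbit has multiplicity 0 in every \<open>collection_of\<close>,
    whereas \<open>single_orbit\<close> would count it once.\<close>
  have "diag_orbit \<mu> \<nu> \<noteq> trivial_orbit" using m by (simp add: diag_orbit_eq_trivial_iff s)
  then show "single_orbit (diag_orbit \<mu> \<nu>) = collection_of {0} (\<lambda>_. \<mu>) (\<lambda>_. \<nu>)"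
    by (auto simp: single_orbit_def collection_of_def fun_eq_iff)
  have "F = {} \<or> F = {0}" if "F \<subseteq> {0::nat}" for F using that by auto
  then show "subprob_family {0} (\<lambda>_. \<mu>) (\<lambda>_. \<nu>)"
    unfolding subprob_family_def using s m by (metis (no_types, lifting) order_refl sum.empty sum.insert finite.emptyI empty_iff add.right_neutral zero_le_one)
qed

lemma single_orbit_in_orbit_collections: "p \<in> prob_orbits \<Longrightarrow> single_orbit p \<in> orbit_collections"
  using single_orbit_eq_collection_of by (fastforce simp: prob_orbits_def orbit_collections_eq)

lemma Lambda_single_orbit:
  fixes \<mu> \<nu> :: "(real^'d::finite) measure"
  assumes "\<mu> \<in> prob_measures" "\<nu> \<in> prob_measures" "k \<ge> 1" "f \<in> test_functions k"
  shows "Lambda (k, f) (single_orbit (diag_orbit \<mu> \<nu>)) = power_integral k f (\<mu> \<Otimes>\<^sub>M \<nu>)"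
  using assms by (simp add: single_orbit_eq_collection_of(1) Lambda_collection_of[OF single_orbit_eq_collection_of(2)])

section \<open>The distance\<close>

lemma sup_norm_nonneg: "f \<in> test_functions k \<Longrightarrow> 0 \<le> sup_norm k f"
  using abs_le_sup_norm[of f k "\<lambda>i\<in>{..<k}. undefined"] by (force simp: configs_def)

definition dist_term :: "(nat \<Rightarrow> nat \<times> ('d::finite config \<Rightarrow> real)) \<Rightarrow> 'd orbit_collection \<Rightarrow> 'd orbit_collection \<Rightarrow> nat \<Rightarrow> real" where
  "dist_term F \<xi>1 \<xi>2 r = (1 / 2 ^ Suc r) * (1 / (1 + sup_norm (fst (F r)) (snd (F r)))) *
     \<bar>Lambda (F r) \<xi>1 - Lambda (F r) \<xi>2\<bar>"

lemma orbit_dist_eq: "orbit_dist F \<xi>1 \<xi>2 = (\<Sum>\<^sub>\<infinity>r. dist_term F \<xi>1 \<xi>2 r)"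
  by (simp add: orbit_dist_def dist_term_def)

context
  fixes F :: "nat \<Rightarrow> nat \<times> ('d::finite config \<Rightarrow> real)"
  assumes F: "dense_test_sequence F"
begin

lemma dense_test_sequenceD: "fst (F r) \<ge> 1" "snd (F r) \<in> test_functions (fst (F r))"
proof -
  have "F r \<in> all_test_functions" using F by (auto simp: dense_test_sequence_def)
  then show "fst (F r) \<ge> 1" "snd (F r) \<in> test_functions (fst (F r))"
    unfolding all_test_functions_def by (auto simp: mem_Sigma_iff dest: SigmaD1 SigmaD2 split: prod.splits)
qed

lemma Lambda_le_sup_norm:
  assumes "\<xi> \<in> orbit_collections"
  shows "\<bar>Lambda (F r) \<xi>\<bar> \<le> sup_norm (fst (F r)) (snd (F r))"
  using Lambda_bound[OF assms dense_test_sequenceD(1) sup_norm_nonneg[OF dense_test_sequenceD(2)] abs_le_sup_norm[OF dense_test_sequenceD(2)] dense_test_sequenceD(2), of r]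
  by simp

lemma dist_term_nonneg: "0 \<le> dist_term F \<xi>1 \<xi>2 r"
  using sup_norm_nonneg[OF dense_test_sequenceD(2), of r] by (simp add: dist_term_def)

text \<open>Two functionals differ by at most twice the sup norm; the weight cancels the norm, and
  the 2 absorbs one factor of \<open>1 / 2 ^ Suc r\<close>. The bound is uniform over all
  collections.\<close>

lemma dist_term_le:
  assumes "\<xi>1 \<in> orbit_collections" "\<xi>2 \<in> orbit_collections"
  shows "dist_term F \<xi>1 \<xi>2 r \<le> (1/2) ^ r"
proof -
  define s where "s = 1 + sup_norm (fst (F r)) (snd (F r))"
  have s: "s > 0" using sup_norm_nonneg[OF dense_test_sequenceD(2), of r] by (simp add: s_def)
  have "\<bar>Lambda (F r) \<xi>1 - Lambda (F r) \<xi>2\<bar> \<le> 2 * s"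
    using Lambda_le_sup_norm[OF assms(1), of r] Lambda_le_sup_norm[OF assms(2), of r] by (simp add: s_def)
  then have "(1 / 2 ^ Suc r) * (1 / s) * \<bar>Lambda (F r) \<xi>1 - Lambda (F r) \<xi>2\<bar> \<le> (1 / 2 ^ Suc r) * (1 / s) * (2 * s)"
    using s by (intro mult_left_mono) auto
  also have "\<dots> = (1/2) ^ r" using s by (simp add: field_simps power_one_over)
  finally show ?thesis by (simp add: dist_term_def s_def)
qed

lemma dist_term_summable:
  assumes "\<xi>1 \<in> orbit_collections" "\<xi>2 \<in> orbit_collections"
  shows "dist_term F \<xi>1 \<xi>2 summable_on UNIV" "summable (dist_term F \<xi>1 \<xi>2)"
proof -
  have s: "summable (\<lambda>r. (1/2 :: real) ^ r)" by (rule summable_geometric) simp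
  show *: "summable (dist_term F \<xi>1 \<xi>2)"
    by (rule summable_comparison_test'[OF s, of 0]) (use dist_term_le[OF assms] dist_term_nonneg in auto)
  show "dist_term F \<xi>1 \<xi>2 summable_on UNIV"
    by (rule summable_nonneg_imp_summable_on[OF *]) (rule dist_term_nonneg)
qed

lemma orbit_dist_suminf:
  assumes "\<xi>1 \<in> orbit_collections" "\<xi>2 \<in> orbit_collections"
  shows "orbit_dist F \<xi>1 \<xi>2 = suminf (dist_term F \<xi>1 \<xi>2)"
  unfolding orbit_dist_eq
  using has_sum_imp_sums[OF has_sum_infsum[OF dist_term_summable(1)[OF assms]]] by (simp add: sums_iff)

text \<open>Dominated convergence for series (Tannery) with the geometric majorant of
  \<open>dist_term_le\<close>.\<close>

lemma orbit_dist_tendsto_0: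
  fixes \<Xi> :: "nat \<Rightarrow> 'd orbit_collection"
  assumes \<Xi>: "\<And>n. \<Xi> n \<in> orbit_collections" and \<xi>: "\<xi> \<in> orbit_collections"
    and conv: "\<And>k f. k \<ge> 1 \<Longrightarrow> f \<in> test_functions k \<Longrightarrow> (\<lambda>n. Lambda (k, f) (\<Xi> n)) \<longlonglongrightarrow> Lambda (k, f) \<xi>"
  shows "(\<lambda>n. orbit_dist F (\<Xi> n) \<xi>) \<longlonglongrightarrow> 0"
proof -
  have t: "(\<lambda>n. dist_term F (\<Xi> n) \<xi> r) \<longlonglongrightarrow> 0" for r
  proof -
    have "(\<lambda>n. Lambda (F r) (\<Xi> n)) \<longlonglongrightarrow> Lambda (F r) \<xi>"
      using conv[OF dense_test_sequenceD[of r]] by simp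
    then have "(\<lambda>n. \<bar>Lambda (F r) (\<Xi> n) - Lambda (F r) \<xi>\<bar>) \<longlonglongrightarrow> 0"
      using tendsto_rabs_zero[OF LIM_zero] by blast
    then show ?thesis unfolding dist_term_def by (rule tendsto_mult_right_zero)
  qed
  have "(\<lambda>n. suminf (dist_term F (\<Xi> n) \<xi>)) \<longlonglongrightarrow> suminf (\<lambda>r. 0 :: real)"
  proof (rule tannerys_theorem[THEN conjunct2, THEN conjunct2])
    show "\<And>r. (\<lambda>n. dist_term F (\<Xi> n) \<xi> r) \<longlonglongrightarrow> 0" by (rule t)
    show "\<forall>\<^sub>F (k, n) in at_top \<times>\<^sub>F sequentially. norm (dist_term F (\<Xi> n) \<xi> k) \<le> (1/2) ^ k"
      using dist_term_le[OF \<Xi> \<xi>] dist_term_nonneg by (auto intro!: always_eventually)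
    show "summable (\<lambda>r. (1/2 :: real) ^ r)" by (rule summable_geometric) simp
  qed simp
  then show ?thesis by (simp add: orbit_dist_suminf \<Xi> \<xi>)
qed

lemma orbit_dist_nonneg: "0 \<le> orbit_dist F \<xi>1 \<xi>2"
  unfolding orbit_dist_eq by (rule infsum_nonneg) (rule dist_term_nonneg)

lemma orbit_dist_commute: "orbit_dist F \<xi>1 \<xi>2 = orbit_dist F \<xi>2 \<xi>1"
  by (simp add: orbit_dist_def abs_minus_commute)

lemma orbit_dist_triangle:
  assumes "\<xi>1 \<in> orbit_collections" "\<xi>2 \<in> orbit_collections" "\<xi>3 \<in> orbit_collections"
  shows "orbit_dist F \<xi>1 \<xi>3 \<le> orbit_dist F \<xi>1 \<xi>2 + orbit_dist F \<xi>2 \<xi>3"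
proof -
  have "dist_term F \<xi>1 \<xi>3 r \<le> dist_term F \<xi>1 \<xi>2 r + dist_term F \<xi>2 \<xi>3 r" for r
    unfolding dist_term_def distrib_left[symmetric]
    using sup_norm_nonneg[OF dense_test_sequenceD(2), of r] by (intro mult_left_mono) auto
  then have "(\<Sum>\<^sub>\<infinity>r. dist_term F \<xi>1 \<xi>3 r) \<le> (\<Sum>\<^sub>\<infinity>r. dist_term F \<xi>1 \<xi>2 r + dist_term F \<xi>2 \<xi>3 r)"
    by (intro infsum_mono summable_on_add dist_term_summable(1) assms)
  also have "\<dots> = (\<Sum>\<^sub>\<infinity>r. dist_term F \<xi>1 \<xi>2 r) + (\<Sum>\<^sub>\<infinity>r. dist_term F \<xi>2 \<xi>3 r)"
    by (intro infsum_add dist_term_summable(1) assms)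
  finally show ?thesis by (simp add: orbit_dist_eq)
qed

text \<open>The functional is Lipschitz in the test function for the sup norm, uniformly over
  collections, so agreement along the dense sequence extends to all test functions.\<close>

lemma orbit_dist_0_imp_Lambda_eq:
  assumes \<xi>: "\<xi>1 \<in> orbit_collections" "\<xi>2 \<in> orbit_collections" and 0: "orbit_dist F \<xi>1 \<xi>2 = 0"
    and k: "k \<ge> 1" and f: "f \<in> test_functions k"
  shows "Lambda (k, f) \<xi>1 = Lambda (k, f) \<xi>2"
proof -
  have eq: "Lambda (F r) \<xi>1 = Lambda (F r) \<xi>2" for r
  proof -
    have "dist_term F \<xi>1 \<xi>2 r = 0"
      by (rule nonneg_infsum_le_0D[OF _ dist_term_summable(1)[OF \<xi>]])
        (use 0 dist_term_nonneg in \<open>auto simp: orbit_dist_eq\<close>)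
    then show ?thesis using sup_norm_nonneg[OF dense_test_sequenceD(2), of r] by (auto simp: dist_term_def)
  qed
  have "\<bar>Lambda (k, f) \<xi>1 - Lambda (k, f) \<xi>2\<bar> \<le> 2 * \<epsilon>" if "\<epsilon> > 0" for \<epsilon>
  proof -
    have "(k, f) \<in> all_test_functions" using k f by (simp add: all_test_functions_def)
    then obtain r where r: "fst (F r) = k" "sup_norm k (\<lambda>z. snd (F r) z - f z) < \<epsilon>"
      using F \<open>\<epsilon> > 0\<close> by (fastforce simp: dense_test_sequence_def)
    define g where "g = snd (F r)"
    have g: "g \<in> test_functions k" using dense_test_sequenceD(2)[of r] r by (simp add: g_def)
    obtain Bf where Bf: "Bf > 0" "\<And>z. z \<in> configs k \<Longrightarrow> \<bar>f z\<bar> \<le> Bf" using test_function_bounded[OF f] by blast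
    obtain Bg where Bg: "Bg > 0" "\<And>z. z \<in> configs k \<Longrightarrow> \<bar>g z\<bar> \<le> Bg" using test_function_bounded[OF g] by blast
    have bd: "\<bar>g z - f z\<bar> \<le> \<epsilon>" if "z \<in> configs k" for z
    proof -
      have "\<bar>g z - f z\<bar> \<le> sup_norm k (\<lambda>z. snd (F r) z - f z)"
        unfolding sup_norm_def g_def[symmetric]
      proof (rule cSUP_upper[OF that])
        show "bdd_above ((\<lambda>z. \<bar>g z - f z\<bar>) ` configs k)"
          by (rule bdd_aboveI[of _ "Bg + Bf"]) (use Bf Bg in \<open>force intro: order_trans[OF abs_triangle_ineq4] add_mono\<close>)
      qed
      then show ?thesis using r by simp
    qed
    have "\<bar>Lambda (k, f) \<xi> - Lambda (k, g) \<xi>\<bar> \<le> \<epsilon>" if \<xi>: "\<xi> \<in> orbit_collections" for \<xi>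
    proof -
      obtain I \<alpha> \<beta> where eq: "\<xi> = collection_of I \<alpha> \<beta>" and fam: "subprob_family I \<alpha> \<beta>"
        using \<xi> by (auto simp: orbit_collections_eq)
      have int: "integrable (PiM {..<k} (\<lambda>_. \<alpha> i \<Otimes>\<^sub>M \<beta> i)) h"
        if "i \<in> I" and h: "h \<in> test_functions k" for i h
      proof -
        note pm = pair_subprob[OF subprob_familyD(1,2)[OF fam \<open>i \<in> I\<close> ] ]
        interpret P: finite_measure "PiM {..<k} (\<lambda>_. \<alpha> i \<Otimes>\<^sub>M \<beta> i)" using pm by (intro finite_measure_PiM_const)
        obtain B where B: "B > 0" "\<And>z. z \<in> configs k \<Longrightarrow> \<bar>h z\<bar> \<le> B" using test_function_bounded[OF h] by blast
        show ?thesis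
        proof (rule P.integrable_const_bound[of _ B])
          show "h \<in> borel_measurable (PiM {..<k} (\<lambda>_. \<alpha> i \<Otimes>\<^sub>M \<beta> i))"
            using test_function_measurable[OF h] pm(2) by (simp cong: measurable_cong_sets sets_PiM_cong)
        qed (use B space_PiM_borel[OF pm(2), of k] in auto)
      qed
      have "Lambda (k, f) \<xi> - Lambda (k, g) \<xi> = (\<Sum>\<^sub>\<infinity>i\<in>I. power_integral k f (\<alpha> i \<Otimes>\<^sub>M \<beta> i) - power_integral k g (\<alpha> i \<Otimes>\<^sub>M \<beta> i))"
        unfolding eq Lambda_collection_of[OF fam k f] Lambda_collection_of[OF fam k g]
        by (intro infsumI[symmetric] has_sum_diff has_sum_infsum
              summable_on_power_integral_family(1)[OF fam k less_imp_le[OF Bf(1)] Bf(2)]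
              summable_on_power_integral_family(1)[OF fam k less_imp_le[OF Bg(1)] Bg(2)])
      also have "\<dots> = (\<Sum>\<^sub>\<infinity>i\<in>I. power_integral k (\<lambda>z. f z - g z) (\<alpha> i \<Otimes>\<^sub>M \<beta> i))"
        unfolding power_integral_def by (intro infsum_cong Bochner_Integration.integral_diff[symmetric] int f g)
      also have "\<bar>\<dots>\<bar> \<le> \<epsilon>"
        using bd \<open>\<epsilon> > 0\<close> by (intro summable_on_power_integral_family(2)[OF fam k]) (auto simp: abs_minus_commute)
      finally show ?thesis .
    qed
    from this[OF \<xi>(1)] this[OF \<xi>(2)]
    have "\<bar>Lambda (k, f) \<xi>1 - Lambda (k, g) \<xi>1\<bar> \<le> \<epsilon>" "\<bar>Lambda (k, f) \<xi>2 - Lambda (k, g) \<xi>2\<bar> \<le> \<epsilon>" .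
    moreover have "F r = (k, g)" using r by (simp add: g_def prod_eq_iff)
    then have "Lambda (k, g) \<xi>1 = Lambda (k, g) \<xi>2" using eq[of r] by simp
    ultimately show ?thesis by linarith
  qed
  \<comment> \<open>With \<epsilon> a quarter of the difference, a positive difference would be at
    most half of itself.\<close>
  from this[of "\<bar>Lambda (k, f) \<xi>1 - Lambda (k, f) \<xi>2\<bar> / 4"] show ?thesis by auto
qed

end

section \<open>Collections are determined by the functionals\<close>

definition compactly_supported :: "('a::euclidean_space \<Rightarrow> real) set" where
  "compactly_supported = {\<phi>. continuous_on UNIV \<phi> \<and> (\<exists>R. \<forall>z. norm z \<ge> R \<longrightarrow> \<phi> z = 0)}"

lemma compactly_supported_bounded:
  assumes "\<phi> \<in> compactly_supported"
  obtains B where "B > 0" "\<And>z. \<bar>\<phi> z\<bar> \<le> B"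
proof -
  obtain R where R: "\<And>z. norm z \<ge> R \<Longrightarrow> \<phi> z = 0" and c: "continuous_on UNIV \<phi>"
    using assms by (auto simp: compactly_supported_def)
  have "compact (\<phi> ` cball 0 R)"
    by (intro compact_continuous_image continuous_on_subset[OF c]) auto
  then obtain B where B: "\<And>z. z \<in> cball 0 R \<Longrightarrow> \<bar>\<phi> z\<bar> \<le> B"
    using compact_imp_bounded by (force simp: bounded_iff)
  show ?thesis
  proof (rule that[of "max B 1"])
    fix z show "\<bar>\<phi> z\<bar> \<le> max B 1" using R[of z] B[of z] by (cases "norm z \<ge> R") auto
  qed simp
qed

lemma compactly_supported_measurable: "\<phi> \<in> compactly_supported \<Longrightarrow> \<phi> \<in> borel_measurable borel"
  by (auto simp: compactly_supported_def intro: borel_measurable_continuous_onI)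

text \<open>Open boxes generate the Borel sets and are stable under intersection. The indicator of a
  bounded open U is the limit of continuous functions supported near U, namely n times the distance
  to the complement of U, cut off at 1.\<close>

lemma finite_measure_eqI_compactly_supported:
  fixes M N :: "'a::euclidean_space measure"
  assumes M: "finite_measure M" "sets M = sets borel" and N: "finite_measure N" "sets N = sets borel"
    and eq: "\<And>\<phi>. \<phi> \<in> compactly_supported \<Longrightarrow> (\<integral>x. \<phi> x \<partial>M) = (\<integral>x. \<phi> x \<partial>N)"
  shows "M = N"
proof -
  interpret M: finite_measure M by fact
  interpret N: finite_measure N by fact
  have main: "emeasure M U = emeasure N U" if U: "open U" "bounded U" for U
  proof -
    \<comment> \<open>The distance \<open>infdist\<close> to the empty set is 0 by convention, which
      would make every \<phi> n vanish.\<close>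
    have ne: "- U \<noteq> {}" using U(2) by (metis Compl_empty_eq double_complement not_bounded_UNIV)
    define \<phi> :: "nat \<Rightarrow> 'a \<Rightarrow> real" where "\<phi> n x = min 1 (real n * infdist x (- U))" for n x
    have c: "continuous_on UNIV (\<phi> n)" for n
      unfolding \<phi>_def by (intro continuous_intros)
    obtain R where R: "\<And>x. x \<in> U \<Longrightarrow> norm x \<le> R" using U(2) by (auto simp: bounded_iff)
    have cs: "\<phi> n \<in> compactly_supported" for n
    proof -
      have "\<phi> n z = 0" if "norm z \<ge> R + 1" for z
        using R[of z] that by (cases "z \<in> U") (auto simp: \<phi>_def)
      then show ?thesis using c by (auto simp: compactly_supported_def)
    qed
    have lim: "(\<lambda>n. \<phi> n x) \<longlonglongrightarrow> indicator U x" for x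
    proof (cases "x \<in> U")
      case True
      then have pos: "infdist x (- U) > 0"
        using U ne by (intro infdist_pos_not_in_closed) auto
      then obtain n0 where n0: "real n0 * infdist x (- U) > 1" using reals_Archimedean3 by blast
      have "\<forall>\<^sub>F n in sequentially. \<phi> n x = 1"
        using eventually_ge_at_top[of n0]
      proof eventually_elim
        case (elim n)
        have "real n0 * infdist x (- U) \<le> real n * infdist x (- U)" using elim pos by (intro mult_right_mono) auto
        then show ?case using n0 by (simp add: \<phi>_def)
      qed
      then show ?thesis using True by (simp add: tendsto_eventually)
    qed (simp add: \<phi>_def)
    have b: "\<bar>\<phi> n x\<bar> \<le> 1" for n x
      using infdist_nonneg[of x "- U"] by (auto simp: \<phi>_def min_def)
    have L: "(\<lambda>n. \<integral>x. \<phi> n x \<partial>K) \<longlonglongrightarrow> measure K U" if K: "finite_measure K" "sets K = sets borel" for K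
    proof -
      interpret K: finite_measure K by fact
      have [measurable_cong]: "sets K = sets borel" by fact
      have sp: "space K = UNIV" using sets_eq_imp_space_eq[OF K(2)] by simp
      have [measurable]: "U \<in> sets K" using U K by simp
      have "(\<lambda>n. \<integral>x. \<phi> n x \<partial>K) \<longlonglongrightarrow> (\<integral>x. indicator U x \<partial>K)"
      proof (rule integral_dominated_convergence[where w="\<lambda>_. 1"])
        show "\<And>n. \<phi> n \<in> borel_measurable K" using borel_measurable_continuous_onI[OF c] K by (simp cong: measurable_cong_sets)
      qed (use lim b in auto)
      then show ?thesis by (simp add: sp)
    qed
    have "measure M U = measure N U"
      using LIMSEQ_unique[OF L[OF M]] L[OF N] eq[OF cs] by simp
    then show ?thesis by (simp add: M.emeasure_eq_measure N.emeasure_eq_measure)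
  qed
  show ?thesis
  proof (rule measure_eqI_generator_eq[where \<Omega>=UNIV and E="range (\<lambda>(a, b). box a b :: 'a set)" and A="\<lambda>n. box (- (real n *\<^sub>R One)) (real n *\<^sub>R One)"])
    show "Int_stable (range (\<lambda>(a, b). box a b :: 'a set))"
      by (auto simp: Int_stable_def box_Int_box)
    show "sets M = sigma_sets UNIV (range (\<lambda>(a, b). box a b))" "sets N = sigma_sets UNIV (range (\<lambda>(a, b). box a b))"
      using M N by (simp_all add: borel_eq_box)
    show "(\<Union>n. box (- (real n *\<^sub>R One)) (real n *\<^sub>R One)) = (UNIV :: 'a set)"
      by (rule UN_box_eq_UNIV)
  qed (auto intro!: main open_box bounded_box)
qed

text \<open>If every point had a null ball around it, countably many of these balls would cover the
  space by Lindelof's theorem, and the measure would be zero.\<close>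

lemma exists_support_point:
  fixes M :: "'a::euclidean_space measure"
  assumes M: "finite_measure M" "sets M = sets borel" and pos: "measure M UNIV > 0"
  obtains z where "\<And>r. r > 0 \<Longrightarrow> measure M (ball z r) > 0"
proof (rule ccontr)
  interpret finite_measure M by fact
  assume "\<not> thesis"
  then have "\<forall>z. \<exists>r>0. \<not> measure M (ball z r) > 0" using that by blast
  then obtain r where r: "\<And>z. r z > 0" "\<And>z. \<not> measure M (ball z (r z)) > 0" by metis
  obtain \<F> where \<F>: "\<F> \<subseteq> range (\<lambda>z. ball z (r z))" "countable \<F>" "\<Union>\<F> = (\<Union>z. ball z (r z))"
    by (rule Lindelof[of "range (\<lambda>z. ball z (r z))"]) auto
  have "measure M (ball z (r z)) = 0" for z
    using r(2)[of z] by (simp add: zero_less_measure_iff)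
  then have "B \<in> null_sets M" if "B \<in> \<F>" for B
    using that \<F>(1) M(2) by (auto simp: null_sets_def emeasure_eq_measure)
  then have "\<Union>\<F> \<in> null_sets M" using null_sets_UN'[OF \<F>(2), of "\<lambda>B. B" M] by simp
  moreover have "\<Union>\<F> = UNIV" unfolding \<F>(3) using r(1) by (auto intro: centre_in_ball[THEN iffD2])
  ultimately show False using pos by (simp add: null_sets_def emeasure_eq_measure)
qed

lemma continuous_on_imp_continuous_map_product:
  fixes f :: "(nat \<Rightarrow> 'a::topological_space) \<Rightarrow> real"
  assumes f: "continuous_on UNIV f"
  shows "continuous_map (product_topology (\<lambda>_. euclidean) {..<k}) euclidean f"
proof -
  have "continuous_map (product_topology (\<lambda>_. euclidean) {..<k}) (product_topology (\<lambda>_. euclidean) UNIV) (\<lambda>z :: nat \<Rightarrow> 'a. z)"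
    unfolding continuous_map_componentwise_UNIV
  proof
    fix i
    show "continuous_map (product_topology (\<lambda>_. euclidean) {..<k}) euclidean (\<lambda>z :: nat \<Rightarrow> 'a. z i)"
    proof (cases "i < k")
      case False
      have "continuous_map (product_topology (\<lambda>_. euclidean :: 'a topology) {..<k}) euclidean (\<lambda>_. undefined)"
        by simp
      then show ?thesis
      proof (rule continuous_map_eq)
        fix z assume "z \<in> topspace (product_topology (\<lambda>_. euclidean :: 'a topology) {..<k})"
        then show "undefined = z i" using False by (simp add: PiE_def extensional_def)
      qed
    next
      case True
      then show ?thesis by (intro continuous_map_product_projection) simp
    qed
  qed
  then have "continuous_map (product_topology (\<lambda>_. euclidean) {..<k}) euclidean (\<lambda>z :: nat \<Rightarrow> 'a. z)"
    by (simp add: euclidean_product_topology)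
  from continuous_map_compose[OF this, of euclidean f] f show ?thesis by (simp add: o_def)
qed

section \<open>Test functions relative to a base point\<close>

lemma continuous_shift_pair:
  "continuous_on UNIV (\<lambda>w. shift_pair (- g w) (h w))"
  if "continuous_on UNIV g" "continuous_on UNIV h"
  unfolding shift_pair_def case_prod_unfold using that by (intro continuous_intros) 

lemma norm_shift_pair_ge: "norm (shift_pair (- x) w) \<ge> norm x - norm w"
proof -
  have "norm x = norm (fst w - (fst w - x))" by simp
  also have "\<dots> \<le> norm (fst w) + norm (fst w - x)" by (rule norm_triangle_ineq4)
  also have "norm (fst w) \<le> norm w" using norm_fst_le[of "fst w" "snd w"] by simp
  also have "norm (fst w - x) \<le> norm (shift_pair (- x) w)"
    using norm_fst_le[of "fst w - x" "snd w - x"] by (simp add: shift_pair_def case_prod_unfold)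
  finally show ?thesis by simp
qed

text \<open>The last pair serves as base pair. Each \<phi> l confines one other pair relative to its
  x; the first factor confines its y, which no \<phi> l controls, so that the whole function
  vanishes at infinity.\<close>

definition monomial_test :: "real \<Rightarrow> nat \<Rightarrow> (nat \<Rightarrow> 'd pt \<Rightarrow> real) \<Rightarrow> 'd::finite config \<Rightarrow> real" where
  "monomial_test R m \<phi> z = max 0 (R - norm (snd (z m) - fst (z m))) * (\<Prod>l<m. \<phi> l (shift_pair (- fst (z m)) (z l)))"

lemma monomial_test_continuous:
  assumes \<phi>: "\<And>l. l < m \<Longrightarrow> \<phi> l \<in> compactly_supported"
  shows "continuous_on UNIV (monomial_test R m \<phi>)"
proof -
  have c: "continuous_on UNIV (\<lambda>z. \<phi> l (shift_pair (- fst (z m)) (z l)))" if "l < m" for l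
  proof (rule continuous_on_compose2[of UNIV "\<phi> l"])
    show "continuous_on UNIV (\<phi> l)" using \<phi>[OF that] by (simp add: compactly_supported_def)
    show "continuous_on UNIV (\<lambda>z. shift_pair (- fst (z m)) (z l))"
      by (intro continuous_shift_pair continuous_intros continuous_on_product_coordinates)
  qed simp
  show ?thesis unfolding monomial_test_def
    by (intro continuous_intros continuous_on_product_coordinates c) auto
qed

text \<open>A nonzero value forces every point to lie within Q of the base point, where Q dominates
  R and the radii of all supports; the spread is then at most 2 Q.\<close>

lemma monomial_test_in_test_functions:
  fixes \<phi> :: "nat \<Rightarrow> 'd::finite pt \<Rightarrow> real"
  assumes \<phi>: "\<And>l. l < m \<Longrightarrow> \<phi> l \<in> compactly_supported"
  shows "monomial_test R m \<phi> \<in> test_functions (Suc m)"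
  unfolding test_functions_def
proof (intro CollectI conjI ballI allI impI)
  show "continuous_map (product_topology (\<lambda>_. euclidean) {..<Suc m}) euclidean (monomial_test R m \<phi>)"
    by (rule continuous_on_imp_continuous_map_product) (rule monomial_test_continuous[OF \<phi>])
next
  fix z :: "'d config" and a
  show "monomial_test R m \<phi> (\<lambda>i\<in>{..<Suc m}. (fst (z i) + a, snd (z i) + a)) = monomial_test R m \<phi> z"
    by (simp add: monomial_test_def shift_pair_def case_prod_unfold)
next
  fix \<epsilon> :: real assume "\<epsilon> > 0"
  have "\<forall>l\<in>{..<m}. \<exists>r. \<forall>z. norm z \<ge> r \<longrightarrow> \<phi> l z = 0"
    using \<phi> by (auto simp: compactly_supported_def)
  then obtain r where r: "\<And>l z. l < m \<Longrightarrow> norm z \<ge> r l \<Longrightarrow> \<phi> l z = 0" by (auto simp: bchoice_iff)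
  define Q where "Q = Max (insert 0 (insert R (r ` {..<m})))"
  have Q: "0 \<le> Q" "R \<le> Q" "\<And>l. l < m \<Longrightarrow> r l \<le> Q" unfolding Q_def by (auto intro!: Max_ge simp del: Max_insert)
  have "monomial_test R m \<phi> z = 0" if z: "z \<in> configs (Suc m)" "spread (Suc m) z \<ge> 2 * Q + 1" for z
  proof (rule ccontr)
    assume nz: "monomial_test R m \<phi> z \<noteq> 0"
    define x where "x = fst (z m)"
    have "norm (fst (z i) - x) \<le> Q \<and> norm (snd (z i) - x) \<le> Q" if "i < Suc m" for i
    proof (cases "i = m")
      case True
      then show ?thesis using nz Q by (auto simp: x_def monomial_test_def max_def split: if_splits)
    next
      case False
      then have i: "i < m" using that by simp
      have "\<phi> i (shift_pair (- x) (z i)) \<noteq> 0" using nz i by (auto simp: monomial_test_def x_def)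
      then have "norm (shift_pair (- x) (z i)) \<le> Q" using r[OF i, of "shift_pair (- x) (z i)"] Q(3)[OF i] by force
      then have n: "norm (fst (z i) - x, snd (z i) - x) \<le> Q" by (simp add: shift_pair_def case_prod_unfold)
      show ?thesis using order_trans[OF norm_fst_le n] order_trans[OF norm_snd_le n] by simp
    qed
    then have d: "norm (fst (z i) - x) \<le> Q" "norm (snd (z i) - x) \<le> Q" if "i < Suc m" for i using that by auto
    have tri: "norm (u - v) \<le> 2 * Q" if "norm (u - x) \<le> Q" "norm (v - x) \<le> Q" for u v
      using norm_triangle_ineq4[of "u - x" "v - x"] that by simp
    have "spread (Suc m) z \<le> 2 * Q"
      unfolding spread_def
    proof (subst Max_le_iff[OF finite_spread_set])
      show "(\<Union>i<Suc m. \<Union>j<Suc m. {norm (fst (z i) - snd (z j)), norm (fst (z i) - fst (z j)), norm (snd (z i) - snd (z j))}) \<noteq> {}"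
        by auto
    qed (use d in \<open>auto intro!: tri\<close>)
    then show False using z by simp
  qed
  then show "\<exists>R'. \<forall>z\<in>configs (Suc m). spread (Suc m) z \<ge> R' \<longrightarrow> \<bar>monomial_test R m \<phi> z\<bar> < \<epsilon>"
    using \<open>\<epsilon> > 0\<close> by (intro exI[of _ "2 * Q + 1"]) auto
qed

text \<open>For a fixed base pair the other m pairs are independent and the integral over them
  factorises; Fubini moves the base pair outermost.\<close>

lemma power_integral_monomial_test:
  fixes \<phi> :: "nat \<Rightarrow> 'd::finite pt \<Rightarrow> real" and \<gamma> :: "'d pt measure"
  assumes \<phi>: "\<And>l. l < m \<Longrightarrow> \<phi> l \<in> compactly_supported"
    and \<gamma>: "finite_measure \<gamma>" "sets \<gamma> = sets borel"
  shows "power_integral (Suc m) (monomial_test R m \<phi>) \<gamma> =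
    (\<integral>z. max 0 (R - norm (snd z - fst z)) * (\<Prod>l<m. \<integral>w. \<phi> l (shift_pair (- fst z) w) \<partial>\<gamma>) \<partial>\<gamma>)"
proof -
  interpret \<gamma>: finite_measure \<gamma> by fact
  interpret P: product_sigma_finite "\<lambda>_::nat. \<gamma>" by (rule product_sigma_finite_const) fact
  interpret Pm: finite_measure "PiM {..<m} (\<lambda>_::nat. \<gamma>)" by (rule finite_measure_PiM_const) fact
  interpret PS: finite_measure "PiM {..<Suc m} (\<lambda>_::nat. \<gamma>)" by (rule finite_measure_PiM_const) fact
  interpret pair: pair_sigma_finite "PiM {..<m} (\<lambda>_::nat. \<gamma>)" \<gamma> by standard
  interpret pf: finite_measure "PiM {..<m} (\<lambda>_::nat. \<gamma>) \<Otimes>\<^sub>M \<gamma>"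
    by (rule finite_measure_pair_measure) unfold_locales
  let ?f = "monomial_test R m \<phi>"
  have sp: "space \<gamma> = UNIV" using sets_eq_imp_space_eq[OF \<gamma>(2)] by simp
  have tf: "?f \<in> test_functions (Suc m)" by (rule monomial_test_in_test_functions[OF \<phi>])
  obtain B where B: "\<And>z. z \<in> configs (Suc m) \<Longrightarrow> \<bar>?f z\<bar> \<le> B" using test_function_bounded[OF tf] by blast
  have meas: "?f \<in> borel_measurable (PiM {..<Suc m} (\<lambda>_. \<gamma>))"
    using test_function_measurable[OF tf] \<gamma>(2) by (simp cong: measurable_cong_sets sets_PiM_cong)
  have int: "integrable (PiM (insert m {..<m}) (\<lambda>_. \<gamma>)) ?f"
    unfolding lessThan_Suc[symmetric]
    by (rule PS.integrable_const_bound[of _ B]) (use B meas space_PiM_borel[OF \<gamma>(2), of "Suc m"] in auto)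
  have upd: "(\<lambda>(x, y). x(m := y)) \<in> measurable (PiM {..<m} (\<lambda>_. \<gamma>) \<Otimes>\<^sub>M \<gamma>) (PiM {..<Suc m} (\<lambda>_. \<gamma>))"
    unfolding lessThan_Suc by (rule measurable_add_dim)
  have upd_cfg: "x(m := y) \<in> configs (Suc m)" if "x \<in> space (PiM {..<m} (\<lambda>_. \<gamma>))" for x y
    using that by (auto simp: configs_def space_PiM sp PiE_iff extensional_def lessThan_Suc)
  have pint: "integrable (PiM {..<m} (\<lambda>_. \<gamma>) \<Otimes>\<^sub>M \<gamma>) (\<lambda>(x, y). ?f (x(m := y)))"
  proof (rule pf.integrable_const_bound[of _ B])
    show "AE x in PiM {..<m} (\<lambda>_. \<gamma>) \<Otimes>\<^sub>M \<gamma>. norm (case x of (x, y) \<Rightarrow> ?f (x(m := y))) \<le> B"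
      using B upd_cfg by (intro AE_I2) (auto simp: space_pair_measure)
    show "(\<lambda>(x, y). ?f (x(m := y))) \<in> borel_measurable (PiM {..<m} (\<lambda>_. \<gamma>) \<Otimes>\<^sub>M \<gamma>)"
      using measurable_compose[OF upd meas] by (simp add: case_prod_unfold)
  qed
  have pi: "(\<integral>x. (\<Prod>l<m. \<phi> l (shift_pair a (x l))) \<partial>PiM {..<m} (\<lambda>_. \<gamma>)) = (\<Prod>l<m. \<integral>w. \<phi> l (shift_pair a w) \<partial>\<gamma>)" for a
  proof (rule P.product_integral_prod)
    fix l assume "l \<in> {..<m}"
    then have l: "\<phi> l \<in> compactly_supported" using \<phi> by simp
    obtain Bl where "\<And>z. \<bar>\<phi> l z\<bar> \<le> Bl" using compactly_supported_bounded[OF l] by blast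
    moreover have "(\<lambda>w. \<phi> l (shift_pair a w)) \<in> borel_measurable \<gamma>"
      using measurable_compose[OF measurable_shift_pair compactly_supported_measurable[OF l]] \<gamma>(2)
      by (simp cong: measurable_cong_sets)
    ultimately show "integrable \<gamma> (\<lambda>w. \<phi> l (shift_pair a w))"
      by (intro \<gamma>.integrable_const_bound[of _ Bl]) auto
  qed simp
  have "power_integral (Suc m) ?f \<gamma> = (\<integral>x. (\<integral>y. ?f (x(m := y)) \<partial>\<gamma>) \<partial>PiM {..<m} (\<lambda>_. \<gamma>))"
    unfolding power_integral_def lessThan_Suc by (rule P.product_integral_insert[OF _ _ int]) auto
  also have "\<dots> = (\<integral>y. (\<integral>x. ?f (x(m := y)) \<partial>PiM {..<m} (\<lambda>_. \<gamma>)) \<partial>\<gamma>)"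
    by (rule pair.Fubini_integral[OF pint, symmetric])
  also have "\<dots> = (\<integral>y. max 0 (R - norm (snd y - fst y)) * (\<integral>x. (\<Prod>l<m. \<phi> l (shift_pair (- fst y) (x l))) \<partial>PiM {..<m} (\<lambda>_. \<gamma>)) \<partial>\<gamma>)"
    by (simp add: monomial_test_def)
  finally show ?thesis by (simp add: pi)
qed

section \<open>Weighted families of measures whose functionals cancel\<close>

text \<open>Models the difference of two collections with equal functionals: c p is the difference
  of the multiplicities and \<gamma> p represents the orbit p. Through \<open>fin_large\<close>, all
  but finitely many measures can be handled by the smallness of their mass alone.\<close>

locale weighted_measures =
  fixes c :: "'i \<Rightarrow> real" and \<gamma> :: "'i \<Rightarrow> 'd::finite pt measure"
  assumes fin: "\<And>p. finite_measure (\<gamma> p)" and sets_\<gamma>: "\<And>p. sets (\<gamma> p) = sets borel"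
    and mass_le: "\<And>p. measure (\<gamma> p) UNIV \<le> 1"
    and summ: "(\<lambda>p. \<bar>c p\<bar> * measure (\<gamma> p) UNIV) summable_on UNIV"
    and fin_large: "\<And>\<epsilon>. \<epsilon> > 0 \<Longrightarrow> finite {p. c p \<noteq> 0 \<and> measure (\<gamma> p) UNIV \<ge> \<epsilon>}"
    and zero: "\<And>k f. k \<ge> 1 \<Longrightarrow> f \<in> test_functions k \<Longrightarrow> ((\<lambda>p. c p * power_integral k f (\<gamma> p)) has_sum 0) UNIV"
begin

sublocale finite_measure "\<gamma> p" for p by (rule fin)

lemma space_\<gamma>: "space (\<gamma> p) = UNIV" using sets_eq_imp_space_eq[OF sets_\<gamma>[of p]] by simp

definition profile :: "'i \<Rightarrow> ('d pt \<Rightarrow> real) \<Rightarrow> real^'d \<Rightarrow> real" where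
  "profile p \<phi> x = (\<integral>w. \<phi> (shift_pair (- x) w) \<partial>\<gamma> p)"

lemma shifted_measurable:
  assumes "\<phi> \<in> compactly_supported"
  shows "(\<lambda>w. \<phi> (shift_pair a w)) \<in> borel_measurable (\<gamma> p)"
  using measurable_compose[OF measurable_shift_pair compactly_supported_measurable[OF assms]]
    measurable_cong_sets[OF sets_\<gamma>[of p] refl] by blast

lemma profile_bound:
  assumes \<phi>: "\<phi> \<in> compactly_supported" and B: "\<And>z. \<bar>\<phi> z\<bar> \<le> B"
  shows "\<bar>profile p \<phi> x\<bar> \<le> B * measure (\<gamma> p) UNIV"
proof -
  have i: "integrable (\<gamma> p) (\<lambda>w. \<phi> (shift_pair (- x) w))"
    by (rule integrable_const_bound[of _ B]) (use B shifted_measurable[OF \<phi>] in auto)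
  have "\<bar>profile p \<phi> x\<bar> \<le> (\<integral>w. \<bar>\<phi> (shift_pair (- x) w)\<bar> \<partial>\<gamma> p)"
    unfolding profile_def by (rule integral_abs_bound)
  also have "\<dots> \<le> (\<integral>w. B \<partial>\<gamma> p)" using i B by (intro integral_mono) auto
  finally show ?thesis by (simp add: space_\<gamma> mult.commute)
qed

lemma profile_continuous:
  assumes \<phi>: "\<phi> \<in> compactly_supported"
  shows "continuous_on UNIV (profile p \<phi>)"
  unfolding continuous_on_sequentially
proof safe
  fix x :: "nat \<Rightarrow> real^'d" and x0 assume x: "x \<longlonglongrightarrow> x0"
  obtain B where B: "\<And>z. \<bar>\<phi> z\<bar> \<le> B" using compactly_supported_bounded[OF \<phi>] by blast
  have c: "continuous_on UNIV (\<lambda>x. \<phi> (shift_pair (- x) w))" for w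
  proof (rule continuous_on_compose2[of UNIV \<phi>])
    show "continuous_on UNIV \<phi>" using \<phi> by (simp add: compactly_supported_def)
    show "continuous_on UNIV (\<lambda>x. shift_pair (- x) w)"
      by (rule continuous_shift_pair) (rule continuous_on_id continuous_on_const)+
  qed simp
  have "(\<lambda>n. profile p \<phi> (x n)) \<longlonglongrightarrow> profile p \<phi> x0"
    unfolding profile_def
  proof (rule integral_dominated_convergence[where w="\<lambda>_. B"])
    show "AE w in \<gamma> p. (\<lambda>n. \<phi> (shift_pair (- x n) w)) \<longlonglongrightarrow> \<phi> (shift_pair (- x0) w)"
      using continuous_on_tendsto_compose[OF c x] by (intro AE_I2) auto
  qed (use B shifted_measurable[OF \<phi>] in auto)
  then show "(profile p \<phi> \<circ> x) \<longlonglongrightarrow> profile p \<phi> x0" by (simp add: o_def)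
qed

text \<open>Recentring at a far point carries any fixed w out of the support of \<phi>; dominated
  convergence then applies along a sequence of centres that would violate the claim.\<close>

lemma profile_vanishes_at_infinity:
  assumes \<phi>: "\<phi> \<in> compactly_supported" and \<epsilon>: "\<epsilon> > 0"
  shows "\<exists>R. \<forall>x. norm x \<ge> R \<longrightarrow> \<bar>profile p \<phi> x\<bar> \<le> \<epsilon>"
proof (rule ccontr)
  assume "\<not> ?thesis"
  then have "\<forall>n::nat. \<exists>x. norm x \<ge> real n \<and> \<bar>profile p \<phi> x\<bar> > \<epsilon>" by (meson not_le)
  then obtain x where x: "\<And>n. norm (x n) \<ge> real n" "\<And>n. \<bar>profile p \<phi> (x n)\<bar> > \<epsilon>" by metis
  obtain B where B: "\<And>z. \<bar>\<phi> z\<bar> \<le> B" using compactly_supported_bounded[OF \<phi>] by blast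
  obtain R where R: "\<And>z. norm z \<ge> R \<Longrightarrow> \<phi> z = 0" using \<phi> by (auto simp: compactly_supported_def)
  have "(\<lambda>n. profile p \<phi> (x n)) \<longlonglongrightarrow> (\<integral>w. 0 \<partial>\<gamma> p)"
    unfolding profile_def
  proof (rule integral_dominated_convergence[where w="\<lambda>_. B"])
    have "(\<lambda>n. \<phi> (shift_pair (- x n) w)) \<longlonglongrightarrow> 0" for w
    proof (rule tendsto_eventually)
      obtain n0 where n0: "real n0 \<ge> R + norm w" using real_arch_simple by blast
      show "\<forall>\<^sub>F n in sequentially. \<phi> (shift_pair (- x n) w) = 0"
        using eventually_ge_at_top[of n0]
      proof eventually_elim
        case (elim n)
        then have "real n0 \<le> real n" by simp
        then show ?case using n0 x(1)[of n] norm_shift_pair_ge[of "x n" w] by (intro R) linarith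
      qed
    qed
    then show "AE w in \<gamma> p. (\<lambda>n. \<phi> (shift_pair (- x n) w)) \<longlonglongrightarrow> 0" by simp
  qed (use B shifted_measurable[OF \<phi>] in auto)
  then have "(\<lambda>n. \<bar>profile p \<phi> (x n)\<bar>) \<longlonglongrightarrow> 0" using tendsto_rabs_zero by simp
  then have "\<forall>\<^sub>F n in sequentially. \<bar>profile p \<phi> (x n)\<bar> < \<epsilon>" using \<epsilon> by (rule order_tendstoD)
  then show False using x(2) by (auto simp: eventually_sequentially) (metis less_asym' order_refl)
qed

text \<open>The profiles are the integrals of compactly supported functions against the recentred
  measure, and these determine it.\<close>

lemma profile_eq_imp_shift_eq:
  assumes "\<And>\<phi>. \<phi> \<in> compactly_supported \<Longrightarrow> profile p \<phi> x = profile p' \<phi> x'"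
  shows "distr (\<gamma> p) borel (shift_pair (- x)) = distr (\<gamma> p') borel (shift_pair (- x'))"
proof (rule finite_measure_eqI_compactly_supported)
  have m: "shift_pair a \<in> measurable (\<gamma> p) borel" for a p
    using measurable_shift_pair measurable_cong_sets[OF sets_\<gamma>[of p] refl] by blast
  show "finite_measure (distr (\<gamma> p) borel (shift_pair (- x)))" "finite_measure (distr (\<gamma> p') borel (shift_pair (- x')))"
    by (auto intro!: finite_measure_distr m)
  fix \<phi> :: "'d pt \<Rightarrow> real" assume \<phi>: "\<phi> \<in> compactly_supported"
  show "(\<integral>z. \<phi> z \<partial>distr (\<gamma> p) borel (shift_pair (- x))) = (\<integral>z. \<phi> z \<partial>distr (\<gamma> p') borel (shift_pair (- x')))"
    using assms[OF \<phi>] by (simp add: integral_distr m compactly_supported_measurable[OF \<phi>] profile_def)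
qed auto

text \<open>Quantifying over all monomials in the profiles makes the predicate stable under multiplication
  by polynomials in the profiles.\<close>

definition vanishing :: "real \<Rightarrow> ('i \<Rightarrow> 'd pt \<Rightarrow> real) \<Rightarrow> bool" where
  "vanishing R u \<longleftrightarrow> (\<forall>p. u p \<in> borel_measurable borel) \<and> (\<exists>B. \<forall>p z. \<bar>u p z\<bar> \<le> B) \<and>
    (\<forall>(m::nat) \<phi>. (\<forall>l<m. \<phi> l \<in> compactly_supported) \<longrightarrow>
      ((\<lambda>p. c p * (\<integral>z. max 0 (R - norm (snd z - fst z)) * (\<Prod>l<m. profile p (\<phi> l) (fst z)) * u p z \<partial>\<gamma> p)) has_sum 0) UNIV)"

text \<open>For the constant 1 the condition is the hypothesis \<open>zero\<close> applied to the
  monomial test functions.\<close>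

lemma vanishing_1:
  assumes "\<And>p z. u p z = (1 :: real)"
  shows "vanishing R u"
  unfolding vanishing_def
proof (intro conjI allI impI)
  fix m :: nat and \<phi> :: "nat \<Rightarrow> 'd pt \<Rightarrow> real" assume "\<forall>l<m. \<phi> l \<in> compactly_supported"
  then have \<phi>: "\<And>l. l < m \<Longrightarrow> \<phi> l \<in> compactly_supported" by simp
  show "((\<lambda>p. c p * (\<integral>z. max 0 (R - norm (snd z - fst z)) * (\<Prod>l<m. profile p (\<phi> l) (fst z)) * u p z \<partial>\<gamma> p)) has_sum 0) UNIV"
    using zero[OF _ monomial_test_in_test_functions[of m \<phi> R, OF \<phi>]]
    by (simp add: assms power_integral_monomial_test[of m \<phi>, OF \<phi> fin sets_\<gamma>] profile_def)
next
  fix p have "u p = (\<lambda>_. 1)" using assms by auto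
  then show "u p \<in> borel_measurable borel" by simp
qed (use assms in auto)

lemma profile_fst_measurable:
  "\<phi> \<in> compactly_supported \<Longrightarrow> (\<lambda>z :: 'd pt. profile p \<phi> (fst z)) \<in> borel_measurable borel"
  by (rule borel_measurable_continuous_onI, rule continuous_on_compose2[OF profile_continuous])
    (auto intro: continuous_intros)

text \<open>The new factor is absorbed into the monomial, which becomes one degree longer by
  \<open>\<phi>s(m := \<phi>)\<close>.\<close>

lemma vanishing_mult_profile:
  assumes u: "vanishing R u" and \<phi>: "\<phi> \<in> compactly_supported"
  shows "vanishing R (\<lambda>p z. profile p \<phi> (fst z) * u p z)"
  unfolding vanishing_def
proof (intro conjI allI impI)
  fix p
  have [measurable]: "u p \<in> borel_measurable borel" using u by (simp add: vanishing_def)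
  show "(\<lambda>z. profile p \<phi> (fst z) * u p z) \<in> borel_measurable borel"
    using profile_fst_measurable[OF \<phi>] by (intro borel_measurable_times) simp_all
next
  obtain B where B: "\<And>p z. \<bar>u p z\<bar> \<le> B" using u by (auto simp: vanishing_def)
  obtain B' where B': "B' > 0" "\<And>z. \<bar>\<phi> z\<bar> \<le> B'" using compactly_supported_bounded[OF \<phi>] by blast
  have "\<bar>profile p \<phi> x\<bar> \<le> B'" for p x
    using profile_bound[OF \<phi> B'(2), of p x] mult_left_mono[OF mass_le[of p], of B'] B' by linarith
  then have "\<bar>profile p \<phi> (fst z) * u p z\<bar> \<le> B' * B" for p z
    unfolding abs_mult using B B' by (intro mult_mono) auto
  then show "\<exists>B. \<forall>p z. \<bar>profile p \<phi> (fst z) * u p z\<bar> \<le> B" by blast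
next
  fix m :: nat and \<phi>s :: "nat \<Rightarrow> 'd pt \<Rightarrow> real" assume \<phi>s: "\<forall>l<m. \<phi>s l \<in> compactly_supported"
  let ?\<phi> = "\<phi>s(m := \<phi>)"
  have "\<forall>l<Suc m. ?\<phi> l \<in> compactly_supported" using \<phi>s \<phi> by (auto simp: less_Suc_eq)
  then have "((\<lambda>p. c p * (\<integral>z. max 0 (R - norm (snd z - fst z)) * (\<Prod>l<Suc m. profile p (?\<phi> l) (fst z)) * u p z \<partial>\<gamma> p)) has_sum 0) UNIV"
    using u unfolding vanishing_def by blast
  moreover have eq: "(\<Prod>l<Suc m. profile p (?\<phi> l) x) = (\<Prod>l<m. profile p (\<phi>s l) x) * profile p \<phi> x" for p x
    unfolding prod.lessThan_Suc by (intro arg_cong2[where f="(*)"] prod.cong) auto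
  ultimately show "((\<lambda>p. c p * (\<integral>z. max 0 (R - norm (snd z - fst z)) * (\<Prod>l<m. profile p (\<phi>s l) (fst z)) *
      (profile p \<phi> (fst z) * u p z) \<partial>\<gamma> p)) has_sum 0) UNIV"
    unfolding eq by (simp only: mult.assoc)
qed

lemma vanishing_integrable:
  fixes m :: nat
  assumes u: "vanishing R u" and \<phi>: "\<forall>l<m. \<phi> l \<in> compactly_supported"
  shows "integrable (\<gamma> p) (\<lambda>z. max 0 (R - norm (snd z - fst z)) * (\<Prod>l<m. profile p (\<phi> l) (fst z)) * u p z)"
proof -
  obtain B where B: "\<And>p z. \<bar>u p z\<bar> \<le> B" using u by (auto simp: vanishing_def)
  have "\<exists>b. \<forall>x. \<bar>profile p (\<phi> l) x\<bar> \<le> b" if "l < m" for l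
  proof -
    obtain B' where "B' > 0" "\<And>z. \<bar>\<phi> l z\<bar> \<le> B'" using compactly_supported_bounded[of "\<phi> l"] \<phi> \<open>l < m\<close> by blast
    then show ?thesis using profile_bound[of "\<phi> l" B' p] \<phi> \<open>l < m\<close> by blast
  qed
  then obtain b where b: "\<And>l x. l < m \<Longrightarrow> \<bar>profile p (\<phi> l) x\<bar> \<le> b l" by metis
  have [measurable]: "u p \<in> borel_measurable borel" using u by (simp add: vanishing_def)
  have [measurable]: "(\<lambda>z :: 'd pt. profile p (\<phi> l) (fst z)) \<in> borel_measurable borel" if "l \<in> {..<m}" for l
    using \<phi> that by (intro profile_fst_measurable) auto
  have [measurable]: "(\<lambda>z :: 'd pt. max 0 (R - norm (snd z - fst z))) \<in> borel_measurable borel"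
    by (intro borel_measurable_continuous_onI continuous_intros)
  have "(\<lambda>z. max 0 (R - norm (snd z - fst z)) * (\<Prod>l<m. profile p (\<phi> l) (fst z)) * u p z) \<in> borel_measurable borel"
    by measurable
  then have meas: "(\<lambda>z. max 0 (R - norm (snd z - fst z)) * (\<Prod>l<m. profile p (\<phi> l) (fst z)) * u p z) \<in> borel_measurable (\<gamma> p)"
    using measurable_cong_sets[OF sets_\<gamma>[of p] refl] by blast
  show ?thesis
  proof (rule integrable_const_bound[OF _ meas])
    have "norm (max 0 (R - norm (snd z - fst z)) * (\<Prod>l<m. profile p (\<phi> l) (fst z)) * u p z) \<le> \<bar>R\<bar> * (\<Prod>l<m. b l) * B" for z
    proof -
      have "\<bar>\<Prod>l<m. profile p (\<phi> l) (fst z)\<bar> \<le> (\<Prod>l<m. b l)"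
        unfolding abs_prod using b by (intro prod_mono) auto
      moreover have "\<bar>max 0 (R - norm (snd z - fst z))\<bar> \<le> \<bar>R\<bar>"
        using norm_ge_zero[of "snd z - fst z"] abs_ge_self[of R] unfolding max_def by (smt (verit))
      ultimately show ?thesis
        using B[of p z] unfolding real_norm_def abs_mult
        by (intro mult_mono mult_nonneg_nonneg) auto
    qed
    then show "AE z in \<gamma> p. norm (max 0 (R - norm (snd z - fst z)) * (\<Prod>l<m. profile p (\<phi> l) (fst z)) * u p z) \<le> \<bar>R\<bar> * (\<Prod>l<m. b l) * B"
      by simp
  qed
qed

lemma vanishing_lincomb:
  assumes u: "vanishing R u" and v: "vanishing R v"
  shows "vanishing R (\<lambda>p z. a * u p z + b * v p z)"
  unfolding vanishing_def
proof (intro conjI allI impI)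
  fix p
  have [measurable]: "u p \<in> borel_measurable borel" "v p \<in> borel_measurable borel"
    using u v by (simp_all add: vanishing_def)
  show "(\<lambda>z. a * u p z + b * v p z) \<in> borel_measurable borel" by measurable
next
  obtain B where B: "\<And>p z. \<bar>u p z\<bar> \<le> B" using u by (auto simp: vanishing_def)
  obtain B' where B': "\<And>p z. \<bar>v p z\<bar> \<le> B'" using v by (auto simp: vanishing_def)
  have "\<bar>a * u p z + b * v p z\<bar> \<le> \<bar>a\<bar> * B + \<bar>b\<bar> * B'" for p z
    using B[of p z] B'[of p z]
    by (intro order_trans[OF abs_triangle_ineq] add_mono) (auto simp: abs_mult intro!: mult_left_mono)
  then show "\<exists>B. \<forall>p z. \<bar>a * u p z + b * v p z\<bar> \<le> B" by blast
next
  fix m :: nat and \<phi> :: "nat \<Rightarrow> 'd pt \<Rightarrow> real" assume \<phi>: "\<forall>l<m. \<phi> l \<in> compactly_supported"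
  let ?w = "\<lambda>p z. max 0 (R - norm (snd z - fst z)) * (\<Prod>l<m. profile p (\<phi> l) (fst z))"
  have *: "((\<lambda>p. c p * (\<integral>z. ?w p z * u p z \<partial>\<gamma> p)) has_sum 0) UNIV" "((\<lambda>p. c p * (\<integral>z. ?w p z * v p z \<partial>\<gamma> p)) has_sum 0) UNIV"
    using u v \<phi> unfolding vanishing_def by blast+
  have eq: "(\<integral>z. ?w p z * (a * u p z + b * v p z) \<partial>\<gamma> p) = a * (\<integral>z. ?w p z * u p z \<partial>\<gamma> p) + b * (\<integral>z. ?w p z * v p z \<partial>\<gamma> p)" for p
  proof -
    have "(\<integral>z. ?w p z * (a * u p z + b * v p z) \<partial>\<gamma> p) = (\<integral>z. a * (?w p z * u p z) + b * (?w p z * v p z) \<partial>\<gamma> p)"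
      by (intro Bochner_Integration.integral_cong) (auto simp: algebra_simps)
    then show ?thesis
      using vanishing_integrable[OF u \<phi>, of p] vanishing_integrable[OF v \<phi>, of p] by simp
  qed
  have "((\<lambda>p. a * (c p * (\<integral>z. ?w p z * u p z \<partial>\<gamma> p)) + b * (c p * (\<integral>z. ?w p z * v p z \<partial>\<gamma> p))) has_sum (a * 0 + b * 0)) UNIV"
    by (intro has_sum_add has_sum_cmult_right *)
  then show "((\<lambda>p. c p * (\<integral>z. ?w p z * (a * u p z + b * v p z) \<partial>\<gamma> p)) has_sum 0) UNIV"
    unfolding eq distrib_left[of "c _"] mult.left_commute[of "c _" a] mult.left_commute[of "c _" b] by simp
qed

section \<open>Separating one profile from all others\<close>

text \<open>A polynomial in the profiles of p, so that \<open>vanishing\<close> survives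
  multiplication by it. It measures, through the functions in L, how far p seen from x is from p0
  seen from x0.\<close>

definition profile_gap :: "('d pt \<Rightarrow> real) set \<Rightarrow> 'i \<Rightarrow> real^'d \<Rightarrow> 'i \<Rightarrow> real^'d \<Rightarrow> real" where
  "profile_gap L p0 x0 p x = (\<Sum>\<phi>\<in>L. (profile p \<phi> x - profile p0 \<phi> x0)\<^sup>2)"

lemma profile_gap_continuous:
  assumes "L \<subseteq> compactly_supported"
  shows "continuous_on UNIV (profile_gap L p0 x0 p)"
  unfolding profile_gap_def
  by (rule continuous_on_sum, rule continuous_on_power, rule continuous_on_diff)
    (use assms profile_continuous in auto)

lemma profile_gap_mono: "finite L' \<Longrightarrow> L \<subseteq> L' \<Longrightarrow> profile_gap L p0 x0 p x \<le> profile_gap L' p0 x0 p x"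
  unfolding profile_gap_def by (rule sum_mono2) auto

lemma profile_gap_nonneg: "0 \<le> profile_gap L p0 x0 p x"
  unfolding profile_gap_def by (rule sum_nonneg) auto

lemma profile_gap_ge:
  assumes "finite L" "\<phi> \<in> L" "\<bar>profile p \<phi> x\<bar> \<le> \<eta>" "profile p0 \<phi> x0 \<ge> 2 * \<eta>" "\<eta> > 0"
  shows "profile_gap L p0 x0 p x \<ge> \<eta>\<^sup>2"
proof -
  have "\<eta> \<le> \<bar>profile p \<phi> x - profile p0 \<phi> x0\<bar>" using assms by linarith
  then have "\<eta>\<^sup>2 \<le> (profile p \<phi> x - profile p0 \<phi> x0)\<^sup>2" using assms(5) by (metis abs_of_pos abs_le_square_iff)
  also have "\<dots> = profile_gap {\<phi>} p0 x0 p x" by (simp add: profile_gap_def)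
  also have "\<dots> \<le> profile_gap L p0 x0 p x" by (rule profile_gap_mono) (use assms in auto)
  finally show ?thesis .
qed

text \<open>For far x the profile of \<phi>0 is at most \<eta>, which alone leaves a gap of \<eta>
  squared. On the remaining compact set each x is separated by some function, finitely many of them
  suffice, and the continuous positive gap attains its minimum.\<close>

lemma separating_profiles:
  assumes ne: "\<And>x. distr (\<gamma> p) borel (shift_pair (- x)) \<noteq> distr (\<gamma> p0) borel (shift_pair (- x0))"
    and \<phi>0: "\<phi>0 \<in> compactly_supported" and \<eta>: "\<eta> > 0" "profile p0 \<phi>0 x0 \<ge> 2 * \<eta>"
  shows "\<exists>L. finite L \<and> L \<subseteq> compactly_supported \<and> (\<exists>\<delta>>0. \<forall>x. \<delta> \<le> profile_gap L p0 x0 p x)"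
proof -
  obtain R where R: "\<And>x. norm x \<ge> R \<Longrightarrow> \<bar>profile p \<phi>0 x\<bar> \<le> \<eta>"
    using profile_vanishes_at_infinity[OF \<phi>0 \<eta>(1)] by blast
  \<comment> \<open>The absolute value keeps K nonempty for negative R, so that a minimum over K
    exists.\<close>
  define K :: "(real^'d) set" where "K = cball 0 \<bar>R\<bar>"
  have "\<exists>\<phi>\<in>compactly_supported. profile p \<phi> x \<noteq> profile p0 \<phi> x0" for x
    using profile_eq_imp_shift_eq[of p x p0 x0] ne[of x] by blast
  then obtain \<phi> where \<phi>: "\<And>x. \<phi> x \<in> compactly_supported" "\<And>x. profile p (\<phi> x) x \<noteq> profile p0 (\<phi> x) x0" by metis
  define U where "U x = {x'. profile p (\<phi> x) x' \<noteq> profile p0 (\<phi> x) x0}" for x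
  have oU: "open (U x)" for x
  proof -
    have "open (profile p (\<phi> x) -` (- {profile p0 (\<phi> x) x0}))"
      using profile_continuous[OF \<phi>(1)[of x], of p] by (intro open_vimage) auto
    then show ?thesis by (simp add: U_def vimage_def)
  qed
  have "compact K" by (simp add: K_def)
  then obtain T where T: "finite T" "K \<subseteq> (\<Union>x\<in>T. U x)"
    using compactE_image[of K UNIV U] oU \<phi>(2) by (metis (mono_tags, lifting) UNIV_I UN_iff U_def mem_Collect_eq subsetI)
  define L where "L = insert \<phi>0 (\<phi> ` T)"
  have L: "finite L" "L \<subseteq> compactly_supported" "\<phi>0 \<in> L" using T \<phi>0 \<phi>(1) by (auto simp: L_def)
  have pos: "profile_gap L p0 x0 p x > 0" if x: "x \<in> K" for x
  proof -
    obtain y where y: "y \<in> T" "x \<in> U y" using T x by auto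
    have "0 < profile_gap {\<phi> y} p0 x0 p x" using y by (simp add: profile_gap_def U_def)
    also have "\<dots> \<le> profile_gap L p0 x0 p x" by (rule profile_gap_mono) (use L y in \<open>auto simp: L_def\<close>)
    finally show ?thesis .
  qed
  obtain x1 where x1: "x1 \<in> K" "\<And>x. x \<in> K \<Longrightarrow> profile_gap L p0 x0 p x1 \<le> profile_gap L p0 x0 p x"
    using continuous_attains_inf[OF \<open>compact K\<close>, of "profile_gap L p0 x0 p"]
      continuous_on_subset[OF profile_gap_continuous[OF L(2)]] by (auto simp: K_def)
  show ?thesis
  proof (intro exI[of _ L] conjI exI[of _ "min (\<eta>\<^sup>2) (profile_gap L p0 x0 p x1)"] allI)
    fix x
    show "min (\<eta>\<^sup>2) (profile_gap L p0 x0 p x1) \<le> profile_gap L p0 x0 p x"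
    proof (cases "x \<in> K")
      case False
      then have "\<bar>profile p \<phi>0 x\<bar> \<le> \<eta>" by (intro R) (simp add: K_def)
      then show ?thesis using profile_gap_ge[OF L(1,3) _ \<eta>(2,1)] by (simp add: min.coboundedI1)
    qed (simp add: x1(2) min.coboundedI2)
  qed (use L pos[OF x1(1)] \<eta> in auto)
qed

text \<open>If B bounds \<phi>0, measures of mass below \<eta> / B have \<phi>0-profiles of at most
  \<eta> everywhere, so \<phi>0 alone separates them. By \<open>fin_large\<close> finitely many
  measures remain, and these are treated one at a time.\<close>

lemma uniformly_separating_profiles:
  assumes ne: "\<And>p x. p \<noteq> p0 \<Longrightarrow> c p \<noteq> 0 \<Longrightarrow> distr (\<gamma> p) borel (shift_pair (- x)) \<noteq> distr (\<gamma> p0) borel (shift_pair (- x0))"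
    and \<phi>0: "\<phi>0 \<in> compactly_supported" and \<eta>: "\<eta> > 0" "profile p0 \<phi>0 x0 \<ge> 2 * \<eta>"
  shows "\<exists>L. finite L \<and> L \<subseteq> compactly_supported \<and>
    (\<exists>\<delta>>0. \<forall>p. p \<noteq> p0 \<longrightarrow> c p \<noteq> 0 \<longrightarrow> (\<forall>x. \<delta> \<le> profile_gap L p0 x0 p x))"
proof -
  obtain B where B: "B > 0" "\<And>z. \<bar>\<phi>0 z\<bar> \<le> B" using compactly_supported_bounded[OF \<phi>0] by blast
  define P where "P = {p. c p \<noteq> 0 \<and> measure (\<gamma> p) UNIV \<ge> \<eta> / B} - {p0}"
  have "finite P" unfolding P_def using fin_large[of "\<eta> / B"] \<eta> B by simp
  have "\<forall>p\<in>P. \<exists>L. finite L \<and> L \<subseteq> compactly_supported \<and> (\<exists>\<delta>>0. \<forall>x. \<delta> \<le> profile_gap L p0 x0 p x)"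
  proof
    fix p assume "p \<in> P"
    then have "p \<noteq> p0" "c p \<noteq> 0" by (auto simp: P_def)
    from separating_profiles[OF ne[OF this] \<phi>0 \<eta>]
    show "\<exists>L. finite L \<and> L \<subseteq> compactly_supported \<and> (\<exists>\<delta>>0. \<forall>x. \<delta> \<le> profile_gap L p0 x0 p x)" .
  qed
  from bchoice[OF this] obtain L where
    L': "\<forall>p\<in>P. finite (L p) \<and> L p \<subseteq> compactly_supported \<and> (\<exists>\<delta>>0. \<forall>x. \<delta> \<le> profile_gap (L p) p0 x0 p x)" ..
  then have "\<forall>p\<in>P. \<exists>\<delta>. \<delta> > 0 \<and> (\<forall>x. \<delta> \<le> profile_gap (L p) p0 x0 p x)" by blast
  from bchoice[OF this] obtain \<delta> where
    \<delta>': "\<forall>p\<in>P. \<delta> p > 0 \<and> (\<forall>x. \<delta> p \<le> profile_gap (L p) p0 x0 p x)" ..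
  have L: "\<And>p. p \<in> P \<Longrightarrow> finite (L p)" "\<And>p. p \<in> P \<Longrightarrow> L p \<subseteq> compactly_supported"
    "\<And>p. p \<in> P \<Longrightarrow> \<delta> p > 0" "\<And>p x. p \<in> P \<Longrightarrow> \<delta> p \<le> profile_gap (L p) p0 x0 p x"
    using L' \<delta>' by auto
  define LL where "LL = insert \<phi>0 (\<Union>p\<in>P. L p)"
  define d where "d = Min (insert (\<eta>\<^sup>2) (\<delta> ` P))"
  have LL: "finite LL" "LL \<subseteq> compactly_supported" "\<phi>0 \<in> LL" using L \<open>finite P\<close> \<phi>0 by (auto simp: LL_def)
  have "d > 0" unfolding d_def using \<open>finite P\<close> L(3) \<eta> by (subst Min_gr_iff) auto
  have d: "d \<le> \<eta>\<^sup>2" "\<And>p. p \<in> P \<Longrightarrow> d \<le> \<delta> p" unfolding d_def using \<open>finite P\<close> by (auto intro: Min_le)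
  have "d \<le> profile_gap LL p0 x0 p x" if p: "p \<noteq> p0" "c p \<noteq> 0" for p x
  proof (cases "p \<in> P")
    case True
    have "d \<le> profile_gap (L p) p0 x0 p x" using d(2)[OF True] L(4)[OF True, of x] by simp
    also have "\<dots> \<le> profile_gap LL p0 x0 p x" by (rule profile_gap_mono[OF LL(1)]) (use True in \<open>auto simp: LL_def\<close>)
    finally show ?thesis .
  next
    case False
    then have "measure (\<gamma> p) UNIV < \<eta> / B" using p by (auto simp: P_def)
    then have "B * measure (\<gamma> p) UNIV \<le> \<eta>" using B by (simp add: field_simps)
    then have "\<bar>profile p \<phi>0 x\<bar> \<le> \<eta>" using profile_bound[OF \<phi>0 B(2), of p x] by simp
    then have "\<eta>\<^sup>2 \<le> profile_gap LL p0 x0 p x" using profile_gap_ge[OF LL(1,3) _ \<eta>(2,1)] by simp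
    then show ?thesis using d(1) by simp
  qed
  then show ?thesis using LL \<open>d > 0\<close> by blast
qed

text \<open>Each further power arises by operations that preserve \<open>vanishing\<close>:
  multiplication by squared differences of profiles, summation over L, and a linear
  combination.\<close>

lemma vanishing_gap_power:
  assumes L: "finite L" "L \<subseteq> compactly_supported"
  shows "vanishing R (\<lambda>p z. (1 - profile_gap L p0 x0 p (fst z) / M) ^ n)"
proof (induction n)
  case 0
  show ?case by (rule vanishing_1) simp
next
  case (Suc n)
  have sq: "vanishing R (\<lambda>p z. (profile p \<phi> (fst z) - t)\<^sup>2 * u p z)" if u: "vanishing R u" and \<phi>: "\<phi> \<in> compactly_supported" for u \<phi> t
  proof -
    have 1: "vanishing R (\<lambda>p z. 1 * (profile p \<phi> (fst z) * v p z) + (- t) * v p z)" if "vanishing R v" for v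
      by (intro vanishing_lincomb vanishing_mult_profile that \<phi>)
    have "vanishing R (\<lambda>p z. 1 * (profile p \<phi> (fst z) * (1 * (profile p \<phi> (fst z) * u p z) + (- t) * u p z)) +
        (- t) * (1 * (profile p \<phi> (fst z) * u p z) + (- t) * u p z))"
      by (rule 1[OF 1[OF u]])
    moreover have "1 * (profile p \<phi> (fst z) * (1 * (profile p \<phi> (fst z) * u p z) + (- t) * u p z)) +
        (- t) * (1 * (profile p \<phi> (fst z) * u p z) + (- t) * u p z) = (profile p \<phi> (fst z) - t)\<^sup>2 * u p z" for p and z :: "'d pt"
      by (simp add: power2_eq_square algebra_simps)
    ultimately show ?thesis by (simp only:)
  qed
  have gap: "vanishing R (\<lambda>p z. profile_gap L p0 x0 p (fst z) * u p z)" if u: "vanishing R u" for u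
    using L
  proof (induction L rule: finite_induct)
    case empty
    have "vanishing R (\<lambda>p z. 0 * u p z + 0 * u p z)" by (rule vanishing_lincomb[OF u u])
    then show ?case by (simp add: profile_gap_def)
  next
    case (insert \<phi> L)
    have "vanishing R (\<lambda>p z. 1 * ((profile p \<phi> (fst z) - profile p0 \<phi> x0)\<^sup>2 * u p z) + 1 * (profile_gap L p0 x0 p (fst z) * u p z))"
      using insert by (intro vanishing_lincomb sq u) auto
    moreover have "1 * ((profile p \<phi> (fst z) - profile p0 \<phi> x0)\<^sup>2 * u p z) + 1 * (profile_gap L p0 x0 p (fst z) * u p z) =
        profile_gap (insert \<phi> L) p0 x0 p (fst z) * u p z" for p and z :: "'d pt"
      using insert by (simp add: profile_gap_def distrib_right)
    ultimately show ?case by (simp only:)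
  qed
  let ?u = "\<lambda>p z. (1 - profile_gap L p0 x0 p (fst z) / M) ^ n"
  have "vanishing R (\<lambda>p z. 1 * ?u p z + (- 1 / M) * (profile_gap L p0 x0 p (fst z) * ?u p z))"
    by (intro vanishing_lincomb gap Suc)
  moreover have "1 * ?u p z + (- 1 / M) * (profile_gap L p0 x0 p (fst z) * ?u p z) = (1 - profile_gap L p0 x0 p (fst z) / M) ^ Suc n" for p and z :: "'d pt"
    by (simp add: algebra_simps)
  ultimately show ?case by (simp only:)
qed

lemma profile_gap_bounded:
  assumes L: "finite L" "L \<subseteq> compactly_supported"
  shows "\<exists>M. \<forall>p x. profile_gap L p0 x0 p x \<le> M"
proof -
  have "\<forall>\<phi>\<in>L. \<exists>B. \<forall>z. \<bar>\<phi> z\<bar> \<le> B" using L compactly_supported_bounded by (metis subsetD)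
  then obtain B where B: "\<And>\<phi> z. \<phi> \<in> L \<Longrightarrow> \<bar>\<phi> z\<bar> \<le> B \<phi>" by metis
  have b: "\<bar>profile p \<phi> x\<bar> \<le> B \<phi>" if "\<phi> \<in> L" for p \<phi> x
  proof -
    have "B \<phi> \<ge> 0" using B[OF that, of 0] by linarith
    then show ?thesis
      using profile_bound[of \<phi> "B \<phi>" p x] B[OF that] L(2) that mult_left_mono[OF mass_le[of p] \<open>B \<phi> \<ge> 0\<close>] by force
  qed
  have "profile_gap L p0 x0 p x \<le> (\<Sum>\<phi>\<in>L. (2 * B \<phi>)\<^sup>2)" for p x
    unfolding profile_gap_def
  proof (rule sum_mono)
    fix \<phi> assume "\<phi> \<in> L"
    then have "\<bar>profile p \<phi> x - profile p0 \<phi> x0\<bar> \<le> 2 * B \<phi>" using b[of \<phi> p x] b[of \<phi> p0 x0] by linarith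
    then show "(profile p \<phi> x - profile p0 \<phi> x0)\<^sup>2 \<le> (2 * B \<phi>)\<^sup>2" by (metis abs_ge_zero order_trans power2_abs power_mono)
  qed
  then show ?thesis by blast
qed

text \<open>If the profiles of all other measures stayed away from one profile of \<open>p0\<close>,
  the powers of \<open>1 - profile_gap / M\<close> would single out the contribution of \<open>p0\<close>.\<close>

lemma exists_shift_equivalent:
  assumes p0: "c p0 \<noteq> 0" "measure (\<gamma> p0) UNIV > 0"
  shows "\<exists>p x x0. p \<noteq> p0 \<and> c p \<noteq> 0 \<and> distr (\<gamma> p) borel (shift_pair x) = distr (\<gamma> p0) borel (shift_pair x0)"
proof (rule ccontr)
  assume contra: "\<not> ?thesis"
  obtain z0 where z0: "\<And>r. r > 0 \<Longrightarrow> measure (\<gamma> p0) (ball z0 r) > 0"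
    using exists_support_point[OF fin sets_\<gamma> p0(2)] by blast
  define x0 where "x0 = fst z0"
  \<comment> \<open>A bump at the recentred support point: it gives p0, seen from x0, a profile
    bounded away from 0, as the separation lemmas require.\<close>
  define \<phi>0 :: "'d pt \<Rightarrow> real" where "\<phi>0 w = max 0 (1 - dist w (shift_pair (- x0) z0))" for w
  have c0: "continuous_on UNIV \<phi>0" unfolding \<phi>0_def by (intro continuous_intros)
  have "\<phi>0 z = 0" if "norm z \<ge> norm (shift_pair (- x0) z0) + 1" for z
    using norm_triangle_ineq2[of z "shift_pair (- x0) z0"] that by (simp add: \<phi>0_def dist_norm)
  then have \<phi>0: "\<phi>0 \<in> compactly_supported" using c0 by (auto simp: compactly_supported_def)
  have ind: "(1/2) * indicator (ball z0 (1/2)) w \<le> \<phi>0 (shift_pair (- x0) w)" for w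
  proof -
    have "dist (shift_pair (- x0) w) (shift_pair (- x0) z0) = dist w z0"
      by (simp add: shift_pair_def case_prod_unfold dist_norm norm_prod_def)
    then show ?thesis by (auto simp: \<phi>0_def indicator_def dist_commute)
  qed
  have "measure (\<gamma> p0) (ball z0 (1/2)) > 0" using z0 by simp
  have bs: "ball z0 r \<in> sets (\<gamma> p0)" for r by (simp add: sets_\<gamma>)
  \<comment> \<open>After recentring, \<phi>0 is at least 1/2 on this ball, so the profile is at
    least half of its mass, which is 2 \<eta>.\<close>
  define \<eta> where "\<eta> = measure (\<gamma> p0) (ball z0 (1/2)) / 4"
  have \<eta>: "\<eta> > 0" using z0[of "1/2"] by (simp add: \<eta>_def)
  have "2 * \<eta> = (\<integral>w. (1/2) * indicator (ball z0 (1/2)) w \<partial>\<gamma> p0)"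
    using bs by (simp add: \<eta>_def space_\<gamma>)
  also have "\<dots> \<le> profile p0 \<phi>0 x0"
    unfolding profile_def
  proof (rule integral_mono)
    show "integrable (\<gamma> p0) (\<lambda>w. (1/2) * indicator (ball z0 (1/2)) w :: real)"
      by (intro integrable_mult_right integrable_real_indicator) (auto simp: bs emeasure_eq_measure)
    show "integrable (\<gamma> p0) (\<lambda>w. \<phi>0 (shift_pair (- x0) w))"
      by (rule integrable_const_bound[of _ 1]) (auto simp: shifted_measurable[OF \<phi>0], auto simp: \<phi>0_def)
  qed (rule ind)
  finally have \<eta>2: "profile p0 \<phi>0 x0 \<ge> 2 * \<eta>" .
  have "\<And>p x. p \<noteq> p0 \<Longrightarrow> c p \<noteq> 0 \<Longrightarrow> distr (\<gamma> p) borel (shift_pair (- x)) \<noteq> distr (\<gamma> p0) borel (shift_pair (- x0))"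
    using contra by blast
  from uniformly_separating_profiles[OF this \<phi>0 \<eta> \<eta>2]
  obtain L d where L: "finite L" "L \<subseteq> compactly_supported" and d: "d > 0"
    and sep: "\<And>p x. p \<noteq> p0 \<Longrightarrow> c p \<noteq> 0 \<Longrightarrow> d \<le> profile_gap L p0 x0 p x" by blast
  obtain M0 where M0: "\<And>p x. profile_gap L p0 x0 p x \<le> M0" using profile_gap_bounded[OF L] by blast
  \<comment> \<open>M bounds all gaps, so that 1 - gap / M stays in [0, 1]; M \<ge> 2 d keeps the
    number b below positive.\<close>
  define M where "M = max M0 (2 * d)"
  have M: "M > 0" "\<And>p x. profile_gap L p0 x0 p x \<le> M" "2 * d \<le> M"
    using d M0 by (auto simp: M_def max_def intro: order_trans)
  let ?q = "profile_gap L p0 x0"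
  have q0: "?q p0 x0 = 0" by (simp add: profile_gap_def)
  have "open {x. ?q p0 x < d / 2}"
    by (intro open_Collect_less profile_gap_continuous[OF L(2)] continuous_on_const)
  moreover have "x0 \<in> {x. ?q p0 x < d / 2}" using q0 d by simp
  ultimately obtain r0 where r0: "r0 > 0" "\<And>x. dist x x0 < r0 \<Longrightarrow> ?q p0 x < d / 2"
    unfolding open_dist by blast
  define r where "r = min r0 (1/2)"
  \<comment> \<open>The difference of the two components varies by at most 1 over the ball of radius
    r \<le> 1/2 around z0, so the 2 makes the weight \<psi> at least 1 there.\<close>
  define R where "R = norm (snd z0 - fst z0) + 2"
  define \<psi> :: "'d pt \<Rightarrow> real" where "\<psi> z = max 0 (R - norm (snd z - fst z))" for z
  have R0: "R \<ge> 0" by (simp add: R_def)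
  have \<psi>R: "0 \<le> \<psi> z" "\<psi> z \<le> R" for z using R0 norm_ge_zero[of "snd z - fst z"] unfolding \<psi>_def max_def by (smt (verit))+
  have r: "r > 0" using r0 by (simp add: r_def)
  have ball: "?q p0 (fst z) < d / 2" "\<psi> z \<ge> 1" if "z \<in> ball z0 r" for z
  proof -
    have z: "dist z z0 < r" using that by (simp add: dist_commute)
    have f: "dist (fst z) (fst z0) < r" "dist (snd z) (snd z0) < r"
      using dist_fst_le[of z z0] dist_snd_le[of z z0] z by linarith+
    show "?q p0 (fst z) < d / 2" using f r0(2) by (simp add: x0_def r_def)
    have "norm (snd z - fst z) \<le> norm (snd z0 - fst z0) + norm (snd z - snd z0) + norm (fst z - fst z0)"
      using norm_triangle_ineq4[of "snd z - snd z0" "fst z - fst z0"] norm_triangle_ineq[of "snd z0 - fst z0" "(snd z - snd z0) - (fst z - fst z0)"]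
      by (simp add: algebra_simps)
    then have "norm (snd z - fst z) \<le> norm (snd z0 - fst z0) + 1" using f by (simp add: dist_norm r_def)
    then show "\<psi> z \<ge> 1" by (simp add: \<psi>_def R_def)
  qed
  \<comment> \<open>Near z0 the gap of p0 is below d / 2, so its factor exceeds a; every other
    measure has gap at least d, so its factor is at most b < a. High powers let p0 dominate the sum
    of all others.\<close>
  define a where "a = 1 - d / 2 / M" define b where "b = 1 - d / M"
  have ab: "0 < b" "b < a" "a \<le> 1" using d M by (auto simp: a_def b_def field_simps)
  define J where "J n p = (\<integral>z. \<psi> z * (1 - ?q p (fst z) / M) ^ n \<partial>\<gamma> p)" for n p
  have q01: "0 \<le> 1 - ?q p x / M" "1 - ?q p x / M \<le> 1" for p x
    using M(1) M(2)[of p x] profile_gap_nonneg[of L p0 x0 p x] by (auto simp: field_simps)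
  have int: "integrable (\<gamma> p) (\<lambda>z. \<psi> z * (1 - ?q p (fst z) / M) ^ n)" for p n
    using vanishing_integrable[OF vanishing_gap_power[OF L, of R p0 x0 M n], of 0] by (simp add: \<psi>_def)
  have Jsum: "((\<lambda>p. c p * J n p) has_sum 0) UNIV" for n
  proof -
    have "vanishing R (\<lambda>p z. (1 - ?q p (fst z) / M) ^ n)" by (rule vanishing_gap_power[OF L])
    \<comment> \<open>The instance of \<open>vanishing\<close> for the empty monomial, whose
      functions may be arbitrary.\<close>
    then have "((\<lambda>p. c p * (\<integral>z. max 0 (R - norm (snd z - fst z)) * (\<Prod>l<(0::nat). profile p (undefined l) (fst z)) * (1 - ?q p (fst z) / M) ^ n \<partial>\<gamma> p)) has_sum 0) UNIV"
      unfolding vanishing_def by blast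
    then show ?thesis by (simp add: J_def \<psi>_def)
  qed
  have low: "J n p0 \<ge> a ^ n * measure (\<gamma> p0) (ball z0 r)" for n
  proof -
    have "a ^ n * measure (\<gamma> p0) (ball z0 r) = (\<integral>z. a ^ n * indicator (ball z0 r) z \<partial>\<gamma> p0)"
      using bs by (simp add: space_\<gamma>)
    also have "\<dots> \<le> J n p0"
      unfolding J_def
    proof (rule integral_mono[OF _ int])
      show "integrable (\<gamma> p0) (\<lambda>z. a ^ n * indicator (ball z0 r) z)"
        by (intro integrable_mult_right integrable_real_indicator) (auto simp: bs emeasure_eq_measure)
      fix z
      show "a ^ n * indicator (ball z0 r) z \<le> \<psi> z * (1 - ?q p0 (fst z) / M) ^ n"
      proof (cases "z \<in> ball z0 r")
        case True
        have "a ^ n \<le> (1 - ?q p0 (fst z) / M) ^ n"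
          using M(1,3) d ball(1)[OF True] by (intro power_mono) (auto simp: a_def field_simps)
        then have "1 * a ^ n \<le> \<psi> z * (1 - ?q p0 (fst z) / M) ^ n"
          using ball(2)[OF True] ab by (intro mult_mono) auto
        then show ?thesis using True by simp
      qed (use \<psi>R(1) q01(1) in \<open>simp\<close>)
    qed
    finally show ?thesis .
  qed
  have up: "\<bar>c p * J n p\<bar> \<le> R * b ^ n * (\<bar>c p\<bar> * measure (\<gamma> p) UNIV)" if p: "p \<noteq> p0" for n p
  proof (cases "c p = 0")
    case False
    have "J n p \<le> (\<integral>z. R * b ^ n \<partial>\<gamma> p)"
      unfolding J_def
    proof (rule integral_mono[OF int])
      fix z :: "'d pt"
      have "(1 - ?q p (fst z) / M) ^ n \<le> b ^ n"
        using sep[OF p False, of "fst z"] M(1) q01(1) by (intro power_mono) (auto simp: b_def divide_right_mono)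
      then show "\<psi> z * (1 - ?q p (fst z) / M) ^ n \<le> R * b ^ n"
        using \<psi>R[of z] q01(1) by (intro mult_mono) auto
    qed simp
    moreover have "J n p \<ge> 0" unfolding J_def using \<psi>R(1) q01(1) by (intro Bochner_Integration.integral_nonneg) simp
    ultimately have "\<bar>c p\<bar> * \<bar>J n p\<bar> \<le> \<bar>c p\<bar> * (R * b ^ n * measure (\<gamma> p) UNIV)"
      by (intro mult_left_mono) (auto simp: space_\<gamma> mult.commute mult.left_commute)
    then show ?thesis by (simp add: abs_mult mult.left_commute)
  qed simp
  define S where "S = (\<Sum>\<^sub>\<infinity>p. \<bar>c p\<bar> * measure (\<gamma> p) UNIV)"
  have ineq: "\<bar>c p0\<bar> * (a ^ n * measure (\<gamma> p0) (ball z0 r)) \<le> R * b ^ n * S" for n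
  proof -
    have s: "(\<lambda>p. R * b ^ n * (\<bar>c p\<bar> * measure (\<gamma> p) UNIV)) summable_on UNIV"
      by (intro summable_on_cmult_right summ)
    have hs: "((\<lambda>p. c p * J n p) has_sum (0 - c p0 * J n p0)) (UNIV - {p0})"
      by (rule has_sum_Diff[OF Jsum]) (auto intro: has_sum_finiteI)
    have abs: "(\<lambda>p. norm (c p * J n p)) summable_on (UNIV - {p0})"
      by (rule Infinite_Sum.abs_summable_on_comparison_test'[OF summable_on_subset_banach[OF s]]) (use up in auto)
    have "\<bar>c p0 * J n p0\<bar> = norm (\<Sum>\<^sub>\<infinity>p\<in>UNIV - {p0}. c p * J n p)" using infsumI[OF hs] by simp
    also have "\<dots> \<le> (\<Sum>\<^sub>\<infinity>p\<in>UNIV - {p0}. norm (c p * J n p))" by (rule norm_infsum_bound[OF abs])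
    also have "\<dots> \<le> (\<Sum>\<^sub>\<infinity>p. R * b ^ n * (\<bar>c p\<bar> * measure (\<gamma> p) UNIV))"
      by (rule infsum_mono_neutral[OF abs s]) (use up R0 ab in auto)
    also have "\<dots> = R * b ^ n * S" by (simp add: infsum_cmult_right' S_def)
    finally have "\<bar>c p0 * J n p0\<bar> \<le> R * b ^ n * S" .
    moreover have "\<bar>c p0\<bar> * (a ^ n * measure (\<gamma> p0) (ball z0 r)) \<le> \<bar>c p0 * J n p0\<bar>"
      unfolding abs_mult using low[of n] by (intro mult_left_mono) auto
    ultimately show ?thesis by simp
  qed
  \<comment> \<open>After division by the n-th power of a, the right-hand side tends to 0 while the
    left-hand side is a positive constant.\<close>
  have "\<bar>c p0\<bar> * measure (\<gamma> p0) (ball z0 r) \<le> R * S * (b / a) ^ n" for n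
  proof -
    have "a ^ n > 0" using ab by simp
    then show ?thesis using ineq[of n] by (simp add: power_divide field_simps)
  qed
  moreover have "(\<lambda>n. R * S * (b / a) ^ n) \<longlonglongrightarrow> R * S * 0"
    using ab by (intro tendsto_mult tendsto_const LIMSEQ_realpow_zero) auto
  ultimately have "\<bar>c p0\<bar> * measure (\<gamma> p0) (ball z0 r) \<le> 0"
    by (intro LIMSEQ_le_const[of "\<lambda>n. R * S * (b / a) ^ n"]) auto
  then show False using p0 z0[OF r] by (simp add: mult_le_0_iff)
qed

end

section \<open>From equal functionals to equal collections\<close>

lemma shift_pair_shift_pair: "shift_pair a (shift_pair b z) = shift_pair (b + a) z"
  by (simp add: shift_pair_def case_prod_unfold add.assoc)

lemma distr_shift_pair_shift_pair:
  assumes "sets \<gamma> = sets borel"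
  shows "distr (distr \<gamma> borel (shift_pair a)) borel (shift_pair b) = distr \<gamma> borel (shift_pair (a + b))"
proof -
  have "shift_pair a \<in> measurable \<gamma> borel"
    using measurable_shift_pair measurable_cong_sets[OF assms refl] by blast
  then show ?thesis
    by (subst distr_distr) (auto simp: o_def shift_pair_shift_pair)
qed

text \<open>Orbits of a group action with a common element coincide; the displacements a and b in
  the proof account for the unknown chosen representatives.\<close>

lemma diag_orbit_eqI:
  fixes \<mu> \<nu> \<mu>' \<nu>' :: "(real^'d::finite) measure"
  assumes \<mu>: "\<mu> \<in> subprob_measures" "\<nu> \<in> subprob_measures" and \<mu>': "\<mu>' \<in> subprob_measures" "\<nu>' \<in> subprob_measures"
    and eq: "distr (orbit_rep (diag_orbit \<mu> \<nu>)) borel (shift_pair x) = distr (orbit_rep (diag_orbit \<mu>' \<nu>')) borel (shift_pair x')"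
  shows "diag_orbit \<mu> \<nu> = diag_orbit \<mu>' \<nu>'"
proof -
  have sub: "diag_orbit \<mu> \<nu> \<subseteq> diag_orbit \<mu>' \<nu>'"
    if \<mu>: "\<mu> \<in> subprob_measures" "\<nu> \<in> subprob_measures" and \<mu>': "\<mu>' \<in> subprob_measures" "\<nu>' \<in> subprob_measures"
    and eq: "distr (orbit_rep (diag_orbit \<mu> \<nu>)) borel (shift_pair x) = distr (orbit_rep (diag_orbit \<mu>' \<nu>')) borel (shift_pair x')"
    for \<mu> \<nu> \<mu>' \<nu>' :: "(real^'d) measure" and x x'
  proof -
    note s = pair_subprob(2)[OF \<mu>] pair_subprob(2)[OF \<mu>']
    obtain a where a: "orbit_rep (diag_orbit \<mu> \<nu>) = distr (\<mu> \<Otimes>\<^sub>M \<nu>) borel (shift_pair a)"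
      using orbit_rep_diag_orbit[OF \<mu>] by blast
    obtain b where b: "orbit_rep (diag_orbit \<mu>' \<nu>') = distr (\<mu>' \<Otimes>\<^sub>M \<nu>') borel (shift_pair b)"
      using orbit_rep_diag_orbit[OF \<mu>'] by blast
    have e: "distr (\<mu> \<Otimes>\<^sub>M \<nu>) borel (shift_pair (a + x)) = distr (\<mu>' \<Otimes>\<^sub>M \<nu>') borel (shift_pair (b + x'))"
      using eq by (simp add: a b distr_shift_pair_shift_pair s)
    have "distr (\<mu> \<Otimes>\<^sub>M \<nu>) borel (shift_pair y) = distr (\<mu>' \<Otimes>\<^sub>M \<nu>') borel (shift_pair (b + x' - (a + x) + y))" for y
    proof -
      have "distr (\<mu> \<Otimes>\<^sub>M \<nu>) borel (shift_pair (a + x + (y - (a + x)))) = distr (\<mu>' \<Otimes>\<^sub>M \<nu>') borel (shift_pair (b + x' + (y - (a + x))))"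
        using arg_cong[OF e, of "\<lambda>M. distr M borel (shift_pair (y - (a + x)))"]
        by (simp only: distr_shift_pair_shift_pair s)
      then show ?thesis by (simp add: algebra_simps)
    qed
    then show ?thesis unfolding diag_orbit_eq[OF \<mu>] diag_orbit_eq[OF \<mu>'] by blast
  qed
  show ?thesis using sub[OF \<mu> \<mu>' eq] sub[OF \<mu>' \<mu> eq[symmetric]] by blast
qed

lemma orbit_collections_support:
  fixes \<xi> :: "'d::finite orbit_collection"
  assumes "\<xi> \<in> orbit_collections" "\<xi> p \<noteq> 0"
  obtains \<mu> \<nu> where "\<mu> \<in> subprob_measures" "\<nu> \<in> subprob_measures" "p = diag_orbit \<mu> \<nu>" "p \<noteq> trivial_orbit"
proof -
  obtain I \<alpha> \<beta> where \<xi>: "\<xi> = collection_of I \<alpha> \<beta>" and fam: "subprob_family I \<alpha> \<beta>"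
    using assms(1) by (auto simp: orbit_collections_eq)
  have p: "p \<noteq> trivial_orbit" and "card {i \<in> I. diag_orbit (\<alpha> i) (\<beta> i) = p} \<noteq> 0"
    using assms(2) by (auto simp: \<xi> collection_of_def split: if_splits)
  then have "{i \<in> I. diag_orbit (\<alpha> i) (\<beta> i) = p} \<noteq> {}" by (metis card.empty)
  then show ?thesis using that p subprob_familyD(1,2)[OF fam] by blast
qed

lemma orbit_collections_mass_summable:
  fixes \<xi> :: "'d::finite orbit_collection"
  assumes "\<xi> \<in> orbit_collections"
  shows "(\<lambda>p. real (\<xi> p) * orbit_mass p) summable_on UNIV"
proof -
  obtain I \<alpha> \<beta> where \<xi>: "\<xi> = collection_of I \<alpha> \<beta>" and fam: "subprob_family I \<alpha> \<beta>"
    using assms(1) by (auto simp: orbit_collections_eq)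
  have "orbit_mass (trivial_orbit :: 'd orbit) = 0"
    by (simp add: trivial_orbit_def orbit_mass_diag_orbit null_measure_subprob)
  moreover have "(\<lambda>i. orbit_mass (diag_orbit (\<alpha> i) (\<beta> i))) summable_on I"
  proof (rule summable_on_comparison_test[OF summable_on_mass(1)[OF fam]])
    fix i assume "i \<in> I"
    then have m: "\<alpha> i \<in> subprob_measures" "\<beta> i \<in> subprob_measures" using subprob_familyD(1,2)[OF fam] by auto
    show "orbit_mass (diag_orbit (\<alpha> i) (\<beta> i)) \<le> measure (\<alpha> i) UNIV"
      using subprob_measuresD(4)[OF m(2)] by (simp add: orbit_mass_diag_orbit m mult_left_le)
    show "0 \<le> orbit_mass (diag_orbit (\<alpha> i) (\<beta> i))" by (simp add: orbit_mass_def)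
  qed
  ultimately show ?thesis
    unfolding \<xi> by (rule has_sum_imp_summable[OF has_sum_collection_of[OF fam]])
qed

lemma orbit_collections_large_finite:
  fixes \<xi> :: "'d::finite orbit_collection"
  assumes "\<xi> \<in> orbit_collections" "\<epsilon> > 0"
  shows "finite {p. \<xi> p \<noteq> 0 \<and> orbit_mass p \<ge> \<epsilon>}"
proof -
  obtain I \<alpha> \<beta> where \<xi>: "\<xi> = collection_of I \<alpha> \<beta>" and fam: "subprob_family I \<alpha> \<beta>"
    using assms(1) by (auto simp: orbit_collections_eq)
  have "{p. \<xi> p \<noteq> 0 \<and> orbit_mass p \<ge> \<epsilon>} \<subseteq> (\<lambda>i. diag_orbit (\<alpha> i) (\<beta> i)) ` {i \<in> I. orbit_mass (diag_orbit (\<alpha> i) (\<beta> i)) \<ge> \<epsilon>}"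
  proof
    fix p assume p: "p \<in> {p. \<xi> p \<noteq> 0 \<and> orbit_mass p \<ge> \<epsilon>}"
    then have "card {i \<in> I. diag_orbit (\<alpha> i) (\<beta> i) = p} \<noteq> 0" by (auto simp: \<xi> collection_of_def split: if_splits)
    then have "{i \<in> I. diag_orbit (\<alpha> i) (\<beta> i) = p} \<noteq> {}" by (metis card.empty)
    then show "p \<in> (\<lambda>i. diag_orbit (\<alpha> i) (\<beta> i)) ` {i \<in> I. orbit_mass (diag_orbit (\<alpha> i) (\<beta> i)) \<ge> \<epsilon>}" using p by auto
  qed
  then show ?thesis using finite_orbit_fibre[OF fam assms(2)] finite_surj by blast
qed

lemma has_sum_Lambda:
  fixes \<xi> :: "'d::finite orbit_collection"
  assumes "\<xi> \<in> orbit_collections" "k \<ge> 1" "f \<in> test_functions k"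
  shows "((\<lambda>p. real (\<xi> p) * orbit_integral k f p) has_sum Lambda (k, f) \<xi>) UNIV"
proof -
  obtain I \<alpha> \<beta> where "\<xi> = collection_of I \<alpha> \<beta>" "subprob_family I \<alpha> \<beta>"
    using assms(1) by (auto simp: orbit_collections_eq)
  then show ?thesis using has_sum_Lambda_collection_of assms(2,3) by blast
qed

text \<open>An orbit with different multiplicities has nonzero weight in the difference. By
  \<open>exists_shift_equivalent\<close> it shares a translate with a different orbit of nonzero
  weight, yet orbits with a common translate are equal.\<close>

theorem Lambda_separates:
  fixes \<xi>1 \<xi>2 :: "'d::finite orbit_collection"
  assumes \<xi>: "\<xi>1 \<in> orbit_collections" "\<xi>2 \<in> orbit_collections"
    and eq: "\<And>k f. k \<ge> 1 \<Longrightarrow> f \<in> test_functions k \<Longrightarrow> Lambda (k, f) \<xi>1 = Lambda (k, f) \<xi>2"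
  shows "\<xi>1 = \<xi>2"
proof (rule ccontr)
  assume "\<xi>1 \<noteq> \<xi>2"
  then obtain p0 where "\<xi>1 p0 \<noteq> \<xi>2 p0" by blast
  define c where "c p = real (\<xi>1 p) - real (\<xi>2 p)" for p
  \<comment> \<open>Where c vanishes, p may be an arbitrary set of measures and
    \<open>orbit_rep p\<close> need not be a finite Borel measure; the null measure is a harmless
    default.\<close>
  define \<gamma> where "\<gamma> p = (if c p = 0 then null_measure borel else orbit_rep p)" for p
  have c_supp: "\<xi>1 p \<noteq> 0 \<or> \<xi>2 p \<noteq> 0" if "c p \<noteq> 0" for p using that by (auto simp: c_def)
  have valid: "\<exists>\<mu> \<nu>. \<mu> \<in> subprob_measures \<and> \<nu> \<in> subprob_measures \<and> p = diag_orbit \<mu> \<nu> \<and> p \<noteq> trivial_orbit" if "c p \<noteq> 0" for p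
    using c_supp[OF that] orbit_collections_support[OF \<xi>(1)] orbit_collections_support[OF \<xi>(2)] by metis
  have null: "finite_measure (null_measure borel :: 'd pt measure)" by (rule finite_measureI) simp
  interpret weighted_measures c \<gamma>
  proof (rule weighted_measures.intro)
    fix p
    have *: "finite_measure (\<gamma> p) \<and> sets (\<gamma> p) = sets borel \<and> measure (\<gamma> p) UNIV \<le> 1"
    proof (cases "c p = 0")
      case False
      obtain \<mu> \<nu> where \<mu>\<nu>: "\<mu> \<in> subprob_measures" "\<nu> \<in> subprob_measures" and p: "p = diag_orbit \<mu> \<nu>"
        using valid[OF False] by blast
      have "orbit_mass p \<le> 1"
        unfolding p orbit_mass_diag_orbit[OF \<mu>\<nu>] using subprob_measuresD(4)[OF \<mu>\<nu>(1)] subprob_measuresD(4)[OF \<mu>\<nu>(2)]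
        by (simp add: mult_le_one)
      moreover have "\<gamma> p = orbit_rep p" using False by (simp add: \<gamma>_def)
      ultimately show ?thesis
        using finite_measure_orbit_rep[OF \<mu>\<nu>] sets_orbit_rep[OF \<mu>\<nu>] by (simp only: orbit_mass_def p)
    qed (simp add: \<gamma>_def null)
    show "finite_measure (\<gamma> p)" "sets (\<gamma> p) = sets borel" "measure (\<gamma> p) UNIV \<le> 1" using * by blast+
  next
    have s: "(\<lambda>p. real (\<xi>1 p) * orbit_mass p + real (\<xi>2 p) * orbit_mass p) summable_on UNIV"
      by (intro summable_on_add orbit_collections_mass_summable \<xi>)
    show "(\<lambda>p. \<bar>c p\<bar> * measure (\<gamma> p) UNIV) summable_on UNIV"
    proof (rule summable_on_comparison_test[OF s])
      fix p
      show "\<bar>c p\<bar> * measure (\<gamma> p) UNIV \<le> real (\<xi>1 p) * orbit_mass p + real (\<xi>2 p) * orbit_mass p"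
        unfolding distrib_right[symmetric]
        by (intro mult_mono) (auto simp: c_def \<gamma>_def orbit_mass_def)
    qed simp
  next
    fix \<epsilon> :: real assume "\<epsilon> > 0"
    have "{p. c p \<noteq> 0 \<and> measure (\<gamma> p) UNIV \<ge> \<epsilon>} \<subseteq> {p. \<xi>1 p \<noteq> 0 \<and> orbit_mass p \<ge> \<epsilon>} \<union> {p. \<xi>2 p \<noteq> 0 \<and> orbit_mass p \<ge> \<epsilon>}"
    proof
      fix p assume "p \<in> {p. c p \<noteq> 0 \<and> measure (\<gamma> p) UNIV \<ge> \<epsilon>}"
      then show "p \<in> {p. \<xi>1 p \<noteq> 0 \<and> orbit_mass p \<ge> \<epsilon>} \<union> {p. \<xi>2 p \<noteq> 0 \<and> orbit_mass p \<ge> \<epsilon>}"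
        using c_supp[of p] by (auto simp: \<gamma>_def orbit_mass_def)
    qed
    then show "finite {p. c p \<noteq> 0 \<and> measure (\<gamma> p) UNIV \<ge> \<epsilon>}"
      using orbit_collections_large_finite[OF \<xi>(1) \<open>\<epsilon> > 0\<close>] orbit_collections_large_finite[OF \<xi>(2) \<open>\<epsilon> > 0\<close>]
      by (meson finite_UnI finite_subset)
  next
    fix k and f :: "'d config \<Rightarrow> real" assume k: "k \<ge> 1" and f: "f \<in> test_functions k"
    have "((\<lambda>p. real (\<xi>1 p) * orbit_integral k f p - real (\<xi>2 p) * orbit_integral k f p) has_sum (Lambda (k, f) \<xi>1 - Lambda (k, f) \<xi>2)) UNIV"
      by (intro has_sum_diff has_sum_Lambda \<xi> k f)
    moreover have "real (\<xi>1 p) * orbit_integral k f p - real (\<xi>2 p) * orbit_integral k f p = c p * power_integral k f (\<gamma> p)" for p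
      unfolding left_diff_distrib[symmetric] c_def[symmetric] by (cases "c p = 0") (simp_all add: \<gamma>_def orbit_integral_rep)
    ultimately show "((\<lambda>p. c p * power_integral k f (\<gamma> p)) has_sum 0) UNIV"
      using eq[OF k f] by simp
  qed
  have c0: "c p0 \<noteq> 0" using \<open>\<xi>1 p0 \<noteq> \<xi>2 p0\<close> by (simp add: c_def)
  obtain \<mu>0 \<nu>0 where p0: "\<mu>0 \<in> subprob_measures" "\<nu>0 \<in> subprob_measures" "p0 = diag_orbit \<mu>0 \<nu>0" "p0 \<noteq> trivial_orbit"
    using valid[OF c0] by blast
  have "measure (\<gamma> p0) UNIV > 0"
    using orbit_mass_pos[OF p0(1,2)] p0(3,4) c0 by (simp add: \<gamma>_def orbit_mass_def)
  from exists_shift_equivalent[OF c0 this] obtain p x x0 where p: "p \<noteq> p0" "c p \<noteq> 0"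
    "distr (\<gamma> p) borel (shift_pair x) = distr (\<gamma> p0) borel (shift_pair x0)" by blast
  obtain \<mu> \<nu> where "\<mu> \<in> subprob_measures" "\<nu> \<in> subprob_measures" "p = diag_orbit \<mu> \<nu>" using valid[OF p(2)] by blast
  then have "p = p0" using diag_orbit_eqI[of \<mu> \<nu> \<mu>0 \<nu>0 x x0] p0 p c0 by (simp add: \<gamma>_def)
  then show False using p by simp
qed

section \<open>Vague compactness\<close>

text \<open>A Borel code of the points of Euclidean space by real numbers reduces vague limits to Helly's theorem
  on the line: the code records, as ternary digits, on which side of each rational hyperplane the image
  of the point in the unit ball lies.\<close>

definition squash :: "'a::real_normed_vector \<Rightarrow> 'a" where
  "squash x = x /\<^sub>R (1 + norm x)"

definition unsquash :: "'a::real_normed_vector \<Rightarrow> 'a" where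
  "unsquash z = z /\<^sub>R (1 - norm z)"

lemma norm_squash: "norm (squash x) = norm x / (1 + norm x)"
  by (simp add: squash_def divide_inverse mult.commute)

lemma norm_squash_less: "norm (squash x) < 1"
  unfolding norm_squash using norm_ge_zero[of x] by (subst divide_less_eq_1_pos) linarith+

lemma unsquash_squash: "unsquash (squash x) = x"
proof -
  have "1 + norm x \<noteq> 0" using norm_ge_zero[of x] by linarith
  then have "1 - norm (squash x) = inverse (1 + norm x)" unfolding norm_squash by (simp add: field_simps)
  then show ?thesis using \<open>1 + norm x \<noteq> 0\<close> by (simp add: unsquash_def squash_def)
qed

lemma continuous_squash: "continuous_on UNIV squash"
proof -
  have "1 + norm x \<noteq> 0" for x :: 'a using norm_ge_zero[of x] by linarith
  then show ?thesis unfolding squash_def by (intro continuous_intros) auto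
qed

lemma continuous_unsquash: "continuous_on (ball 0 1) unsquash"
  unfolding unsquash_def by (intro continuous_intros) auto

lemma norm_unsquash: "norm z < 1 \<Longrightarrow> norm (unsquash z) = norm z / (1 - norm z)"
  by (simp add: unsquash_def divide_inverse mult.commute)

section \<open>The ternary code of a point\<close>

definition code_bit :: "nat \<Rightarrow> real^'d::finite \<Rightarrow> real" where
  "code_bit m x = (if squash x $ fst (from_nat m :: 'd \<times> rat) < of_rat (snd (from_nat m :: 'd \<times> rat)) then 1 else 0)"

text \<open>With digits 0 and 1 in base 3, everything after position n contributes at most half of
  the unit at position n, so digits can be read off from approximate values of the code; in base 2
  they could not.\<close>

definition code :: "real^'d::finite \<Rightarrow> real" where
  "code x = (\<Sum>m. code_bit m x / 3 ^ m)"

lemma code_bit_01: "code_bit m x = 0 \<or> code_bit m x = 1"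
  by (simp add: code_bit_def)

lemma summable_thirds: "summable (\<lambda>m. 1 / 3 ^ m :: real)"
  using summable_geometric[of "1/3 :: real"] by (simp add: power_one_over)

lemma suminf_thirds: "(\<Sum>m. 1 / 3 ^ m :: real) = 3 / 2"
  using suminf_geometric[of "1/3 :: real"] by (simp add: power_one_over)

lemma code_summable: "summable (\<lambda>m. code_bit m x / 3 ^ m)"
  by (rule summable_comparison_test'[OF summable_thirds, of 0]) (simp add: code_bit_def)

lemma code_bounds: "0 \<le> code x" "code x \<le> 3 / 2"
proof -
  show "0 \<le> code x" unfolding code_def
    by (rule suminf_nonneg[OF code_summable]) (simp add: code_bit_def)
  have "code x \<le> (\<Sum>m. 1 / 3 ^ m)" unfolding code_def
    by (rule suminf_le[OF _ code_summable summable_thirds]) (simp add: code_bit_def)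
  then show "code x \<le> 3 / 2" by (simp add: suminf_thirds)
qed

lemma code_measurable[measurable]: "code \<in> borel_measurable borel"
proof -
  have [measurable]: "squash \<in> borel_measurable (borel :: (real^'d) measure)"
    by (rule borel_measurable_continuous_onI[OF continuous_squash])
  have [measurable]: "(\<lambda>x :: real^'d. squash x $ i) \<in> borel_measurable borel" for i
    by (rule borel_measurable_continuous_onI[OF bounded_linear.continuous_on[OF bounded_linear_vec_nth continuous_squash]])
  have "code_bit m \<in> borel_measurable (borel :: (real^'d) measure)" for m
    unfolding code_bit_def by measurable
  then show ?thesis unfolding code_def by measurable
qed

text \<open>At the first position where the digits differ, the codes differ by one unit of that
  position up to a tail of at most half a unit.\<close>

lemma code_close_imp_bits_eq:
  assumes close: "\<bar>code x - code y\<bar> < 1 / (2 * 3 ^ M)" and m: "m \<le> M"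
  shows "code_bit m x = code_bit m y"
proof (rule ccontr)
  assume "code_bit m x \<noteq> code_bit m y"
  define n where "n = (LEAST m. code_bit m x \<noteq> code_bit m y)"
  have n: "code_bit n x \<noteq> code_bit n y" unfolding n_def by (rule LeastI) fact
  have "n \<le> m" unfolding n_def by (rule Least_le) fact
  have less: "code_bit l x = code_bit l y" if "l < n" for l using not_less_Least[of l] that unfolding n_def by blast
  define d where "d l = (code_bit l x - code_bit l y) / 3 ^ l" for l
  have d: "\<bar>d l\<bar> \<le> 1 / 3 ^ l" for l
    using code_bit_01[of l x] code_bit_01[of l y] by (auto simp: d_def)
  have sd: "summable d" unfolding d_def diff_divide_distrib by (intro summable_diff code_summable)
  have "code x - code y = suminf d"
    unfolding code_def d_def diff_divide_distrib by (rule suminf_diff) (rule code_summable)+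
  also have "\<dots> = (\<Sum>l. d (l + Suc n)) + (\<Sum>l<Suc n. d l)"
    by (rule suminf_split_initial_segment[OF sd])
  also have "(\<Sum>l<Suc n. d l) = d n" using less by (simp add: d_def)
  finally have eq: "code x - code y = (\<Sum>l. d (l + Suc n)) + d n" .
  have sg: "summable (\<lambda>l. 1 / 3 ^ (l + Suc n) :: real)" by (rule summable_ignore_initial_segment[OF summable_thirds])
  have sn: "summable (\<lambda>l. norm (d (l + Suc n)))"
    by (rule summable_comparison_test'[OF sg, of 0], unfold real_norm_def abs_abs, rule d)
  have "\<bar>\<Sum>l. d (l + Suc n)\<bar> \<le> (\<Sum>l. norm (d (l + Suc n)))"
    using summable_norm[OF sn] by simp
  also have "\<dots> \<le> (\<Sum>l. 1 / 3 ^ (l + Suc n))" by (rule suminf_le[OF _ sn sg], unfold real_norm_def, rule d)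
  also have "\<dots> = (\<Sum>l. (1 / 3 ^ l) * (1 / 3 ^ Suc n))" by (simp add: power_add mult_ac)
  also have "\<dots> = 3 / 2 * (1 / 3 ^ Suc n)" by (subst suminf_mult2[OF summable_thirds, symmetric]) (simp only: suminf_thirds)
  finally have "\<bar>\<Sum>l. d (l + Suc n)\<bar> \<le> 1 / (2 * 3 ^ n)" by simp
  moreover have "\<bar>d n\<bar> = 1 / 3 ^ n" using n code_bit_01[of n x] code_bit_01[of n y] by (auto simp: d_def)
  ultimately have "1 / 3 ^ n - 1 / (2 * 3 ^ n) \<le> \<bar>code x - code y\<bar>" unfolding eq by linarith
  then have "1 / (2 * 3 ^ n) \<le> \<bar>code x - code y\<bar>" by (simp add: field_simps)
  moreover have "1 / (2 * 3 ^ M) \<le> (1 / (2 * 3 ^ n) :: real)"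
    using \<open>n \<le> m\<close> m by (intro divide_left_mono mult_left_mono power_increasing) auto
  ultimately show False using close by simp
qed

lemma abs_component_squash_less: "\<bar>squash x $ j\<bar> < 1" for x :: "real^'d::finite"
  using component_le_norm_cart[of "squash x" j] norm_squash_less[of x] by linarith

text \<open>Finitely many digits locate every coordinate of the squashed point on a grid of mesh 1 /
  N, and sufficiently close codes share these digits. N is chosen so that the coordinate errors add
  up to less than \<epsilon>.\<close>

lemma code_close_imp_squash_close:
  assumes "\<epsilon> > 0"
  shows "\<exists>\<delta>>0. \<forall>x y :: real^'d::finite. \<bar>code x - code y\<bar> < \<delta> \<longrightarrow> dist (squash x) (squash y) < \<epsilon>"
proof -
  obtain N :: nat where N: "real CARD('d) / \<epsilon> < real N" using reals_Archimedean2 by blast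
  have Np: "real N > 0" using N assms by (meson divide_nonneg_pos le_less_trans of_nat_0_le_iff)
  \<comment> \<open>Thresholds of the form floor + 1 of N times a coordinate in (-1, 1) stay in this
    range; M bounds their positions in the code.\<close>
  define T :: "('d \<times> rat) set" where "T = (\<lambda>(j, l). (j, of_int l / of_nat N)) ` (UNIV \<times> {- int N - 1 .. int N + 1})"
  define M where "M = Max (insert 0 (to_nat ` T))"
  have finT: "finite T" by (simp add: T_def)
  have one: "squash y $ j \<le> squash x $ j + 1 / real N"
    if bits: "\<And>m. m \<le> M \<Longrightarrow> code_bit m x = code_bit m y" for x y :: "real^'d" and j
  proof -
    define l where "l = \<lfloor>real N * squash x $ j\<rfloor> + 1"
    have l: "real N * squash x $ j < of_int l" "of_int l \<le> real N * squash x $ j + 1" unfolding l_def by linarith+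
    have "\<bar>real N * squash x $ j\<bar> \<le> real N"
      using abs_component_squash_less[of x j] Np by (simp add: abs_mult mult_left_le)
    then have "- int N - 1 \<le> l" "l \<le> int N + 1" using l by linarith+
    then have "(j, of_int l / of_nat N) \<in> T" unfolding T_def by (force intro!: image_eqI[where x="(j, l)"])
    then have le: "to_nat (j, of_int l / of_nat N :: rat) \<le> M"
      unfolding M_def using finT by (intro Max_ge) auto
    have fr: "from_nat (to_nat (j, of_int l / of_nat N :: rat)) = (j, of_int l / of_nat N :: rat)" by (rule from_nat_to_nat)
    have "code_bit (to_nat (j, of_int l / of_nat N :: rat)) x = 1"
      using l Np unfolding code_bit_def fr by (simp add: of_rat_divide field_simps)
    then have "code_bit (to_nat (j, of_int l / of_nat N :: rat)) y = 1" using bits[OF le] by simp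
    then have "squash y $ j < of_int l / real N"
      unfolding code_bit_def fr by (simp add: of_rat_divide split: if_splits)
    also have "\<dots> \<le> squash x $ j + 1 / real N" using l Np by (simp add: field_simps)
    finally show ?thesis by simp
  qed
  show ?thesis
  proof (intro exI[of _ "1 / (2 * 3 ^ M)"] conjI allI impI)
    fix x y :: "real^'d" assume close: "\<bar>code x - code y\<bar> < 1 / (2 * 3 ^ M)"
    have bits: "code_bit m x = code_bit m y" if "m \<le> M" for m using code_close_imp_bits_eq[OF close that] .
    have "\<bar>(squash x - squash y) $ j\<bar> \<le> 1 / real N" for j
      using one[OF bits, of j] one[of y x j] bits by (simp add: abs_le_iff)
    then have "(\<Sum>j\<in>UNIV. \<bar>(squash x - squash y) $ j\<bar>) \<le> (\<Sum>j\<in>(UNIV::'d set). 1 / real N)" by (intro sum_mono) auto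
    then have "norm (squash x - squash y) \<le> real CARD('d) / real N"
      using norm_le_l1_cart[of "squash x - squash y"] by simp
    also have "\<dots> < \<epsilon>" using N assms Np by (simp add: field_simps)
    finally show "dist (squash x) (squash y) < \<epsilon>" by (simp add: dist_norm)
  qed simp
qed

text \<open>Decoding is uniformly continuous on the range of the code, so it extends to the closure
  and, by Dugundji's theorem, to the line with values in the closed unit ball. Values of norm 1
  stand for points at infinity.\<close>

lemma exists_decoder:
  obtains \<psi> :: "real \<Rightarrow> real^'d::finite"
  where "continuous_on UNIV \<psi>" "\<And>t. norm (\<psi> t) \<le> 1" "\<And>x. \<psi> (code x) = squash x"
proof -
  \<comment> \<open>\<open>gc\<close> shows that the choice is immaterial: equal codes put the
    squashed points at distance less than every \<epsilon>.\<close>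
  define g where "g t = squash (SOME x :: real^'d. code x = t)" for t
  have inv: "code (SOME x :: real^'d. code x = code y) = code y" for y :: "real^'d" by (rule someI) simp
  have gc: "g (code y) = squash y" for y
  proof (rule ccontr)
    assume "g (code y) \<noteq> squash y"
    then have "dist (g (code y)) (squash y) > 0" by simp
    then obtain \<delta> where "\<delta> > 0"
      "\<And>x y' :: real^'d. \<bar>code x - code y'\<bar> < \<delta> \<Longrightarrow> dist (squash x) (squash y') < dist (g (code y)) (squash y)"
      using code_close_imp_squash_close by blast
    from this(2)[of "SOME x. code x = code y" y] this(1) show False
      using inv[of y] by (simp add: g_def)
  qed
  have "uniformly_continuous_on (range (code :: real^'d \<Rightarrow> real)) g"
    unfolding uniformly_continuous_on_def
  proof (intro allI impI)
    fix \<epsilon> :: real assume "\<epsilon> > 0"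
    then obtain \<delta> where "\<delta> > 0" "\<And>x y :: real^'d. \<bar>code x - code y\<bar> < \<delta> \<Longrightarrow> dist (squash x) (squash y) < \<epsilon>"
      using code_close_imp_squash_close by blast
    then show "\<exists>\<delta>>0. \<forall>s\<in>range (code :: real^'d \<Rightarrow> real). \<forall>t\<in>range (code :: real^'d \<Rightarrow> real). dist t s < \<delta> \<longrightarrow> dist (g t) (g s) < \<epsilon>"
      by (intro exI[of _ \<delta>]) (auto simp: gc dist_real_def)
  qed
  then obtain h where h: "uniformly_continuous_on (closure (range (code :: real^'d \<Rightarrow> real))) h"
    "\<And>t. t \<in> range (code :: real^'d \<Rightarrow> real) \<Longrightarrow> g t = h t"
    by (rule uniformly_continuous_on_extension_on_closure) blast
  have ch: "continuous_on (closure (range (code :: real^'d \<Rightarrow> real))) h"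
    using h(1) by (rule uniformly_continuous_imp_continuous)
  have "h ` closure (range (code :: real^'d \<Rightarrow> real)) \<subseteq> cball 0 1"
    by (rule image_closure_subset[OF ch]) (use h(2) gc norm_squash_less in \<open>force intro: less_imp_le\<close>)+
  then obtain \<psi> where \<psi>: "continuous_on UNIV \<psi>" "\<psi> ` UNIV \<subseteq> cball 0 1"
    "\<And>t. t \<in> closure (range (code :: real^'d \<Rightarrow> real)) \<Longrightarrow> \<psi> t = h t"
    using Dugundji[of "cball 0 (1::real)" UNIV "closure (range (code :: real^'d \<Rightarrow> real))" h] ch by auto
  show ?thesis
  proof (rule that[OF \<psi>(1)])
    show "norm (\<psi> t) \<le> 1" for t using \<psi>(2) by (auto simp: image_subset_iff)
    show "\<psi> (code x) = squash x" for x
      using \<psi>(3)[OF subsetD[OF closure_subset]] h(2)[of "code x"] gc[of x] by simp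
  qed
qed

section \<open>Couplings for vague convergence\<close>

text \<open>A Skorohod representation with values in the one-point compactification: on A the points
  converge, off A they escape to infinity. Both hold at every point of the space, so the pointwise
  limits of integrands need no null sets.\<close>

definition vague_coupling :: "(nat \<Rightarrow> (real^'d::finite) measure) \<Rightarrow> real measure \<Rightarrow> real set \<Rightarrow>
    (nat \<Rightarrow> real \<Rightarrow> real^'d) \<Rightarrow> (real \<Rightarrow> real^'d) \<Rightarrow> bool" where
  "vague_coupling \<mu> \<Omega> A Xs X \<longleftrightarrow> prob_space \<Omega> \<and> A \<in> sets \<Omega> \<and> X \<in> borel_measurable \<Omega> \<and>
    (\<forall>n. Xs n \<in> borel_measurable \<Omega> \<and> distr \<Omega> borel (Xs n) = \<mu> n) \<and>
    (\<forall>\<omega>\<in>A. (\<lambda>n. Xs n \<omega>) \<longlonglongrightarrow> X \<omega>) \<and>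
    (\<forall>\<omega>\<in>space \<Omega> - A. filterlim (\<lambda>n. norm (Xs n \<omega>)) at_top sequentially)"

text \<open>The law of X on A only: the mass of the points that escape is lost.\<close>

definition vague_limit :: "real measure \<Rightarrow> real set \<Rightarrow> (real \<Rightarrow> real^'d::finite) \<Rightarrow> (real^'d) measure" where
  "vague_limit \<Omega> A X = distr (density \<Omega> (indicator A)) borel X"

lemma unsquash_measurable:
  fixes f :: "'b \<Rightarrow> 'a::euclidean_space"
  assumes [measurable]: "f \<in> borel_measurable N"
  shows "(\<lambda>x. if norm (f x) < 1 then unsquash (f x) else v) \<in> borel_measurable N"
proof -
  have "(\<lambda>x. if norm (f x) < 1 then f x /\<^sub>R (1 - norm (f x)) else v) \<in> borel_measurable N" by measurable
  then show ?thesis unfolding unsquash_def .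
qed

text \<open>Skorohod's theorem couples the codes so that they converge everywhere. After decoding,
  points converge where the limit decodes into the open unit ball and escape where it decodes to the
  unit sphere.\<close>

lemma exists_vague_coupling:
  fixes \<mu> :: "nat \<Rightarrow> (real^'d::finite) measure"
  assumes \<mu>: "\<And>n. \<mu> n \<in> prob_measures" and M: "real_distribution M"
    and conv: "weak_conv_m (\<lambda>n. distr (\<mu> n) borel code) M"
  shows "\<exists>\<Omega> A Xs X. vague_coupling \<mu> \<Omega> A Xs X"
proof -
  have s[measurable_cong]: "sets (\<mu> n) = sets borel" and p: "prob_space (\<mu> n)" for n using \<mu>[of n] by (auto simp: prob_measures_def)
  have rd: "real_distribution (distr (\<mu> n) borel code)" for n
    by (intro real_distribution.intro real_distribution_axioms.intro prob_space.prob_space_distr[OF p]) (auto, measurable)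
  obtain \<Omega> :: "real measure" and Ys Y where sk: "prob_space \<Omega> \<and> (\<forall>n. Ys n \<in> borel_measurable \<Omega>) \<and>
    (\<forall>n. distr \<Omega> borel (Ys n) = distr (\<mu> n) borel code) \<and> Y \<in> measurable \<Omega> lborel \<and> distr \<Omega> borel Y = M \<and>
    (\<forall>\<omega>\<in>space \<Omega>. (\<lambda>n. Ys n \<omega>) \<longlonglongrightarrow> Y \<omega>)"
    using Skorohod[OF rd M conv] by blast
  then have \<Omega>: "prob_space \<Omega>" and Ys[measurable]: "\<And>n. Ys n \<in> borel_measurable \<Omega>"
    and Ysd: "\<And>n. distr \<Omega> borel (Ys n) = distr (\<mu> n) borel code"
    and Y: "Y \<in> measurable \<Omega> lborel" and Ylim: "\<And>\<omega>. \<omega> \<in> space \<Omega> \<Longrightarrow> (\<lambda>n. Ys n \<omega>) \<longlonglongrightarrow> Y \<omega>"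
    by auto
  have [measurable]: "Y \<in> borel_measurable \<Omega>" using Y by simp
  obtain \<psi> :: "real \<Rightarrow> real^'d" where \<psi>: "continuous_on UNIV \<psi>" "\<And>t. norm (\<psi> t) \<le> 1" "\<And>x. \<psi> (code x) = squash x"
    using exists_decoder by blast
  have [measurable]: "\<psi> \<in> borel_measurable borel" by (rule borel_measurable_continuous_onI[OF \<psi>(1)])
  define e :: "real^'d" where "e = axis (SOME i. True) 1"
  have e: "norm e = 1" by (simp add: e_def)
  \<comment> \<open>On a null set the coupled reals may decode to norm 1 without being codes. The
    value n e then tends to infinity, so escape holds at every point of the complement of A and not
    only almost everywhere.\<close>
  define dec where "dec n t = (if norm (\<psi> t) < 1 then unsquash (\<psi> t) else real n *\<^sub>R e)" for n t
  have [measurable]: "dec n \<in> borel_measurable borel" for n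
    unfolding dec_def by (rule unsquash_measurable) measurable
  have dec_code: "dec n (code x) = x" for n x by (simp add: dec_def \<psi>(3) norm_squash_less unsquash_squash)
  define Xs where "Xs n \<omega> = dec n (Ys n \<omega>)" for n \<omega>
  define X where "X \<omega> = dec 0 (Y \<omega>)" for \<omega>
  define A where "A = {\<omega> \<in> space \<Omega>. norm (\<psi> (Y \<omega>)) < 1}"
  have "distr \<Omega> borel (Xs n) = \<mu> n" for n
  proof -
    have "distr \<Omega> borel (Xs n) = distr (distr \<Omega> borel (Ys n)) borel (dec n)"
      by (subst distr_distr) (auto simp: Xs_def[abs_def] o_def)
    also have "\<dots> = distr (\<mu> n) borel (\<lambda>x. x)"
      unfolding Ysd by (subst distr_distr) (auto simp: o_def dec_code)
    also have "\<dots> = \<mu> n" by (rule distr_id2) (simp add: s)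
    finally show ?thesis .
  qed
  moreover have "(\<lambda>n. Xs n \<omega>) \<longlonglongrightarrow> X \<omega>" if "\<omega> \<in> A" for \<omega>
  proof -
    have \<omega>: "\<omega> \<in> space \<Omega>" "norm (\<psi> (Y \<omega>)) < 1" using that by (auto simp: A_def)
    have l: "(\<lambda>n. \<psi> (Ys n \<omega>)) \<longlonglongrightarrow> \<psi> (Y \<omega>)"
      by (rule continuous_on_tendsto_compose[OF \<psi>(1) Ylim[OF \<omega>(1)]]) auto
    have ev: "\<forall>\<^sub>F n in sequentially. norm (\<psi> (Ys n \<omega>)) < 1"
      by (rule order_tendstoD(2)[OF tendsto_norm[OF l] \<omega>(2)])
    have "(\<lambda>n. unsquash (\<psi> (Ys n \<omega>))) \<longlonglongrightarrow> unsquash (\<psi> (Y \<omega>))"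
      by (rule continuous_on_tendsto_compose[OF continuous_unsquash l]) (use \<omega> ev in auto)
    moreover have "\<forall>\<^sub>F n in sequentially. unsquash (\<psi> (Ys n \<omega>)) = Xs n \<omega>"
      using ev by eventually_elim (simp add: Xs_def dec_def)
    moreover have "X \<omega> = unsquash (\<psi> (Y \<omega>))" using \<omega> by (simp add: X_def dec_def)
    ultimately show ?thesis by (simp add: tendsto_cong)
  qed
  moreover have "filterlim (\<lambda>n. norm (Xs n \<omega>)) at_top sequentially" if "\<omega> \<in> space \<Omega> - A" for \<omega>
    unfolding filterlim_at_top_gt[where c=0]
  proof (intro allI impI)
    fix C :: real assume "C > 0"
    have \<omega>: "\<omega> \<in> space \<Omega>" "norm (\<psi> (Y \<omega>)) = 1" using that \<psi>(2)[of "Y \<omega>"] by (auto simp: A_def)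
    have "(\<lambda>n. norm (\<psi> (Ys n \<omega>))) \<longlonglongrightarrow> 1"
      using tendsto_norm[OF continuous_on_tendsto_compose[OF \<psi>(1) Ylim[OF \<omega>(1)]]] \<omega>(2) by simp
    \<comment> \<open>C / (1 + C) is the norm at which \<open>unsquash\<close> reaches norm
      C.\<close>
    then have "\<forall>\<^sub>F n in sequentially. norm (\<psi> (Ys n \<omega>)) > C / (1 + C)"
      by (rule order_tendstoD) (use \<open>C > 0\<close> in simp)
    moreover have "\<forall>\<^sub>F n in sequentially. real n \<ge> C"
      by (metis eventually_sequentiallyI nat_ceiling_le_eq)
    ultimately show "\<forall>\<^sub>F n in sequentially. C \<le> norm (Xs n \<omega>)"
    proof eventually_elim
      case (elim n)
      show ?case
      proof (cases "norm (\<psi> (Ys n \<omega>)) < 1")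
        case True
        have "C \<le> norm (\<psi> (Ys n \<omega>)) / (1 - norm (\<psi> (Ys n \<omega>)))"
          using elim(1) True \<open>C > 0\<close> by (simp add: field_simps)
        then show ?thesis using True by (simp add: Xs_def dec_def norm_unsquash)
      qed (use elim e in \<open>simp add: Xs_def dec_def\<close>)
    qed
  qed
  moreover have "A \<in> sets \<Omega>" unfolding A_def by measurable
  moreover have "Xs n \<in> borel_measurable \<Omega>" for n unfolding Xs_def by measurable
  moreover have "X \<in> borel_measurable \<Omega>" unfolding X_def by measurable
  ultimately show ?thesis using \<Omega> unfolding vague_coupling_def by blast
qed

text \<open>Codes lie in [0, 3/2], so the coded measures are tight even when the mass of \<mu> n
  escapes to infinity.\<close>

lemma code_helly:
  fixes \<mu> :: "nat \<Rightarrow> (real^'d::finite) measure"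
  assumes \<mu>: "\<And>n. \<mu> n \<in> prob_measures"
  shows "\<exists>r M. strict_mono (r :: nat \<Rightarrow> nat) \<and> real_distribution M \<and> weak_conv_m (\<lambda>n. distr (\<mu> (r n)) borel code) M"
proof -
  have s[measurable_cong]: "sets (\<mu> n) = sets borel" and p: "prob_space (\<mu> n)" for n using \<mu>[of n] by (auto simp: prob_measures_def)
  have sp: "space (\<mu> n) = UNIV" for n using sets_eq_imp_space_eq[OF s[of n]] by simp
  have rd: "real_distribution (distr (\<mu> n) borel code)" for n
    by (intro real_distribution.intro real_distribution_axioms.intro prob_space.prob_space_distr[OF p]) (auto, measurable)
  have one: "measure (distr (\<mu> n) borel code) {-1<..2} = 1" for n
  proof -
    have "- 1 < code x \<and> code x \<le> 2" for x :: "real^'d" using code_bounds[of x] by linarith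
    then have "code -` {-1<..2} = (UNIV :: (real^'d) set)" by (auto simp: vimage_def)
    then show ?thesis using prob_space.prob_space[OF p, of n] by (subst measure_distr) (auto simp: sp)
  qed
  have "tight (\<lambda>n. distr (\<mu> n) borel code)"
    unfolding tight_def
  proof (intro conjI allI impI)
    fix \<epsilon> :: real assume "\<epsilon> > 0"
    then show "\<exists>a b. a < b \<and> (\<forall>n. 1 - \<epsilon> < measure (distr (\<mu> n) borel code) {a<..b})"
      by (intro exI[of _ "-1"] exI[of _ 2]) (simp add: one)
  qed (rule rd)
  from tight_imp_convergent_subsubsequence[OF this strict_mono_id] show ?thesis by (simp add: o_def)
qed

lemma vague_limit_subprob:
  assumes "vague_coupling \<mu> \<Omega> A Xs X"
  shows "vague_limit \<Omega> A X \<in> subprob_measures"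
proof (rule subprob_measuresI)
  interpret prob_space \<Omega> using assms by (simp add: vague_coupling_def)
  have m: "A \<in> sets \<Omega>" "X \<in> borel_measurable \<Omega>" using assms by (auto simp: vague_coupling_def)
  show "finite_measure (vague_limit \<Omega> A X)" unfolding vague_limit_def
    by (rule finite_measure_distr_density) (use m in \<open>auto intro: finite_measure_axioms\<close>)
  show "measure (vague_limit \<Omega> A X) UNIV \<le> 1"
    unfolding vague_limit_def measure_def by (subst emeasure_distr_density) (use m in \<open>auto simp: measure_def[symmetric]\<close>)
qed (simp add: vague_limit_def)

definition vanishing_at_infinity :: "nat \<Rightarrow> ((nat \<Rightarrow> 'a::real_normed_vector) \<Rightarrow> real) \<Rightarrow> bool" where
  "vanishing_at_infinity k G \<longleftrightarrow> (\<forall>\<epsilon>>0. \<exists>R. \<forall>z\<in>PiE {..<k} (\<lambda>_. UNIV). (\<exists>l<k. norm (z l) \<ge> R) \<longrightarrow> \<bar>G z\<bar> < \<epsilon>)"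

lemma vague_limit_pair:
  fixes X Y :: "real \<Rightarrow> real^'d::finite"
  assumes "prob_space \<Omega>" "prob_space \<Omega>'" "A \<in> sets \<Omega>" "B \<in> sets \<Omega>'" "X \<in> borel_measurable \<Omega>" "Y \<in> borel_measurable \<Omega>'"
  shows "vague_limit \<Omega> A X \<Otimes>\<^sub>M vague_limit \<Omega>' B Y =
    distr (density (\<Omega> \<Otimes>\<^sub>M \<Omega>') (indicator (A \<times> B))) borel (\<lambda>(a, b). (X a, Y b))"
  unfolding vague_limit_def borel_prod[symmetric]
  by (rule pair_distr_density) (use assms in \<open>auto intro: prob_space.finite_measure\<close>)

text \<open>All integrals are transferred to one power of the product of the coupling spaces. If
  every pair lies in A \<times> B, the configuration converges and G is continuous; otherwise some
  pair escapes and G tends to 0, the value that the product of indicators assigns in the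
  limit.\<close>

lemma vague_coupling_integral_tendsto:
  fixes \<mu> \<nu> :: "nat \<Rightarrow> (real^'d::finite) measure"
  assumes \<mu>: "vague_coupling \<mu> \<Omega> A Xs X" and \<nu>: "vague_coupling \<nu> \<Omega>' B Ys Y"
    and G: "continuous_map (product_topology (\<lambda>_. euclidean) {..<k}) euclidean G"
    and bd: "\<And>z. z \<in> configs k \<Longrightarrow> \<bar>G z\<bar> \<le> C" and van: "vanishing_at_infinity k G"
  shows "(\<lambda>n. power_integral k G (\<mu> n \<Otimes>\<^sub>M \<nu> n)) \<longlonglongrightarrow> power_integral k G (vague_limit \<Omega> A X \<Otimes>\<^sub>M vague_limit \<Omega>' B Y)"
proof -
  have p: "prob_space \<Omega>" "prob_space \<Omega>'" and AB[measurable]: "A \<in> sets \<Omega>" "B \<in> sets \<Omega>'"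
    and [measurable]: "X \<in> borel_measurable \<Omega>" "Y \<in> borel_measurable \<Omega>'"
    and XYs[measurable]: "\<And>n. Xs n \<in> borel_measurable \<Omega>" "\<And>n. Ys n \<in> borel_measurable \<Omega>'"
    and d: "\<And>n. distr \<Omega> borel (Xs n) = \<mu> n" "\<And>n. distr \<Omega>' borel (Ys n) = \<nu> n"
    and limX: "\<And>\<omega>. \<omega> \<in> A \<Longrightarrow> (\<lambda>n. Xs n \<omega>) \<longlonglongrightarrow> X \<omega>" and limY: "\<And>\<omega>. \<omega> \<in> B \<Longrightarrow> (\<lambda>n. Ys n \<omega>) \<longlonglongrightarrow> Y \<omega>"
    and infX: "\<And>\<omega>. \<omega> \<in> space \<Omega> - A \<Longrightarrow> filterlim (\<lambda>n. norm (Xs n \<omega>)) at_top sequentially"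
    and infY: "\<And>\<omega>. \<omega> \<in> space \<Omega>' - B \<Longrightarrow> filterlim (\<lambda>n. norm (Ys n \<omega>)) at_top sequentially"
    using \<mu> \<nu> by (auto simp: vague_coupling_def)
  let ?\<Omega> = "\<Omega> \<Otimes>\<^sub>M \<Omega>'"
  interpret pp: pair_prob_space \<Omega> \<Omega>' using p by (simp add: pair_prob_space_def pair_sigma_finite_def prob_space_imp_sigma_finite)
  have fin: "finite_measure ?\<Omega>" by (rule pp.P.finite_measure_axioms)
  interpret PP: finite_measure "PiM {..<k} (\<lambda>_. ?\<Omega>)" by (rule finite_measure_PiM_const[OF fin])
  have Gm: "G \<in> borel_measurable (PiM {..<k} (\<lambda>_. borel))" by (rule continuous_map_imp_borel_measurable_PiM[OF G])
  define Z where "Z n = (\<lambda>(a, b). (Xs n a, Ys n b))" for n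
  define Z' where "Z' = (\<lambda>(a, b). (X a, Y b))"
  have [measurable]: "Z n \<in> borel_measurable ?\<Omega>" for n unfolding Z_def borel_prod[symmetric] by measurable
  have [measurable]: "Z' \<in> borel_measurable ?\<Omega>" unfolding Z'_def borel_prod[symmetric] by measurable
  have eqn: "power_integral k G (\<mu> n \<Otimes>\<^sub>M \<nu> n) = (\<integral>w. G (\<lambda>l\<in>{..<k}. Z n (w l)) \<partial>PiM {..<k} (\<lambda>_. ?\<Omega>))" for n
  proof -
    have "\<mu> n \<Otimes>\<^sub>M \<nu> n = distr (density ?\<Omega> (indicator (space \<Omega> \<times> space \<Omega>'))) borel (Z n)"
      using vague_limit_pair[OF p sets.top sets.top XYs(1)[of n] XYs(2)[of n]]
      by (simp add: vague_limit_def density_indicator_space d Z_def)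
    then have "\<mu> n \<Otimes>\<^sub>M \<nu> n = distr (density ?\<Omega> (indicator (space ?\<Omega>))) borel (Z n)"
      by (simp add: space_pair_measure)
    then show ?thesis
      unfolding power_integral_def
      by (simp only:) (subst integral_PiM_distr_density[OF fin], auto simp: Gm intro!: Bochner_Integration.integral_cong simp: space_PiM prod_indicator_eq PiE_iff)
  qed
  have eql: "power_integral k G (vague_limit \<Omega> A X \<Otimes>\<^sub>M vague_limit \<Omega>' B Y) =
      (\<integral>w. (\<Prod>l<k. indicator (A \<times> B) (w l)) * G (\<lambda>l\<in>{..<k}. Z' (w l)) \<partial>PiM {..<k} (\<lambda>_. ?\<Omega>))"
    unfolding power_integral_def vague_limit_pair[OF p AB \<open>X \<in> _\<close> \<open>Y \<in> _\<close>] Z'_def[symmetric]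
    by (rule integral_PiM_distr_density[OF fin _ _ _ Gm]) auto
  have cfg: "(\<lambda>l\<in>{..<k}. z l) \<in> configs k" for z :: "'d config" by (simp add: configs_def)
  have m: "(\<lambda>w. \<lambda>l\<in>{..<k}. W (w l)) \<in> measurable (PiM {..<k} (\<lambda>_. ?\<Omega>)) (PiM {..<k} (\<lambda>_. borel))"
    if [measurable]: "W \<in> borel_measurable ?\<Omega>" for W :: "_ \<Rightarrow> 'd pt"
    by (rule measurable_restrict) measurable
  show ?thesis
    unfolding eqn eql
  proof (rule integral_dominated_convergence[where w="\<lambda>_. C"])
    show "(\<lambda>w. (\<Prod>l<k. indicator (A \<times> B) (w l)) * G (\<lambda>l\<in>{..<k}. Z' (w l))) \<in> borel_measurable (PiM {..<k} (\<lambda>_. ?\<Omega>))"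
      using measurable_compose[OF m Gm, of Z'] by measurable
    show "(\<lambda>w. G (\<lambda>l\<in>{..<k}. Z n (w l))) \<in> borel_measurable (PiM {..<k} (\<lambda>_. ?\<Omega>))" for n
      using measurable_compose[OF m Gm, of "Z n"] by simp
    show "AE w in PiM {..<k} (\<lambda>_. ?\<Omega>). (\<lambda>n. G (\<lambda>l\<in>{..<k}. Z n (w l))) \<longlonglongrightarrow> (\<Prod>l<k. indicator (A \<times> B) (w l)) * G (\<lambda>l\<in>{..<k}. Z' (w l))"
    proof (rule AE_I2)
      fix w assume w: "w \<in> space (PiM {..<k} (\<lambda>_. ?\<Omega>))"
      show "(\<lambda>n. G (\<lambda>l\<in>{..<k}. Z n (w l))) \<longlonglongrightarrow> (\<Prod>l<k. indicator (A \<times> B) (w l)) * G (\<lambda>l\<in>{..<k}. Z' (w l))"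
      proof (cases "\<forall>l<k. w l \<in> A \<times> B")
        case True
        have "(\<lambda>n. Z n (w l)) \<longlonglongrightarrow> Z' (w l)" if "l < k" for l
          using True that limX limY unfolding Z_def Z'_def case_prod_unfold by (intro tendsto_Pair) (auto simp: mem_Times_iff)
        then have "limitin (product_topology (\<lambda>_. euclidean) {..<k}) (\<lambda>n. \<lambda>l\<in>{..<k}. Z n (w l)) (\<lambda>l\<in>{..<k}. Z' (w l)) sequentially"
          by (auto simp: limitin_componentwise)
        then have "limitin euclidean (G \<circ> (\<lambda>n. \<lambda>l\<in>{..<k}. Z n (w l))) (G (\<lambda>l\<in>{..<k}. Z' (w l))) sequentially"
          by (rule continuous_map_limit[OF G])
        then show ?thesis using True by (simp add: o_def)
      next
        case False
        then obtain l where l: "l < k" "w l \<notin> A \<times> B" by blast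
        have wl: "w l \<in> space ?\<Omega>" using w l by (auto simp: space_PiM)
        have inf: "filterlim (\<lambda>n. norm (Z n (w l))) at_top sequentially"
        proof (cases "fst (w l) \<in> A")
          case True
          then have "filterlim (\<lambda>n. norm (Ys n (snd (w l)))) at_top sequentially"
            using l wl by (intro infY) (auto simp: mem_Times_iff space_pair_measure)
          then show ?thesis
            by (rule filterlim_at_top_mono) (simp add: Z_def case_prod_unfold norm_snd_le)
        next
          case False
          then have "filterlim (\<lambda>n. norm (Xs n (fst (w l)))) at_top sequentially"
            using l wl by (intro infX) (auto simp: mem_Times_iff space_pair_measure)
          then show ?thesis
            by (rule filterlim_at_top_mono) (simp add: Z_def case_prod_unfold norm_fst_le)
        qed
        have "(\<lambda>n. G (\<lambda>l\<in>{..<k}. Z n (w l))) \<longlonglongrightarrow> 0"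
        proof (rule tendstoI)
          fix \<epsilon> :: real assume "\<epsilon> > 0"
          then obtain R where R: "\<And>z. z \<in> PiE {..<k} (\<lambda>_. UNIV) \<Longrightarrow> (\<exists>l<k. norm (z l) \<ge> R) \<Longrightarrow> \<bar>G z\<bar> < \<epsilon>"
            using van unfolding vanishing_at_infinity_def by meson
          have "\<forall>\<^sub>F n in sequentially. R \<le> norm (Z n (w l))" using inf by (auto simp: filterlim_at_top)
          then show "\<forall>\<^sub>F n in sequentially. dist (G (\<lambda>l\<in>{..<k}. Z n (w l))) 0 < \<epsilon>"
          proof eventually_elim
            case (elim n)
            then have "\<bar>G (\<lambda>l\<in>{..<k}. Z n (w l))\<bar> < \<epsilon>" using l(1) by (intro R) auto
            then show ?case by simp
          qed
        qed
        moreover have "indicator (A \<times> B) (w l) = (0 :: real)" using l(2) by (metis indicator_simps(2))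
        then have "(\<Prod>l<k. indicator (A \<times> B) (w l)) = (0 :: real)"
          by (intro prod_zero finite_lessThan bexI[of _ l]) (simp_all only: l(1) lessThan_iff)
        ultimately show ?thesis by (simp only: mult_zero_left)
      qed
    qed
    show "AE w in PiM {..<k} (\<lambda>_. ?\<Omega>). norm (G (\<lambda>l\<in>{..<k}. Z n (w l))) \<le> C" for n
      using bd cfg by (intro AE_I2) simp
  qed simp
qed

text \<open>The analogue for a single marginal, needed for the masses of windows.\<close>

lemma vague_coupling_integral_tendsto_1:
  fixes \<mu> :: "nat \<Rightarrow> (real^'d::finite) measure"
  assumes \<mu>: "vague_coupling \<mu> \<Omega> A Xs X" and g: "g \<in> compactly_supported"
  shows "(\<lambda>n. \<integral>x. g x \<partial>\<mu> n) \<longlonglongrightarrow> (\<integral>x. g x \<partial>vague_limit \<Omega> A X)"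
proof -
  have p: "prob_space \<Omega>" and [measurable]: "A \<in> sets \<Omega>" "X \<in> borel_measurable \<Omega>" "\<And>n. Xs n \<in> borel_measurable \<Omega>"
    and d: "\<And>n. \<mu> n = distr \<Omega> borel (Xs n)"
    and limX: "\<And>\<omega>. \<omega> \<in> A \<Longrightarrow> (\<lambda>n. Xs n \<omega>) \<longlonglongrightarrow> X \<omega>"
    and infX: "\<And>\<omega>. \<omega> \<in> space \<Omega> - A \<Longrightarrow> filterlim (\<lambda>n. norm (Xs n \<omega>)) at_top sequentially"
    using \<mu> by (auto simp: vague_coupling_def)
  interpret prob_space \<Omega> by fact
  have [measurable]: "g \<in> borel_measurable borel" by (rule compactly_supported_measurable[OF g])
  have cg: "continuous_on UNIV g" using g by (simp add: compactly_supported_def)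
  obtain R where R: "\<And>z. norm z \<ge> R \<Longrightarrow> g z = 0" using g by (auto simp: compactly_supported_def)
  obtain C where C: "\<And>z. \<bar>g z\<bar> \<le> C" using compactly_supported_bounded[OF g] by blast
  have "(\<integral>x. g x \<partial>vague_limit \<Omega> A X) = (\<integral>\<omega>. g (X \<omega>) \<partial>density \<Omega> (\<lambda>\<omega>. ennreal (indicator A \<omega>)))"
    unfolding vague_limit_def ennreal_indicator by (subst integral_distr) auto
  also have "\<dots> = (\<integral>\<omega>. indicator A \<omega> * g (X \<omega>) \<partial>\<Omega>)"
    by (subst integral_density) auto
  finally have eq: "(\<integral>x. g x \<partial>vague_limit \<Omega> A X) = (\<integral>\<omega>. indicator A \<omega> * g (X \<omega>) \<partial>\<Omega>)" .
  have eqn: "(\<integral>x. g x \<partial>\<mu> n) = (\<integral>\<omega>. g (Xs n \<omega>) \<partial>\<Omega>)" for n unfolding d by (subst integral_distr) auto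
  show ?thesis
    unfolding eq eqn
  proof (rule integral_dominated_convergence[where w="\<lambda>_. C"])
    show "AE \<omega> in \<Omega>. (\<lambda>n. g (Xs n \<omega>)) \<longlonglongrightarrow> indicator A \<omega> * g (X \<omega>)"
    proof (rule AE_I2)
      fix \<omega> assume \<omega>: "\<omega> \<in> space \<Omega>"
      show "(\<lambda>n. g (Xs n \<omega>)) \<longlonglongrightarrow> indicator A \<omega> * g (X \<omega>)"
      proof (cases "\<omega> \<in> A")
        case True
        then show ?thesis using continuous_on_tendsto_compose[OF cg limX[OF True]] by simp
      next
        case False
        then have "\<forall>\<^sub>F n in sequentially. R \<le> norm (Xs n \<omega>)" using infX \<omega> by (auto simp: filterlim_at_top)
        then have "\<forall>\<^sub>F n in sequentially. g (Xs n \<omega>) = 0" by eventually_elim (rule R)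
        then show ?thesis using False by (simp add: tendsto_eventually)
      qed
    qed
  qed (use C in auto)
qed

section \<open>Lattice windows\<close>

definition tent1 :: "real \<Rightarrow> real" where
  "tent1 t = max 0 (1 - \<bar>t\<bar>)"

text \<open>A product of hat functions, whose integer translates form a continuous partition of
  unity.\<close>

definition tent :: "real^'d::finite \<Rightarrow> real" where
  "tent x = (\<Prod>j\<in>UNIV. tent1 (x $ j))"

definition lattice_point :: "int^'d::finite \<Rightarrow> real^'d" where
  "lattice_point q = (\<chi> j. real_of_int (q $ j))"

lemma lattice_point_add: "lattice_point (p + q) = lattice_point p + lattice_point q"
  by (simp add: lattice_point_def vec_eq_iff)

lemma tent1_bounds: "0 \<le> tent1 t" "tent1 t \<le> 1"
  by (auto simp: tent1_def)

lemma tent_bounds: "0 \<le> tent x" "tent x \<le> 1"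
  unfolding tent_def using tent1_bounds by (auto intro: prod_nonneg prod_le_1)

lemma continuous_tent: "continuous_on UNIV tent"
  unfolding tent_def tent1_def
  by (intro continuous_on_prod continuous_intros bounded_linear.continuous_on[OF bounded_linear_vec_nth])

lemma tent_nonzero_imp_component:
  assumes "tent x \<noteq> 0"
  shows "\<bar>x $ j\<bar> < 1"
proof -
  have "tent1 (x $ j) \<noteq> 0" using assms by (auto simp: tent_def)
  then show ?thesis by (auto simp: tent1_def max_def split: if_splits)
qed

lemma tent_nonzero_imp_norm:
  fixes x :: "real^'d::finite"
  assumes "tent x \<noteq> 0"
  shows "norm x \<le> real CARD('d)"
proof -
  have "norm x \<le> (\<Sum>j\<in>UNIV. \<bar>x $ j\<bar>)" by (rule norm_le_l1_cart)
  also have "\<dots> \<le> (\<Sum>j\<in>(UNIV::'d set). 1)"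
    by (intro sum_mono less_imp_le tent_nonzero_imp_component assms)
  finally show ?thesis by simp
qed

lemma tent_compactly_supported: "(\<lambda>x :: real^'d::finite. tent (x - a)) \<in> compactly_supported"
proof -
  have "continuous_on UNIV (\<lambda>x :: real^'d. tent (x - a))"
    by (rule continuous_on_compose2[OF continuous_tent]) (auto intro: continuous_intros)
  moreover have "tent (x - a) = 0" if "norm x \<ge> norm a + real CARD('d) + 1" for x :: "real^'d"
    using tent_nonzero_imp_norm[of "x - a"] norm_triangle_ineq2[of x a] that by (cases "tent (x - a) = 0") linarith+
  ultimately show ?thesis by (auto simp: compactly_supported_def)
qed

lemma sum_tent1: "(\<Sum>m\<in>{\<lfloor>t\<rfloor>, \<lfloor>t\<rfloor> + 1}. tent1 (t - of_int m)) = 1"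
proof -
  have "0 \<le> t - of_int \<lfloor>t\<rfloor>" "t - of_int \<lfloor>t\<rfloor> < 1" by linarith+
  then show ?thesis by (simp add: tent1_def)
qed

text \<open>In each coordinate only the floor of x and its successor contribute, and these two terms
  sum to 1; multiplying out the product over coordinates gives the sum over lattice points.\<close>

lemma has_sum_tent: "((\<lambda>q. tent (x - lattice_point q)) has_sum 1) UNIV" for x :: "real^'d::finite"
proof (rule has_sum_finite_neutralI)
  define K where "K j = {\<lfloor>x $ j\<rfloor>, \<lfloor>x $ j\<rfloor> + 1}" for j
  let ?B = "vec_lambda ` (PiE UNIV K)"
  show "finite ?B" by (intro finite_imageI finite_PiE) (auto simp: K_def)
  show "tent (x - lattice_point q) = 0" if "q \<in> UNIV - ?B" for q
  proof (rule ccontr)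
    assume nz: "tent (x - lattice_point q) \<noteq> 0"
    have "q $ j \<in> K j" for j
    proof -
      have "\<bar>x $ j - of_int (q $ j)\<bar> < 1" using tent_nonzero_imp_component[OF nz, of j] by (simp add: lattice_point_def)
      then show ?thesis unfolding K_def by (simp, linarith)
    qed
    then have "q \<in> ?B" by (intro image_eqI[where x="vec_nth q"]) (auto simp: vec_nth_inverse)
    then show False using that by simp
  qed
  have inj: "inj_on vec_lambda (PiE UNIV K)" by (rule inj_onI) (metis vec_lambda_inverse UNIV_I)
  have "1 = (\<Prod>j\<in>UNIV. \<Sum>m\<in>K j. tent1 (x $ j - of_int m))"
    unfolding K_def by (simp only: sum_tent1 prod.neutral_const)
  also have "\<dots> = (\<Sum>g\<in>PiE UNIV K. \<Prod>j\<in>UNIV. tent1 (x $ j - of_int (g j)))"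
    by (rule prod_sum_PiE) (auto simp: K_def)
  also have "\<dots> = (\<Sum>q\<in>?B. tent (x - lattice_point q))"
    by (subst sum.reindex[OF inj]) (simp add: tent_def lattice_point_def o_def)
  finally show "1 = (\<Sum>q\<in>?B. tent (x - lattice_point q))" .
qed simp

lemma sum_tent_le_1: "finite F \<Longrightarrow> (\<Sum>q\<in>F. tent (x - lattice_point q)) \<le> 1"
  using finite_sum_le_has_sum[OF has_sum_tent[of x], of F] tent_bounds by auto

lemma exists_window:
  shows "\<exists>V :: (int^'d::finite) set. finite V \<and> (\<forall>y. norm y \<le> r \<longrightarrow> 1 \<le> (\<Sum>v\<in>V. tent (y - lattice_point v)))"
proof -
  \<comment> \<open>A tent at v is nonzero at y only if the coordinates of v and y differ by less
    than 1, so all other members of the partition of unity vanish on the ball.\<close>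
  define V :: "(int^'d) set" where "V = vec_lambda ` (PiE UNIV (\<lambda>_. {- \<lceil>r\<rceil> - 1 .. \<lceil>r\<rceil> + 1}))"
  have fin: "finite V" unfolding V_def by (intro finite_imageI finite_PiE) auto
  have "(\<Sum>v\<in>V. tent (y - lattice_point v)) = 1" if y: "norm y \<le> r" for y
  proof -
    have "tent (y - lattice_point v) = 0" if "v \<notin> V" for v
    proof (rule ccontr)
      assume nz: "tent (y - lattice_point v) \<noteq> 0"
      have "v $ j \<in> {- \<lceil>r\<rceil> - 1 .. \<lceil>r\<rceil> + 1}" for j
      proof -
        have "\<bar>y $ j - of_int (v $ j)\<bar> < 1" using tent_nonzero_imp_component[OF nz, of j] by (simp add: lattice_point_def)
        moreover have "\<bar>y $ j\<bar> \<le> r" using component_le_norm_cart[of y j] y by linarith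
        ultimately show ?thesis by (simp, linarith)
      qed
      then have "v \<in> V" unfolding V_def by (intro image_eqI[where x="vec_nth v"]) (auto simp: vec_nth_inverse)
      then show False using that by simp
    qed
    then have "((\<lambda>q. tent (y - lattice_point q)) has_sum (\<Sum>v\<in>V. tent (y - lattice_point v))) UNIV"
      by (intro has_sum_finite_neutralI[OF fin]) auto
    then show ?thesis using has_sum_tent[of y] has_sum_unique by blast
  qed
  then show ?thesis using fin by (intro exI[of _ V]) auto
qed

lemma infinite_UNIV_lattice: "infinite (UNIV :: (int^'d::finite) set)"
proof -
  have "inj (\<lambda>n::int. (\<chi> j. n) :: int^'d)" by (auto simp: inj_def vec_eq_iff)
  then show ?thesis using infinite_UNIV_int finite_imageD[of "\<lambda>n::int. (\<chi> j. n) :: int^'d" UNIV] by (meson finite_subset subset_UNIV)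
qed

section \<open>Enumerations and sums\<close>

text \<open>Ranking by decreasing weight: a summable positive weight is at most of the order of the inverse rank.\<close>

lemma exists_decreasing_enumeration:
  fixes w :: "'a::countable \<Rightarrow> real"
  assumes inf: "infinite (UNIV :: 'a set)" and pos: "\<And>q. w q > 0" and sum: "\<And>Q. finite Q \<Longrightarrow> sum w Q \<le> C"
  shows "\<exists>e :: nat \<Rightarrow> 'a. bij e \<and> (\<forall>i. w (e i) \<le> C / real (Suc i))"
proof -
  \<comment> \<open>The elements ranked before q, with ties broken by the countable encoding;
    finitely many, because the weights are positive with bounded sums.\<close>
  define P where "P q = {q'. w q' > w q \<or> (w q' = w q \<and> to_nat q' < to_nat q)}" for q
  have card_le: "real (card Q) * c \<le> C" if "finite Q" "\<And>q. q \<in> Q \<Longrightarrow> w q \<ge> c" for Q c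
    using sum_mono[of Q "\<lambda>_. c" w] that sum[of Q] by simp
  have finge: "finite {q. w q \<ge> c}" if c: "c > 0" for c
  proof (rule ccontr)
    assume inf: "infinite {q. w q \<ge> c}"
    obtain n :: nat where n: "real n * c > C" using c reals_Archimedean3 by blast
    obtain Q where "finite Q" "card Q = n" "Q \<subseteq> {q. w q \<ge> c}" using infinite_arbitrarily_large[OF inf] by blast
    then show False using card_le[of Q c] n by auto
  qed
  have finP: "finite (P q)" for q
    by (rule finite_subset[OF _ finge[OF pos[of q]]]) (auto simp: P_def)
  define r where "r q = card (P q)" for q
  have mono: "r q' < r q" if "q' \<in> P q" for q q'
  proof -
    have "P q' \<subset> P q" using that by (auto simp: P_def)
    then show ?thesis unfolding r_def by (rule psubset_card_mono[OF finP])
  qed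
  have tri: "q' \<in> P q \<or> q \<in> P q'" if "q \<noteq> q'" for q q'
  proof -
    have "to_nat q \<noteq> to_nat q'" using that by (simp add: inj_eq[OF inj_to_nat])
    then show ?thesis unfolding P_def by (simp, linarith)
  qed
  have inj: "inj r"
  proof (rule injI, rule ccontr)
    fix q q' assume "r q = r q'" "q \<noteq> q'"
    then show False using tri[of q q'] mono[of q' q] mono[of q q'] by auto
  qed
  have bound: "w q \<le> C / real (Suc (r q))" for q
  proof -
    have "q \<notin> P q" by (simp add: P_def)
    then have "card (insert q (P q)) = Suc (r q)" using finP by (simp add: r_def)
    moreover have "real (card (insert q (P q))) * w q \<le> C"
      by (rule card_le) (use finP in \<open>auto simp: P_def\<close>)
    ultimately have "real (Suc (r q)) * w q \<le> C" by simp
    then show ?thesis by (simp add: field_simps)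
  qed
  have infr: "infinite (range r)" using inf inj finite_imageD by blast
  \<comment> \<open>The rank r is injective; enumerating its range gives a bijection without
    identifying that range. The i-th element of the range is at least i, which is the direction the
    bound requires.\<close>
  define e where "e i = inv r (enumerate (range r) i)" for i
  have re: "r (e i) = enumerate (range r) i" for i
    unfolding e_def by (rule f_inv_into_f) (rule enumerate_in_set[OF infr])
  have "bij e"
    unfolding e_def[abs_def]
    using bij_betw_trans[OF bij_enumerate[OF infr] bij_betw_inv_into[OF inj_on_imp_bij_betw[OF inj]]]
    by (simp add: o_def)
  moreover have "w (e i) \<le> C / real (Suc i)" for i
  proof -
    have "i \<le> r (e i)" unfolding re by (rule le_enumerate[OF infr])
    moreover have "C \<ge> 0" using sum[of "{}"] by simp
    ultimately have "C / real (Suc (r (e i))) \<le> C / real (Suc i)" by (intro divide_left_mono) auto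
    then show ?thesis using bound[of "e i"] by simp
  qed
  ultimately show ?thesis by blast
qed

lemma sum_halves_le_1:
  fixes Q :: "'a::countable set"
  assumes "finite Q"
  shows "(\<Sum>v\<in>Q. 1 / 2 ^ Suc (to_nat v) :: real) \<le> 1"
proof -
  have s: "(\<lambda>n. 1 / 2 ^ Suc n :: real) sums 1" using power_half_series by (simp add: power_one_over)
  have "(\<Sum>v\<in>Q. 1 / 2 ^ Suc (to_nat v)) = (\<Sum>n\<in>to_nat ` Q. 1 / 2 ^ Suc n :: real)"
    by (subst sum.reindex) (auto simp: inj_on_def)
  also have "\<dots> \<le> (\<Sum>n. 1 / 2 ^ Suc n)"
    by (rule sum_le_suminf) (use s assms in \<open>auto simp: sums_iff\<close>)
  finally show ?thesis using s by (simp add: sums_iff)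
qed

text \<open>Ranks by a smoothed weight: T averaged over all shifts v with weights
  \<open>1 / 2 ^ Suc (to_nat v)\<close>, plus a summable term that makes it positive. One summand of
  the average controls T at the shift v, so the constant depends on v but not on T. Applied to the
  masses for each n, it gives bounds uniform in n.\<close>

lemma exists_lattice_enumeration:
  fixes T :: "'a::{countable, ab_group_add} \<Rightarrow> real"
  assumes inf: "infinite (UNIV :: 'a set)" and nonneg: "\<And>q. T q \<ge> 0" and sum: "\<And>Q. finite Q \<Longrightarrow> sum T Q \<le> 2"
  shows "\<exists>e :: nat \<Rightarrow> 'a. bij e \<and> (\<forall>i v. T (e i + v) \<le> 3 * 2 ^ Suc (to_nat v) / real (Suc i))"
proof -
  define \<epsilon> where "\<epsilon> v = (1 / 2 ^ Suc (to_nat v) :: real)" for v :: 'a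
  have \<epsilon>: "\<epsilon> v > 0" for v by (simp add: \<epsilon>_def)
  have \<epsilon>sum: "sum \<epsilon> Q \<le> 1" if "finite Q" for Q using sum_halves_le_1[OF that] by (simp add: \<epsilon>_def)
  have \<epsilon>s: "\<epsilon> summable_on UNIV"
    by (rule nonneg_bdd_above_summable_on, simp add: \<epsilon>_def) (auto intro!: bdd_aboveI[of _ 1] \<epsilon>sum)
  have e0: "0 \<le> \<epsilon> v * T x" for v x using \<epsilon>[of v] nonneg[of x] by simp
  have T2: "T q \<le> 2" for q using sum[of "{q}"] by simp
  have s: "(\<lambda>v. \<epsilon> v * T (q + v)) summable_on UNIV" for q
    by (rule summable_on_comparison_test[OF summable_on_cmult_left[OF \<epsilon>s, of 2]])
      (rule mult_left_mono[OF T2 less_imp_le[OF \<epsilon>]], rule e0)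
  define w where "w q = \<epsilon> q + (\<Sum>\<^sub>\<infinity>v. \<epsilon> v * T (q + v))" for q
  have inn: "0 \<le> (\<Sum>\<^sub>\<infinity>v. \<epsilon> v * T (q + v))" for q
    by (rule infsum_nonneg) (rule e0)
  have wpos: "w q > 0" for q unfolding w_def using \<epsilon>[of q] inn[of q] by linarith
  \<comment> \<open>1 from the positive terms and 2 from the average: each shift maps Q injectively,
    so the inner sum of T is at most 2.\<close>
  have wsum: "sum w Q \<le> 3" if Q: "finite Q" for Q
  proof -
    have h: "((\<lambda>v. \<Sum>q\<in>Q. \<epsilon> v * T (q + v)) has_sum (\<Sum>q\<in>Q. \<Sum>\<^sub>\<infinity>v. \<epsilon> v * T (q + v))) UNIV"
      using Q
    proof (induction Q rule: finite_induct)
      case (insert q Q)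
      then show ?case unfolding sum.insert[OF insert.hyps] by (intro has_sum_add has_sum_infsum s)
    qed simp
    have "(\<Sum>q\<in>Q. \<Sum>\<^sub>\<infinity>v. \<epsilon> v * T (q + v)) = (\<Sum>\<^sub>\<infinity>v. \<Sum>q\<in>Q. \<epsilon> v * T (q + v))"
      using infsumI[OF h] by simp
    also have "\<dots> \<le> (\<Sum>\<^sub>\<infinity>v. \<epsilon> v * 2)"
    proof (rule infsum_mono[OF has_sum_imp_summable[OF h] summable_on_cmult_left[OF \<epsilon>s]])
      fix v
      have "(\<Sum>q\<in>Q. T (q + v)) = sum T ((\<lambda>q. q + v) ` Q)" by (subst sum.reindex) auto
      also have "\<dots> \<le> 2" using Q by (intro sum) simp
      finally show "(\<Sum>q\<in>Q. \<epsilon> v * T (q + v)) \<le> \<epsilon> v * 2"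
        unfolding sum_distrib_left[symmetric] using \<epsilon>[of v] by (intro mult_left_mono) auto
    qed
    also have "\<dots> = (\<Sum>\<^sub>\<infinity>v. \<epsilon> v) * 2" by (rule infsum_cmult_left')
    also have "(\<Sum>\<^sub>\<infinity>v. \<epsilon> v) \<le> 1" by (rule infsum_le_finite_sums[OF \<epsilon>s]) (rule \<epsilon>sum)
    finally have "(\<Sum>q\<in>Q. \<Sum>\<^sub>\<infinity>v. \<epsilon> v * T (q + v)) \<le> 2" by simp
    then show ?thesis using \<epsilon>sum[OF Q] by (simp add: w_def sum.distrib)
  qed
  obtain e :: "nat \<Rightarrow> 'a" where e: "bij e" "\<And>i. w (e i) \<le> 3 / real (Suc i)"
    using exists_decreasing_enumeration[OF inf wpos wsum] by blast
  have "T (e i + v) \<le> 3 * 2 ^ Suc (to_nat v) / real (Suc i)" for i v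
  proof -
    have "(\<Sum>v\<in>{v}. \<epsilon> v * T (e i + v)) \<le> (\<Sum>\<^sub>\<infinity>v. \<epsilon> v * T (e i + v))"
      by (rule finite_sum_le_infsum[OF s]) (use e0 in auto)
    then have "\<epsilon> v * T (e i + v) \<le> w (e i)" using \<epsilon>[of "e i"] by (simp add: w_def)
    also have "\<dots> \<le> 3 / real (Suc i)" by (rule e(2))
    finally have "\<epsilon> v * T (e i + v) \<le> 3 / real (Suc i)" .
    then show ?thesis by (simp add: \<epsilon>_def field_simps)
  qed
  then show ?thesis using e(1) by blast
qed

text \<open>Uniformly small tails justify exchanging limit and sum. The tail bounds pass to the
  limit terms g, which makes these absolutely summable.\<close>

lemma tight_sums_tendsto:
  fixes a :: "nat \<Rightarrow> nat \<Rightarrow> real"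
  assumes S: "\<And>n. (a n has_sum S n) UNIV" and lim: "\<And>j. (\<lambda>n. a n j) \<longlonglongrightarrow> g j"
    and tail: "\<And>\<epsilon>. \<epsilon> > 0 \<Longrightarrow> \<exists>N. \<forall>n J. finite J \<longrightarrow> J \<subseteq> {N..} \<longrightarrow> (\<Sum>j\<in>J. \<bar>a n j\<bar>) \<le> \<epsilon>"
  shows "\<exists>T. (g has_sum T) UNIV \<and> S \<longlonglongrightarrow> T"
proof -
  have gtail: "(\<Sum>j\<in>J. \<bar>g j\<bar>) \<le> \<epsilon>"
    if "\<And>n J. finite J \<Longrightarrow> J \<subseteq> {N..} \<Longrightarrow> (\<Sum>j\<in>J. \<bar>a n j\<bar>) \<le> \<epsilon>" "finite J" "J \<subseteq> {N..}" for N J \<epsilon>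
  proof -
    have "(\<lambda>n. \<Sum>j\<in>J. \<bar>a n j\<bar>) \<longlonglongrightarrow> (\<Sum>j\<in>J. \<bar>g j\<bar>)" by (intro tendsto_sum tendsto_rabs lim)
    then show ?thesis by (rule LIMSEQ_le_const2) (use that in auto)
  qed
  have rest: "\<bar>T - (\<Sum>j<N. h j)\<bar> \<le> \<epsilon>"
    if h: "(h has_sum T) UNIV" and t: "\<And>J. finite J \<Longrightarrow> J \<subseteq> {N..} \<Longrightarrow> (\<Sum>j\<in>J. \<bar>h j\<bar>) \<le> \<epsilon>" for h :: "nat \<Rightarrow> real" and T N \<epsilon>
  proof -
    have hs: "(h has_sum (T - (\<Sum>j<N. h j))) (UNIV - {..<N})"
      by (rule has_sum_Diff[OF h]) (auto intro: has_sum_finiteI)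
    have abs: "(\<lambda>j. norm (h j)) summable_on (UNIV - {..<N})"
      using has_sum_imp_summable[OF hs] by (rule summable_on_iff_abs_summable_on_real[THEN iffD1])
    have "norm (\<Sum>\<^sub>\<infinity>j\<in>UNIV - {..<N}. h j) \<le> (\<Sum>\<^sub>\<infinity>j\<in>UNIV - {..<N}. norm (h j))" by (rule norm_infsum_bound[OF abs])
    also have "\<dots> \<le> \<epsilon>"
    proof (rule infsum_le_finite_sums[OF abs])
      fix J assume "finite J" "J \<subseteq> UNIV - {..<N}"
      then show "(\<Sum>j\<in>J. norm (h j)) \<le> \<epsilon>" unfolding real_norm_def by (intro t) auto
    qed
    finally show ?thesis using infsumI[OF hs] by simp
  qed
  obtain N1 where N1: "\<And>n J. finite J \<Longrightarrow> J \<subseteq> {N1..} \<Longrightarrow> (\<Sum>j\<in>J. \<bar>a n j\<bar>) \<le> 1" using tail[of 1] by auto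
  have "(\<lambda>j. norm (g j)) summable_on UNIV"
  proof (rule nonneg_bdd_above_summable_on)
    show "bdd_above (sum (\<lambda>j. norm (g j)) ` {F. F \<subseteq> UNIV \<and> finite F})"
    proof (rule bdd_aboveI2)
      fix F :: "nat set" assume F: "F \<in> {F. F \<subseteq> UNIV \<and> finite F}"
      have "(\<Sum>j\<in>F. \<bar>g j\<bar>) \<le> (\<Sum>j\<in>{..<N1} \<union> (F \<inter> {N1..}). \<bar>g j\<bar>)" using F by (intro sum_mono2) auto
      also have "\<dots> = (\<Sum>j<N1. \<bar>g j\<bar>) + (\<Sum>j\<in>F \<inter> {N1..}. \<bar>g j\<bar>)" using F by (intro sum.union_disjoint) auto
      also have "(\<Sum>j\<in>F \<inter> {N1..}. \<bar>g j\<bar>) \<le> 1" by (rule gtail[OF N1]) (use F in auto)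
      finally show "(\<Sum>j\<in>F. norm (g j)) \<le> (\<Sum>j<N1. \<bar>g j\<bar>) + 1" by simp
    qed
  qed simp
  then have "g summable_on UNIV" by (rule abs_summable_summable)
  then obtain T where T: "(g has_sum T) UNIV" by (auto simp: summable_on_def)
  have "S \<longlonglongrightarrow> T"
  proof (rule tendstoI)
    fix \<epsilon> :: real assume "\<epsilon> > 0"
    then obtain N where N: "\<And>n J. finite J \<Longrightarrow> J \<subseteq> {N..} \<Longrightarrow> (\<Sum>j\<in>J. \<bar>a n j\<bar>) \<le> \<epsilon> / 4" using tail[of "\<epsilon> / 4"] by auto
    have "(\<lambda>n. \<Sum>j<N. a n j) \<longlonglongrightarrow> (\<Sum>j<N. g j)" by (intro tendsto_sum lim)
    then have "\<forall>\<^sub>F n in sequentially. dist (\<Sum>j<N. a n j) (\<Sum>j<N. g j) < \<epsilon> / 4" using \<open>\<epsilon> > 0\<close> by (intro tendstoD) auto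
    then show "\<forall>\<^sub>F n in sequentially. dist (S n) T < \<epsilon>"
    proof eventually_elim
      case (elim n)
      have "\<bar>S n - (\<Sum>j<N. a n j)\<bar> \<le> \<epsilon> / 4" by (rule rest[OF S]) (rule N)
      moreover have "\<bar>T - (\<Sum>j<N. g j)\<bar> \<le> \<epsilon> / 4" by (rule rest[OF T gtail[OF N]])
      ultimately show ?case using elim \<open>\<epsilon> > 0\<close> unfolding dist_real_def by linarith
    qed
  qed
  then show ?thesis using T by blast
qed

text \<open>The diagonal sequence is a subsequence of the i-th extraction only from some index on;
  \<open>tail\<close> says that P i disregards the terms before.\<close>

lemma diagonal_subsequence:
  fixes P :: "nat \<Rightarrow> (nat \<Rightarrow> nat) \<Rightarrow> bool"
  assumes ex: "\<And>i (s :: nat \<Rightarrow> nat). strict_mono s \<Longrightarrow> \<exists>r :: nat \<Rightarrow> nat. strict_mono r \<and> P i (s \<circ> r)"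
    and stable: "\<And>i s (r :: nat \<Rightarrow> nat). strict_mono r \<Longrightarrow> P i s \<Longrightarrow> P i (s \<circ> r)"
    and tail: "\<And>i s m. P i (s \<circ> (+) m) \<Longrightarrow> P i s"
  shows "\<exists>s. strict_mono s \<and> (\<forall>i. P i s)"
proof -
  interpret subseqs P by (rule subseqs.intro) (rule ex)
  have "P i diagseq" for i by (rule tail[OF diagseq_holds]) (rule stable)
  then show ?thesis using subseq_diagseq by blast
qed

section \<open>Windowed functionals\<close>

text \<open>The tent in x of the first pair pins the configuration in space, which turns the
  translation invariant f into a function that vanishes at infinity.\<close>

definition windowed :: "int^'d::finite \<Rightarrow> ('d config \<Rightarrow> real) \<Rightarrow> 'd config \<Rightarrow> real" where
  "windowed v f z = tent (fst (z 0) - lattice_point v) * f z"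

definition translate :: "real^'d \<Rightarrow> (real^'d::finite) measure \<Rightarrow> (real^'d) measure" where
  "translate a \<mu> = distr \<mu> borel (\<lambda>x. x + a)"

lemma prob_measuresD:
  assumes "\<mu> \<in> prob_measures"
  shows "prob_space \<mu>" "sets \<mu> = sets borel" "space \<mu> = UNIV" "finite_measure \<mu>" "\<mu> \<in> subprob_measures"
  using assms subprob_measuresD[of \<mu>] prob_measures_subprob by (auto simp: prob_measures_def)

lemma translate_prob:
  assumes "\<mu> \<in> prob_measures"
  shows "translate a \<mu> \<in> prob_measures"
proof -
  note [measurable_cong] = prob_measuresD(2)[OF assms]
  have "prob_space (distr \<mu> borel (\<lambda>x. x + a))"
    by (rule prob_space.prob_space_distr[OF prob_measuresD(1)[OF assms]]) measurable
  then show ?thesis by (simp add: translate_def prob_measures_def)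
qed

lemma pair_translate:
  fixes \<mu> \<nu> :: "(real^'d::finite) measure"
  assumes "\<mu> \<in> subprob_measures" "\<nu> \<in> subprob_measures"
  shows "translate a \<mu> \<Otimes>\<^sub>M translate a \<nu> = distr (\<mu> \<Otimes>\<^sub>M \<nu>) borel (shift_pair a)"
proof -
  note m = subprob_measuresD[OF assms(1)] and n = subprob_measuresD[OF assms(2)]
  note [measurable_cong] = m(2) n(2)
  have "distr (density \<mu> (indicator (space \<mu>))) borel (\<lambda>x. x + a) \<Otimes>\<^sub>M distr (density \<nu> (indicator (space \<nu>))) borel (\<lambda>x. x + a)
    = distr (density (\<mu> \<Otimes>\<^sub>M \<nu>) (indicator (space \<mu> \<times> space \<nu>))) (borel \<Otimes>\<^sub>M borel) (\<lambda>(x, y). (x + a, y + a))"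
    by (rule pair_distr_density) (use m n in auto)
  then show ?thesis
    by (simp add: density_indicator_space space_pair_measure[symmetric] borel_prod shift_pair_def translate_def)
qed

lemma windowed_continuous:
  fixes f :: "'d::finite config \<Rightarrow> real"
  assumes "k \<ge> 1" "f \<in> test_functions k"
  shows "continuous_map (product_topology (\<lambda>_. euclidean) {..<k}) euclidean (windowed v f)"
proof -
  have "continuous_on UNIV (\<lambda>z :: 'd config. tent (fst (z 0) - lattice_point v))"
    by (rule continuous_on_compose2[OF continuous_tent])
      (auto intro!: continuous_intros continuous_on_product_coordinates)
  then have "continuous_map (product_topology (\<lambda>_. euclidean) {..<k}) euclidean (\<lambda>z :: 'd config. tent (fst (z 0) - lattice_point v))"
    by (rule continuous_on_imp_continuous_map_product)
  then show ?thesis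
    unfolding windowed_def using assms(2) by (intro continuous_map_real_mult) (auto simp: test_functions_def)
qed

lemma windowed_measurable:
  "k \<ge> 1 \<Longrightarrow> f \<in> test_functions k \<Longrightarrow> windowed v f \<in> borel_measurable (PiM {..<k} (\<lambda>_. borel))"
  by (rule continuous_map_imp_borel_measurable_PiM[OF windowed_continuous])

lemma windowed_bounded:
  assumes "\<bar>f z\<bar> \<le> B"
  shows "\<bar>windowed v f z\<bar> \<le> B * tent (fst (z 0) - lattice_point v)"
  using mult_right_mono[OF assms tent_bounds(1)[of "fst (z 0) - lattice_point v"]]
  by (simp add: windowed_def abs_mult tent_bounds mult.commute)

lemma windowed_le:
  assumes "\<bar>f z\<bar> \<le> B"
  shows "\<bar>windowed v f z\<bar> \<le> B"
proof -
  have "\<bar>windowed v f z\<bar> \<le> 1 * \<bar>f z\<bar>"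
    unfolding windowed_def abs_mult using tent_bounds[of "fst (z 0) - lattice_point v"] by (intro mult_right_mono) auto
  then show ?thesis using assms by simp
qed

text \<open>The tent keeps x of the first pair in a bounded set; if any other point is far away, the
  spread is large and f is small.\<close>

lemma windowed_vanishing:
  fixes f :: "'d::finite config \<Rightarrow> real"
  assumes k: "k \<ge> 1" and f: "f \<in> test_functions k"
  shows "vanishing_at_infinity k (windowed v f)"
  unfolding vanishing_at_infinity_def
proof (intro allI impI)
  fix \<epsilon> :: real assume "\<epsilon> > 0"
  then obtain R where R: "\<And>z. z \<in> configs k \<Longrightarrow> spread k z \<ge> R \<Longrightarrow> \<bar>f z\<bar> < \<epsilon>"
    using f unfolding test_functions_def mem_Collect_eq by meson
  define c where "c = norm (lattice_point v :: real^'d) + real CARD('d)"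
  \<comment> \<open>In the window the first x has norm at most c, so both components of
    \<open>z l\<close> have norm at most c plus the spread.\<close>
  have "\<bar>windowed v f z\<bar> < \<epsilon>" if z: "z \<in> configs k" and l: "l < k" "norm (z l) \<ge> 2 * c + 2 * R" for z l
  proof (cases "tent (fst (z 0) - lattice_point v) = 0")
    case True
    then show ?thesis using \<open>\<epsilon> > 0\<close> by (simp add: windowed_def)
  next
    case False
    have "norm (fst (z 0)) \<le> norm (lattice_point v :: real^'d) + norm (fst (z 0) - lattice_point v)"
      using norm_triangle_ineq[of "lattice_point v" "fst (z 0) - lattice_point v"] by simp
    then have x0: "norm (fst (z 0)) \<le> c" using tent_nonzero_imp_norm[OF False] by (simp add: c_def)
    have "norm (fst (z l)) \<le> norm (fst (z 0)) + norm (fst (z l) - fst (z 0))"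
      using norm_triangle_ineq[of "fst (z 0)" "fst (z l) - fst (z 0)"] by simp
    moreover have "norm (snd (z l)) \<le> norm (fst (z 0)) + norm (fst (z 0) - snd (z l))"
      using norm_triangle_ineq4[of "fst (z 0)" "fst (z 0) - snd (z l)"] by simp
    moreover have "norm (z l) \<le> norm (fst (z l)) + norm (snd (z l))" using norm_Pair_le[of "fst (z l)" "snd (z l)"] by simp
    ultimately have "norm (z l) \<le> 2 * c + 2 * spread k z"
      using spread_ge(2)[of l k 0 z] spread_ge(1)[of 0 k l z] l(1) k x0 by linarith
    then have "spread k z \<ge> R" using l(2) by linarith
    then show ?thesis using windowed_le[of f z "\<bar>f z\<bar>" v] R[OF z] by fastforce
  qed
  then show "\<exists>R. \<forall>z\<in>PiE {..<k} (\<lambda>_. UNIV). (\<exists>l<k. R \<le> norm (z l)) \<longrightarrow> \<bar>windowed v f z\<bar> < \<epsilon>"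
    unfolding configs_def[symmetric] by blast
qed

text \<open>The tents sum to 1 pointwise, and the absolute values of the pieces add up to at most B,
  which justifies exchanging sum and integral.\<close>

lemma has_sum_windowed:
  fixes f :: "'d::finite config \<Rightarrow> real" and \<gamma> :: "'d pt measure"
  assumes \<gamma>: "finite_measure \<gamma>" "sets \<gamma> = sets borel" and k: "k \<ge> 1" and f: "f \<in> test_functions k"
  shows "((\<lambda>v. power_integral k (windowed v f) \<gamma>) has_sum power_integral k f \<gamma>) UNIV"
proof -
  let ?P = "PiM {..<k} (\<lambda>_. \<gamma>)"
  interpret P: finite_measure ?P by (rule finite_measure_PiM_const[OF \<gamma>(1)])
  have sp: "space ?P = configs k" by (rule space_PiM_borel[OF \<gamma>(2)])
  obtain B where B: "B > 0" "\<And>z. z \<in> configs k \<Longrightarrow> \<bar>f z\<bar> \<le> B" using test_function_bounded[OF f] by blast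
  have meas: "h \<in> borel_measurable ?P" if "h \<in> borel_measurable (PiM {..<k} (\<lambda>_. borel))" for h :: "'d config \<Rightarrow> real"
    using that \<gamma>(2) by (simp cong: measurable_cong_sets sets_PiM_cong)
  \<comment> \<open>The lattice is enumerated so that the exchange is one for series; absolute
    convergence makes the order immaterial in the end.\<close>
  define g :: "nat \<Rightarrow> int^'d" where "g = from_nat_into UNIV"
  have g: "bij_betw g UNIV UNIV" unfolding g_def by (rule bij_betw_from_nat_into[OF _ infinite_UNIV_lattice]) simp
  define F where "F i = windowed (g i) f" for i
  have int: "integrable ?P (F i)" for i
    unfolding F_def
    by (rule P.integrable_const_bound[of _ B, OF AE_I2 meas[OF windowed_measurable[OF k f]]])
      (simp only: sp real_norm_def windowed_le[OF B(2)])
  have tent_sums: "(\<lambda>i. tent (x - lattice_point (g i))) sums 1" for x :: "real^'d"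
    by (rule has_sum_imp_sums) (use has_sum_tent[of x] has_sum_reindex_bij_betw[OF g, of "\<lambda>q. tent (x - lattice_point q)" 1] in simp)
  have tent_le: "(\<Sum>i<n. tent (x - lattice_point (g i))) \<le> 1" for n and x :: "real^'d"
    using sum_le_suminf[of "\<lambda>i. tent (x - lattice_point (g i))" "{..<n}"] tent_sums[of x] by (simp add: sums_iff tent_bounds)
  have Fsums: "(\<lambda>i. F i z) sums f z" for z
    using sums_mult2[OF tent_sums[of "fst (z 0)"], of "f z"] by (simp add: F_def windowed_def)
  have nF: "norm (F i z) = tent (fst (z 0) - lattice_point (g i)) * \<bar>f z\<bar>" for i z
    by (simp add: F_def windowed_def abs_mult tent_bounds)
  have sn: "summable (\<lambda>i. norm (F i z))" for z
    unfolding nF by (rule summable_mult2) (use tent_sums sums_iff in blast)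
  have bnd: "(\<Sum>i<n. \<integral>z. norm (F i z) \<partial>?P) \<le> B * measure ?P (space ?P)" for n
  proof -
    have "(\<Sum>i<n. \<integral>z. norm (F i z) \<partial>?P) = (\<integral>z. (\<Sum>i<n. norm (F i z)) \<partial>?P)"
      by (rule Bochner_Integration.integral_sum[symmetric]) (use int in auto)
    also have "\<dots> \<le> (\<integral>z. B \<partial>?P)"
    proof (rule integral_mono)
      fix z assume "z \<in> space ?P"
      then have "\<bar>f z\<bar> \<le> B" using B sp by auto
      then have "(\<Sum>i<n. tent (fst (z 0) - lattice_point (g i))) * \<bar>f z\<bar> \<le> 1 * B"
        using tent_le B by (intro mult_mono) auto
      then show "(\<Sum>i<n. norm (F i z)) \<le> B" unfolding nF by (simp add: sum_distrib_right)
    qed (use int in auto)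
    finally show ?thesis by (simp add: mult.commute)
  qed
  have si: "summable (\<lambda>i. \<integral>z. norm (F i z) \<partial>?P)"
    by (rule summableI_nonneg_bounded[OF _ bnd]) (rule Bochner_Integration.integral_nonneg, simp)
  have "(\<lambda>i. \<integral>z. F i z \<partial>?P) sums (\<integral>z. (\<Sum>i. F i z) \<partial>?P)"
    by (rule sums_integral[OF int _ si]) (use sn in auto)
  then have "(\<lambda>i. \<integral>z. F i z \<partial>?P) sums (\<integral>z. f z \<partial>?P)"
    using Fsums by (simp add: sums_iff)
  moreover have "summable (\<lambda>i. norm (\<integral>z. F i z \<partial>?P))"
    by (rule summable_comparison_test'[OF si, of 0], unfold real_norm_def abs_abs) (rule integral_abs_bound)
  ultimately have "((\<lambda>i. \<integral>z. F i z \<partial>?P) has_sum (\<integral>z. f z \<partial>?P)) UNIV"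
    by (intro norm_summable_imp_has_sum)
  then show ?thesis
    unfolding power_integral_def F_def
    using has_sum_reindex_bij_betw[OF g, of "\<lambda>v. \<integral>z. windowed v f z \<partial>?P"] by simp
qed

text \<open>f does not see the common translation of both measures, so recentring only moves the
  window.\<close>

lemma power_integral_windowed_translate:
  fixes f :: "'d::finite config \<Rightarrow> real"
  assumes \<mu>: "\<mu> \<in> subprob_measures" "\<nu> \<in> subprob_measures" and k: "k \<ge> 1" and f: "f \<in> test_functions k"
  shows "power_integral k (windowed v f) (translate (- lattice_point q) \<mu> \<Otimes>\<^sub>M translate (- lattice_point q) \<nu>) =
    power_integral k (windowed (q + v) f) (\<mu> \<Otimes>\<^sub>M \<nu>)"
proof -
  note pm = pair_subprob[OF \<mu>]
  have [measurable_cong]: "sets (\<mu> \<Otimes>\<^sub>M \<nu>) = sets borel" by fact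
  have sp: "space (\<mu> \<Otimes>\<^sub>M \<nu>) = UNIV" using sets_eq_imp_space_eq[OF pm(2)] by simp
  have "power_integral k (windowed v f) (translate (- lattice_point q) \<mu> \<Otimes>\<^sub>M translate (- lattice_point q) \<nu>) =
    power_integral k (windowed v f) (distr (density (\<mu> \<Otimes>\<^sub>M \<nu>) (indicator (space (\<mu> \<Otimes>\<^sub>M \<nu>)))) borel (shift_pair (- lattice_point q)))"
    by (simp add: density_indicator_space pair_translate[OF \<mu>])
  also have "\<dots> = (\<integral>w. windowed v f (\<lambda>i\<in>{..<k}. shift_pair (- lattice_point q) (w i)) \<partial>PiM {..<k} (\<lambda>_. \<mu> \<Otimes>\<^sub>M \<nu>))"
    unfolding power_integral_def
    by (subst integral_PiM_distr_density) (auto simp: pm windowed_measurable[OF k f] sp)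
  also have "\<dots> = power_integral k (windowed (q + v) f) (\<mu> \<Otimes>\<^sub>M \<nu>)"
    unfolding power_integral_def
  proof (rule Bochner_Integration.integral_cong[OF refl])
    fix w assume "w \<in> space (PiM {..<k} (\<lambda>_. \<mu> \<Otimes>\<^sub>M \<nu>))"
    then have w: "w \<in> configs k" by (simp add: space_PiM_borel[OF pm(2)])
    have "f (\<lambda>i\<in>{..<k}. shift_pair (- lattice_point q) (w i)) = f w"
      using f w unfolding test_functions_def shift_pair_def case_prod_unfold mem_Collect_eq by blast
    then show "windowed v f (\<lambda>i\<in>{..<k}. shift_pair (- lattice_point q) (w i)) = windowed (q + v) f w"
      using k by (simp add: windowed_def shift_pair_def case_prod_unfold lattice_point_add algebra_simps)
  qed
  finally show ?thesis .
qed

definition window_mass :: "(real^'d::finite) measure \<Rightarrow> int^'d \<Rightarrow> real" where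
  "window_mass \<mu> q = (\<integral>x. tent (x - lattice_point q) \<partial>\<mu>)"

lemma tent_measurable[measurable]: "(\<lambda>x. tent (x - a)) \<in> borel_measurable borel"
  by (rule compactly_supported_measurable[OF tent_compactly_supported])

lemma tent_integrable:
  assumes "\<mu> \<in> subprob_measures"
  shows "integrable \<mu> (\<lambda>x. tent (x - a))"
proof -
  note m = subprob_measuresD[OF assms]
  note [measurable_cong] = m(2)
  show ?thesis by (rule finite_measure.integrable_const_bound[OF m(1), of _ 1]) (auto simp: tent_bounds)
qed

lemma window_mass_nonneg: "0 \<le> window_mass \<mu> q"
  unfolding window_mass_def by (rule Bochner_Integration.integral_nonneg) (rule tent_bounds)

lemma sum_window_mass_le:
  assumes \<mu>: "\<mu> \<in> subprob_measures" and Q: "finite Q"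
  shows "(\<Sum>q\<in>Q. window_mass \<mu> q) \<le> measure \<mu> UNIV"
proof -
  note m = subprob_measuresD[OF assms(1)]
  interpret finite_measure \<mu> by (rule m)
  have "(\<Sum>q\<in>Q. window_mass \<mu> q) = (\<integral>x. (\<Sum>q\<in>Q. tent (x - lattice_point q)) \<partial>\<mu>)"
    unfolding window_mass_def by (rule Bochner_Integration.integral_sum[symmetric]) (rule tent_integrable[OF \<mu>])
  also have "\<dots> \<le> (\<integral>x. 1 \<partial>\<mu>)"
    by (rule integral_mono) (use sum_tent_le_1[OF Q] tent_integrable[OF \<mu>] in auto)
  finally show ?thesis by (simp add: m(3))
qed

text \<open>Balls exhaust the measure, and finitely many tents dominate the indicator of a
  ball.\<close>

lemma measure_le_window_mass:
  assumes \<mu>: "\<mu> \<in> subprob_measures" and \<epsilon>: "\<epsilon> > 0"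
  shows "\<exists>V. finite V \<and> measure \<mu> UNIV \<le> (\<Sum>v\<in>V. window_mass \<mu> v) + \<epsilon>"
proof -
  note m = subprob_measuresD[OF assms(1)]
  interpret finite_measure \<mu> by (rule m)
  have "(\<lambda>n. measure \<mu> (cball 0 (real n))) \<longlonglongrightarrow> measure \<mu> (\<Union>n. cball 0 (real n))"
    by (rule finite_Lim_measure_incseq) (auto simp: m(2) incseq_def)
  moreover have "(\<Union>n. cball 0 (real n)) = (UNIV :: (real^'a) set)"
    using real_arch_simple by auto
  ultimately have "(\<lambda>n. measure \<mu> (cball 0 (real n))) \<longlonglongrightarrow> measure \<mu> UNIV" by simp
  then have "\<forall>\<^sub>F n in sequentially. measure \<mu> (cball 0 (real n)) > measure \<mu> UNIV - \<epsilon>"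
    using \<epsilon> by (intro order_tendstoD) auto
  then obtain n where n: "measure \<mu> (cball 0 (real n)) > measure \<mu> UNIV - \<epsilon>"
    by (meson eventually_sequentially order_refl)
  obtain V :: "(int^'a) set" where V: "finite V" "\<And>y. norm y \<le> real n \<Longrightarrow> 1 \<le> (\<Sum>v\<in>V. tent (y - lattice_point v))"
    using exists_window[of "real n"] by blast
  have "measure \<mu> (cball 0 (real n)) = (\<integral>x. indicator (cball 0 (real n)) x \<partial>\<mu>)" by (simp add: m)
  also have "\<dots> \<le> (\<integral>x. (\<Sum>v\<in>V. tent (x - lattice_point v)) \<partial>\<mu>)"
  proof (rule integral_mono)
    show "integrable \<mu> (\<lambda>x. indicator (cball 0 (real n)) x :: real)"
      by (rule integrable_real_indicator) (auto simp: m emeasure_eq_measure)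
    show "integrable \<mu> (\<lambda>x. \<Sum>v\<in>V. tent (x - lattice_point v))" using tent_integrable[OF \<mu>] by auto
    fix x :: "real^'a"
    show "indicator (cball 0 (real n)) x \<le> (\<Sum>v\<in>V. tent (x - lattice_point v))"
      using V(2)[of x] by (cases "norm x \<le> real n") (auto simp: indicator_def intro!: sum_nonneg tent_bounds)
  qed
  also have "\<dots> = (\<Sum>v\<in>V. window_mass \<mu> v)"
    unfolding window_mass_def by (rule Bochner_Integration.integral_sum) (rule tent_integrable[OF \<mu>])
  finally show ?thesis using n V(1) by (intro exI[of _ V]) auto
qed

text \<open>The bound involves only the first pair. Since \<mu> and \<nu> have mass 1, that pair has
  the law of their product under the power, and its components are independent, so the integral
  factorises into window masses.\<close>

lemma power_integral_windowed_le:
  fixes f :: "'d::finite config \<Rightarrow> real"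
  assumes \<mu>: "\<mu> \<in> prob_measures" and \<nu>: "\<nu> \<in> prob_measures" and k: "k \<ge> 1" and f: "f \<in> test_functions k"
    and V: "finite V" and ab: "a \<ge> 0" "b \<ge> 0"
    and le: "\<And>z. z \<in> configs k \<Longrightarrow> \<bar>windowed q f z\<bar> \<le>
      tent (fst (z 0) - lattice_point q) * (a + b * (\<Sum>v\<in>V. tent (snd (z 0) - lattice_point (q + v))))"
  shows "\<bar>power_integral k (windowed q f) (\<mu> \<Otimes>\<^sub>M \<nu>)\<bar> \<le> window_mass \<mu> q * (a + b * (\<Sum>v\<in>V. window_mass \<nu> (q + v)))"
proof -
  note m = prob_measuresD[OF \<mu>] and n = prob_measuresD[OF \<nu>]
  note [measurable_cong] = m(2) n(2)
  note pm = pair_subprob[OF m(5) n(5)]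
  let ?\<gamma> = "\<mu> \<Otimes>\<^sub>M \<nu>"
  let ?P = "PiM {..<k} (\<lambda>_::nat. ?\<gamma>)"
  interpret \<mu>: prob_space \<mu> by (rule m)
  interpret \<nu>: prob_space \<nu> by (rule n)
  interpret pp: pair_prob_space \<mu> \<nu> by unfold_locales
  interpret P: finite_measure ?P by (rule finite_measure_PiM_const[OF pm(1)])
  define h1 where "h1 x = tent (x - lattice_point q)" for x :: "real^'d"
  define h2 where "h2 y = a + b * (\<Sum>v\<in>V. tent (y - lattice_point (q + v)))" for y :: "real^'d"
  have [measurable]: "h1 \<in> borel_measurable borel" "h2 \<in> borel_measurable borel" unfolding h1_def h2_def by measurable
  have h1: "0 \<le> h1 x" "h1 x \<le> 1" for x by (auto simp: h1_def tent_bounds)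
  have h2: "0 \<le> h2 y" "h2 y \<le> a + b * real (card V)" for y
  proof -
    show "0 \<le> h2 y" unfolding h2_def using ab tent_bounds by (auto intro!: add_nonneg_nonneg mult_nonneg_nonneg sum_nonneg)
    show "h2 y \<le> a + b * real (card V)"
      unfolding h2_def using ab sum_bounded_above[of V "\<lambda>v. tent (y - lattice_point (q + v))" 1] tent_bounds
      by (auto intro!: mult_left_mono)
  qed
  have hm: "(\<lambda>x. h1 (fst x) * h2 (snd x)) \<in> borel_measurable ?\<gamma>" by measurable
  have hb: "norm (h1 (fst x) * h2 (snd x)) \<le> 1 * (a + b * real (card V))" for x :: "'d pt"
    unfolding norm_mult using h1 h2 by (intro mult_mono) auto
  have hi: "integrable ?\<gamma> (\<lambda>x. h1 (fst x) * h2 (snd x))"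
    by (rule pp.P.integrable_const_bound[OF AE_I2[OF hb] hm])
  have comp: "distr ?P ?\<gamma> (\<lambda>z. z 0) = ?\<gamma>"
    by (rule distr_PiM_component) (use k pp.P.prob_space_axioms in auto)
  have c0: "(\<lambda>z. z 0) \<in> measurable ?P ?\<gamma>" using k by (intro measurable_component_singleton) auto
  have hiP: "integrable ?P (\<lambda>z. h1 (fst (z 0)) * h2 (snd (z 0)))"
    using hi integrable_distr_eq[OF c0 hm] comp by simp
  have "\<bar>power_integral k (windowed q f) ?\<gamma>\<bar> \<le> (\<integral>z. \<bar>windowed q f z\<bar> \<partial>?P)"
    unfolding power_integral_def by (rule integral_abs_bound)
  also have "\<dots> \<le> (\<integral>z. h1 (fst (z 0)) * h2 (snd (z 0)) \<partial>?P)"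
  proof (rule integral_mono_AE'[OF hiP])
    show "AE z in ?P. \<bar>windowed q f z\<bar> \<le> h1 (fst (z 0)) * h2 (snd (z 0))"
      using le by (intro AE_I2) (simp add: space_PiM_borel[OF pm(2)] h1_def h2_def)
    show "AE z in ?P. 0 \<le> h1 (fst (z 0)) * h2 (snd (z 0))"
      by (intro AE_I2 mult_nonneg_nonneg h1 h2)
  qed
  also have "\<dots> = (\<integral>x. h1 (fst x) * h2 (snd x) \<partial>?\<gamma>)"
    using integral_distr[OF c0 hm] comp by simp
  also have "\<dots> = (\<integral>x. (\<integral>y. h1 x * h2 y \<partial>\<nu>) \<partial>\<mu>)"
    using pp.integral_fst'[OF hi] by simp
  also have "\<dots> = (\<integral>x. h1 x \<partial>\<mu>) * (\<integral>y. h2 y \<partial>\<nu>)" by simp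
  also have "(\<integral>y. h2 y \<partial>\<nu>) = a + b * (\<Sum>v\<in>V. window_mass \<nu> (q + v))"
  proof -
    have "(\<integral>y. h2 y \<partial>\<nu>) = (\<integral>y. a \<partial>\<nu>) + (\<integral>y. b * (\<Sum>v\<in>V. tent (y - lattice_point (q + v))) \<partial>\<nu>)"
      unfolding h2_def by (rule Bochner_Integration.integral_add) (use tent_integrable[OF n(5)] in auto)
    also have "(\<integral>y. b * (\<Sum>v\<in>V. tent (y - lattice_point (q + v))) \<partial>\<nu>) = b * (\<Sum>v\<in>V. window_mass \<nu> (q + v))"
      unfolding window_mass_def integral_mult_right_zero
      by (subst Bochner_Integration.integral_sum) (use tent_integrable[OF n(5)] in auto)
    finally show ?thesis by (simp add: \<nu>.prob_space)
  qed
  finally show ?thesis by (simp add: h1_def window_mass_def)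
qed

section \<open>Profile decomposition\<close>

text \<open>The data available along a suitable subsequence: \<open>e n\<close> ranks the cells,
  \<open>small\<close> bounds the masses near a cell by its rank uniformly in n,
  \<open>dichotomy\<close> says that the rank of a cell displaced from a ranked one eventually
  settles or tends to infinity, and the couplings give the vague limits seen from each rank.\<close>

locale profile_decomposition =
  fixes \<mu> \<nu> :: "nat \<Rightarrow> (real^'d::finite) measure" and e :: "nat \<Rightarrow> nat \<Rightarrow> int^'d"
    and \<Omega> \<Omega>' :: "nat \<Rightarrow> real measure" and A B :: "nat \<Rightarrow> real set"
    and Xs Ys :: "nat \<Rightarrow> nat \<Rightarrow> real \<Rightarrow> real^'d" and X Y :: "nat \<Rightarrow> real \<Rightarrow> real^'d"
  assumes \<mu>: "\<And>n. \<mu> n \<in> prob_measures" and \<nu>: "\<And>n. \<nu> n \<in> prob_measures"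
    and bij: "\<And>n. bij (e n)"
    and small: "\<And>v. \<exists>C. \<forall>n i. window_mass (\<mu> n) (e n i + v) + window_mass (\<nu> n) (e n i + v) \<le> C / real (Suc i)"
    and dichotomy: "\<And>i v. (\<exists>j. \<forall>\<^sub>F n in sequentially. e n j = e n i + v) \<or>
      filterlim (\<lambda>n. inv (e n) (e n i + v)) at_top sequentially"
    and c\<mu>: "\<And>i. vague_coupling (\<lambda>n. translate (- lattice_point (e n i)) (\<mu> n)) (\<Omega> i) (A i) (Xs i) (X i)"
    and c\<nu>: "\<And>i. vague_coupling (\<lambda>n. translate (- lattice_point (e n i)) (\<nu> n)) (\<Omega>' i) (B i) (Ys i) (Y i)"
begin

definition \<alpha> :: "nat \<Rightarrow> (real^'d) measure" where "\<alpha> i = vague_limit (\<Omega> i) (A i) (X i)"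
definition \<beta> :: "nat \<Rightarrow> (real^'d) measure" where "\<beta> i = vague_limit (\<Omega>' i) (B i) (Y i)"

lemma \<alpha>_subprob: "\<alpha> i \<in> subprob_measures"
  unfolding \<alpha>_def by (rule vague_limit_subprob[OF c\<mu>])

lemma \<beta>_subprob: "\<beta> i \<in> subprob_measures"
  unfolding \<beta>_def by (rule vague_limit_subprob[OF c\<nu>])

section \<open>Ranks at constant displacement\<close>

definition position :: "nat \<times> (int^'d) \<Rightarrow> nat \<Rightarrow> bool" where
  "position = (\<lambda>(i, v) j. \<forall>\<^sub>F n in sequentially. e n j = e n i + v)"

text \<open>The least rank in each class of ranks at eventually constant displacement; each class
  yields one member of the limit collection.\<close>

definition representatives :: "nat set" where
  "representatives = {i. \<forall>i'<i. \<forall>v. \<not> position (i', v) i}"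

lemma position_unique: "position (i, v) j \<Longrightarrow> position (i, v) j' \<Longrightarrow> j = j'"
proof -
  assume "position (i, v) j" "position (i, v) j'"
  then have "\<forall>\<^sub>F n in sequentially. e n j = e n j'" unfolding position_def by (auto elim: eventually_elim2)
  then obtain n where "e n j = e n j'" by (meson eventually_sequentially order_refl)
  then show ?thesis using bij[of n] by (auto simp: bij_def inj_eq)
qed

lemma position_trans: "position (i, v) j \<Longrightarrow> position (i', v') i \<Longrightarrow> position (i', v' + v) j"
  unfolding position_def by (auto elim: eventually_elim2 simp: add.assoc)

lemma position_sym: "position (i, v) j \<Longrightarrow> position (j, - v) i"
  unfolding position_def by (auto elim: eventually_mono)

lemma position_0: "position (i, 0) i"
  by (simp add: position_def)

lemma exists_representative: "\<exists>i\<in>representatives. \<exists>v. position (i, v) j"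
proof -
  define i where "i = (LEAST i. \<exists>v. position (i, v) j)"
  have "\<exists>v. position (i, v) j" unfolding i_def by (rule LeastI[of _ j]) (use position_0 in blast)
  then obtain v where v: "position (i, v) j" ..
  have "\<not> position (i', v') i" if "i' < i" for i' v'
  proof
    assume "position (i', v') i"
    then have "position (i', v' + v) j" by (rule position_trans[OF v])
    then have "i \<le> i'" unfolding i_def by (intro Least_le) blast
    then show False using that by simp
  qed
  then show ?thesis using v by (auto simp: representatives_def)
qed

lemma representative_unique:
  assumes "i \<in> representatives" "i' \<in> representatives" "position (i, v) j" "position (i', v') j"
  shows "i = i' \<and> v = v'"
proof -
  have "position (i', v' + - v) i" by (rule position_trans[OF position_sym[OF assms(3)] assms(4)])
  moreover have "position (i, v + - v') i'" by (rule position_trans[OF position_sym[OF assms(4)] assms(3)])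
  ultimately have i: "i = i'" using assms(1,2) unfolding representatives_def by (metis (mono_tags, lifting) linorder_neqE_nat mem_Collect_eq)
  have "\<forall>\<^sub>F n in sequentially. v = v'"
    using assms(3,4) unfolding position_def i case_prod_conv by eventually_elim simp
  then show ?thesis using i by simp
qed

text \<open>For pairs of a representative and a displacement that are left out, the rank of the
  displaced cell tends to infinity by \<open>dichotomy\<close>.\<close>

definition placed :: "(nat \<times> (int^'d)) set" where
  "placed = {p. fst p \<in> representatives \<and> (\<exists>j. position p j)}"

definition place :: "nat \<times> (int^'d) \<Rightarrow> nat" where
  "place p = (THE j. position p j)"

lemma place_eq: "position p j \<Longrightarrow> place p = j"
  unfolding place_def by (rule the_equality) (use position_unique[of "fst p" "snd p"] in simp_all)

text \<open>Every rank lies at exactly one displacement from exactly one representative, so sums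
  over ranks can be rewritten as sums over placed pairs.\<close>

lemma place_bij: "bij_betw place placed UNIV"
proof (rule bij_betw_imageI)
  show "inj_on place placed"
  proof (rule inj_onI)
    fix p p' assume p: "p \<in> placed" "p' \<in> placed" "place p = place p'"
    obtain j j' where j: "position p j" "position p' j'" using p by (auto simp: placed_def)
    then have "j = j'" using place_eq p(3) by metis
    then show "p = p'" using representative_unique[of "fst p" "fst p'" "snd p" j "snd p'"] p j
      by (auto simp: placed_def prod_eq_iff)
  qed
  show "place ` placed = UNIV"
  proof safe
    fix j
    obtain i v where "i \<in> representatives" "position (i, v) j" using exists_representative by blast
    then show "j \<in> place ` placed" by (intro image_eqI[of _ _ "(i, v)"]) (auto simp: placed_def place_eq)
  qed simp
qed

lemma window_mass_translate:
  assumes "\<kappa> \<in> prob_measures"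
  shows "window_mass (translate (- lattice_point q) \<kappa>) v = window_mass \<kappa> (q + v)"
proof -
  note [measurable_cong] = prob_measuresD(2)[OF assms]
  show ?thesis
    unfolding window_mass_def translate_def
    by (subst integral_distr) (auto simp: lattice_point_add algebra_simps)
qed

lemma window_mass_tendsto:
  "(\<lambda>n. window_mass (\<mu> n) (e n i + v)) \<longlonglongrightarrow> window_mass (\<alpha> i) v"
  "(\<lambda>n. window_mass (\<nu> n) (e n i + v)) \<longlonglongrightarrow> window_mass (\<beta> i) v"
  using vague_coupling_integral_tendsto_1[OF c\<mu> tent_compactly_supported, of i "lattice_point v"]
    vague_coupling_integral_tendsto_1[OF c\<nu> tent_compactly_supported, of i "lattice_point v"]
  unfolding window_mass_def[symmetric] window_mass_translate[OF \<mu>] window_mass_translate[OF \<nu>] \<alpha>_def[symmetric] \<beta>_def[symmetric]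
  by simp_all

text \<open>Windows around positions of different representatives are eventually distinct, hence the
  masses of the profiles add up to at most one.\<close>

lemma sum_masses_le_1:
  assumes F: "finite F" "F \<subseteq> representatives"
    and \<kappa>: "\<And>n. \<kappa> n \<in> prob_measures" and a: "\<And>i. a i \<in> subprob_measures"
    and lim: "\<And>i v. (\<lambda>n. window_mass (\<kappa> n) (e n i + v)) \<longlonglongrightarrow> window_mass (a i) v"
  shows "(\<Sum>i\<in>F. measure (a i) UNIV) \<le> 1"
proof (rule field_le_epsilon)
  fix \<epsilon> :: real assume "\<epsilon> > 0"
  \<comment> \<open>Distributes \<epsilon> over the members of F; the added 1 guards against an
    empty F.\<close>
  define \<delta> where "\<delta> = \<epsilon> / (real (card F) + 1)"
  have "\<delta> > 0" using \<open>\<epsilon> > 0\<close> by (simp add: \<delta>_def)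
  have "\<forall>i\<in>F. \<exists>V. finite V \<and> measure (a i) UNIV \<le> (\<Sum>v\<in>V. window_mass (a i) v) + \<delta>"
    using measure_le_window_mass[OF a \<open>\<delta> > 0\<close>] by blast
  from bchoice[OF this] obtain V where
    V: "\<And>i. i \<in> F \<Longrightarrow> finite (V i)" "\<And>i. i \<in> F \<Longrightarrow> measure (a i) UNIV \<le> (\<Sum>v\<in>V i. window_mass (a i) v) + \<delta>" by blast
  define W where "W = Sigma F V"
  have W: "finite W" using F(1) V(1) by (auto simp: W_def)
  have ne: "\<forall>\<^sub>F n in sequentially. p \<noteq> p' \<longrightarrow> e n (fst p) + snd p \<noteq> e n (fst p') + snd p'" if "p \<in> W" "p' \<in> W" for p p'
  proof (cases "fst p = fst p'")
    case True
    then show ?thesis by (auto simp: prod_eq_iff)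
  next
    case False
    let ?v = "snd p' - snd p"
    have r: "fst p \<in> representatives" "fst p' \<in> representatives" using that F(2) by (auto simp: W_def)
    have "\<forall>\<^sub>F n in sequentially. e n (fst p) \<noteq> e n (fst p') + ?v"
    proof (cases "\<exists>j. position (fst p', ?v) j")
      case True
      then obtain j where j: "position (fst p', ?v) j" by blast
      have "j \<noteq> fst p"
        using representative_unique[OF r position_0, of ?v] j False by auto
      then have "e n (fst p) \<noteq> e n j" for n using bij[of n] by (auto simp: bij_def inj_eq)
      then show ?thesis using j unfolding position_def case_prod_conv
        by (elim eventually_mono) metis
    next
      \<comment> \<open>No fixed rank is eventually at this displacement, so the rank of the
        displaced cell exceeds \<open>fst p\<close> from some n on.\<close>
      case nex: False
      then have "filterlim (\<lambda>n. inv (e n) (e n (fst p') + ?v)) at_top sequentially"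
        using dichotomy[of "fst p'" ?v] by (auto simp: position_def)
      then have "\<forall>\<^sub>F n in sequentially. inv (e n) (e n (fst p') + ?v) > fst p"
        unfolding filterlim_at_top by (auto simp: Suc_le_eq dest: spec[of _ "Suc (fst p)"])
      then show ?thesis
      proof eventually_elim
        case (elim n)
        then show ?case using bij[of n] by (metis bij_def inv_f_f less_irrefl)
      qed
    qed
    then show ?thesis by eventually_elim (auto simp: algebra_simps)
  qed
  have "\<forall>\<^sub>F n in sequentially. \<forall>p\<in>W. \<forall>p'\<in>W. p \<noteq> p' \<longrightarrow> e n (fst p) + snd p \<noteq> e n (fst p') + snd p'"
    by (intro eventually_ball_finite W ballI ne)
  then have ev: "\<forall>\<^sub>F n in sequentially. (\<Sum>p\<in>W. window_mass (\<kappa> n) (e n (fst p) + snd p)) \<le> 1"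
  proof eventually_elim
    case (elim n)
    then have inj: "inj_on (\<lambda>p. e n (fst p) + snd p) W" by (auto simp: inj_on_def)
    have "(\<Sum>p\<in>W. window_mass (\<kappa> n) (e n (fst p) + snd p)) = (\<Sum>q\<in>(\<lambda>p. e n (fst p) + snd p) ` W. window_mass (\<kappa> n) q)"
      by (subst sum.reindex[OF inj]) simp
    also have "\<dots> \<le> measure (\<kappa> n) UNIV"
      by (rule sum_window_mass_le[OF prob_measuresD(5)[OF \<kappa>]]) (use W in simp)
    also have "\<dots> \<le> 1" by (rule subprob_measuresD(4)[OF prob_measuresD(5)[OF \<kappa>]])
    finally show ?case .
  qed
  have "(\<lambda>n. \<Sum>p\<in>W. window_mass (\<kappa> n) (e n (fst p) + snd p)) \<longlonglongrightarrow> (\<Sum>p\<in>W. window_mass (a (fst p)) (snd p))"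
    by (intro tendsto_sum lim)
  then have le1: "(\<Sum>p\<in>W. window_mass (a (fst p)) (snd p)) \<le> 1"
    by (rule tendsto_upperbound[OF _ ev]) simp
  have "(\<Sum>i\<in>F. measure (a i) UNIV) \<le> (\<Sum>i\<in>F. (\<Sum>v\<in>V i. window_mass (a i) v) + \<delta>)" using V(2) by (rule sum_mono)
  also have "\<dots> = (\<Sum>p\<in>W. window_mass (a (fst p)) (snd p)) + real (card F) * \<delta>"
    unfolding W_def using F(1) V(1) by (simp add: sum.distrib sum.Sigma case_prod_unfold)
  also have "\<dots> \<le> 1 + \<epsilon>"
  proof -
    have "real (card F) * \<delta> \<le> \<epsilon>" using \<open>\<epsilon> > 0\<close> by (simp add: \<delta>_def field_simps)
    then show ?thesis using le1 by simp
  qed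
  finally show "(\<Sum>i\<in>F. measure (a i) UNIV) \<le> 1 + \<epsilon>" .
qed

lemma representatives_family: "subprob_family representatives \<alpha> \<beta>"
  unfolding subprob_family_def
  using \<alpha>_subprob \<beta>_subprob sum_masses_le_1[OF _ _ \<mu> \<alpha>_subprob window_mass_tendsto(1)] sum_masses_le_1[OF _ _ \<nu> \<beta>_subprob window_mass_tendsto(2)]
  by blast

section \<open>Convergence of the functionals to those of the profiles\<close>

context
  fixes k :: nat and f :: "'d config \<Rightarrow> real"
  assumes k: "k \<ge> 1" and f: "f \<in> test_functions k"
begin

lemma windowed_tendsto:
  "(\<lambda>n. power_integral k (windowed (e n i + v) f) (\<mu> n \<Otimes>\<^sub>M \<nu> n)) \<longlonglongrightarrow> power_integral k (windowed v f) (\<alpha> i \<Otimes>\<^sub>M \<beta> i)"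
proof -
  obtain C where C: "\<And>z. z \<in> configs k \<Longrightarrow> \<bar>f z\<bar> \<le> C" using test_function_bounded[OF f] by blast
  have "(\<lambda>n. power_integral k (windowed v f) (translate (- lattice_point (e n i)) (\<mu> n) \<Otimes>\<^sub>M translate (- lattice_point (e n i)) (\<nu> n)))
    \<longlonglongrightarrow> power_integral k (windowed v f) (\<alpha> i \<Otimes>\<^sub>M \<beta> i)"
    unfolding \<alpha>_def \<beta>_def
    by (rule vague_coupling_integral_tendsto[OF c\<mu> c\<nu> windowed_continuous[OF k f] windowed_le[OF C] windowed_vanishing[OF k f]])
  then show ?thesis
    by (simp only: power_integral_windowed_translate[OF prob_measuresD(5)[OF \<mu>] prob_measuresD(5)[OF \<nu>] k f])
qed

text \<open>With f replaced by its bound, only the mass of \<mu> n in the window remains. This makes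
  the contribution of a window vanish when its rank tends to infinity.\<close>

lemma windowed_small:
  "\<exists>C. \<forall>n i. \<bar>power_integral k (windowed (e n i) f) (\<mu> n \<Otimes>\<^sub>M \<nu> n)\<bar> \<le> C / real (Suc i)"
proof -
  obtain B0 where B0: "B0 > 0" "\<And>z. z \<in> configs k \<Longrightarrow> \<bar>f z\<bar> \<le> B0" using test_function_bounded[OF f] by blast
  obtain C where C: "\<And>n i. window_mass (\<mu> n) (e n i + 0) + window_mass (\<nu> n) (e n i + 0) \<le> C / real (Suc i)" using small by blast
  have "\<bar>power_integral k (windowed (e n i) f) (\<mu> n \<Otimes>\<^sub>M \<nu> n)\<bar> \<le> (B0 * C) / real (Suc i)" for n i
  proof -
    have "\<bar>power_integral k (windowed (e n i) f) (\<mu> n \<Otimes>\<^sub>M \<nu> n)\<bar> \<le> window_mass (\<mu> n) (e n i) * (B0 + 0 * (\<Sum>v\<in>{}. window_mass (\<nu> n) (e n i + v)))"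
      by (rule power_integral_windowed_le[OF \<mu> \<nu> k f])
        (use B0(1) windowed_bounded[OF B0(2)] in \<open>auto simp: mult.commute\<close>)
    also have "\<dots> \<le> (C / real (Suc i)) * B0"
    proof -
      have "window_mass (\<mu> n) (e n i) \<le> C / real (Suc i)"
        using C[of n i] window_mass_nonneg[of "\<nu> n" "e n i"] by simp
      from mult_right_mono[OF this, of B0] show ?thesis using B0(1) by simp
    qed
    finally show ?thesis by (simp add: mult.commute)
  qed
  then show ?thesis by blast
qed

text \<open>In the window of rank j, either the spread is at least R and f is below \<epsilon> / 2,
  or y of the first pair lies in a fixed neighbourhood of the cell, covered by the finite set V of
  windows, where the mass of \<nu> n is of order 1 / (j + 1). The masses of \<mu> n in the windows
  sum to at most 1 over all ranks.\<close>

lemma windowed_tail: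
  assumes "\<epsilon> > 0"
  shows "\<exists>N. \<forall>n J. finite J \<longrightarrow> J \<subseteq> {N..} \<longrightarrow> (\<Sum>j\<in>J. \<bar>power_integral k (windowed (e n j) f) (\<mu> n \<Otimes>\<^sub>M \<nu> n)\<bar>) \<le> \<epsilon>"
proof -
  obtain B0 where B0: "B0 > 0" "\<And>z. z \<in> configs k \<Longrightarrow> \<bar>f z\<bar> \<le> B0" using test_function_bounded[OF f] by blast
  have "\<epsilon> / 2 > 0" using assms by simp
  then obtain R where R: "\<And>z. z \<in> configs k \<Longrightarrow> spread k z \<ge> R \<Longrightarrow> \<bar>f z\<bar> < \<epsilon> / 2"
    using f unfolding test_functions_def mem_Collect_eq by meson
  obtain V :: "(int^'d) set" where V: "finite V" "\<And>y. norm y \<le> R + real CARD('d) \<Longrightarrow> 1 \<le> (\<Sum>v\<in>V. tent (y - lattice_point v))"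
    using exists_window[of "R + real CARD('d)"] by blast
  have le: "\<bar>windowed q f z\<bar> \<le> tent (fst (z 0) - lattice_point q) * (\<epsilon> / 2 + B0 * (\<Sum>v\<in>V. tent (snd (z 0) - lattice_point (q + v))))"
    if z: "z \<in> configs k" for q z
  proof -
    let ?S = "\<Sum>v\<in>V. tent (snd (z 0) - lattice_point (q + v))"
    have S: "0 \<le> ?S" by (rule sum_nonneg) (rule tent_bounds)
    show ?thesis
    proof (cases "tent (fst (z 0) - lattice_point q) = 0")
      case False
      have "\<bar>f z\<bar> \<le> \<epsilon> / 2 + B0 * ?S"
      proof (cases "spread k z \<ge> R")
        case True
        then show ?thesis using R[OF z True] S B0(1) by (smt (verit) mult_nonneg_nonneg)
      next
        case far: False
        have "norm (snd (z 0) - lattice_point q) \<le> norm (fst (z 0) - lattice_point q) + norm (fst (z 0) - snd (z 0))"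
          using norm_triangle_ineq4[of "fst (z 0) - lattice_point q" "fst (z 0) - snd (z 0)"] by simp
        also have "\<dots> \<le> real CARD('d) + R"
          using tent_nonzero_imp_norm[OF False] spread_ge(1)[of 0 k 0 z] k far by simp
        finally have "1 \<le> ?S" using V(2)[of "snd (z 0) - lattice_point q"] by (simp add: lattice_point_add algebra_simps)
        then have "B0 * 1 \<le> B0 * ?S" using B0(1) by (intro mult_left_mono) auto
        then show ?thesis using B0(2)[OF z] assms by simp
      qed
      then show ?thesis
        using windowed_bounded[of f z "\<epsilon> / 2 + B0 * ?S" q] by (simp add: mult.commute)
    qed (simp add: windowed_def)
  qed
  have "\<forall>v\<in>V. \<exists>C. \<forall>n i. window_mass (\<mu> n) (e n i + v) + window_mass (\<nu> n) (e n i + v) \<le> C / real (Suc i)" using small by blast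
  from bchoice[OF this] obtain C where C: "\<And>v n i. v \<in> V \<Longrightarrow> window_mass (\<mu> n) (e n i + v) + window_mass (\<nu> n) (e n i + v) \<le> C v / real (Suc i)" by blast
  define K where "K = \<bar>\<Sum>v\<in>V. C v\<bar>"
  \<comment> \<open>Makes B0 times the mass of \<nu> n near a cell of rank at least N no larger than
    \<epsilon> / 2.\<close>
  obtain N :: nat where N: "real N > 2 * B0 * K / \<epsilon>" using reals_Archimedean2 by blast
  have "(\<Sum>j\<in>J. \<bar>power_integral k (windowed (e n j) f) (\<mu> n \<Otimes>\<^sub>M \<nu> n)\<bar>) \<le> \<epsilon>" if J: "finite J" "J \<subseteq> {N..}" for n J
  proof -
    have "\<bar>power_integral k (windowed (e n j) f) (\<mu> n \<Otimes>\<^sub>M \<nu> n)\<bar> \<le> window_mass (\<mu> n) (e n j) * \<epsilon>" if "j \<in> J" for j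
    proof -
      have jN: "j \<ge> N" using that J by auto
      have "(\<Sum>v\<in>V. window_mass (\<nu> n) (e n j + v)) \<le> (\<Sum>v\<in>V. C v / real (Suc j))"
        using C[of _ n j] window_mass_nonneg[of "\<mu> n"] by (intro sum_mono) (smt (verit))
      also have "\<dots> \<le> K / real (Suc j)" unfolding sum_divide_distrib[symmetric] K_def by (intro divide_right_mono) auto
      finally have 1: "(\<Sum>v\<in>V. window_mass (\<nu> n) (e n j + v)) \<le> K / real (Suc j)" .
      have "real (Suc j) \<ge> 2 * B0 * K / \<epsilon>" using N jN by simp
      then have "B0 * (K / real (Suc j)) \<le> \<epsilon> / 2" using assms by (simp add: field_simps)
      then have "\<epsilon> / 2 + B0 * (\<Sum>v\<in>V. window_mass (\<nu> n) (e n j + v)) \<le> \<epsilon>"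
        using mult_left_mono[OF 1, of B0] B0(1) by linarith
      then have "window_mass (\<mu> n) (e n j) * (\<epsilon> / 2 + B0 * (\<Sum>v\<in>V. window_mass (\<nu> n) (e n j + v))) \<le> window_mass (\<mu> n) (e n j) * \<epsilon>"
        by (intro mult_left_mono window_mass_nonneg)
      moreover have "\<bar>power_integral k (windowed (e n j) f) (\<mu> n \<Otimes>\<^sub>M \<nu> n)\<bar> \<le>
          window_mass (\<mu> n) (e n j) * (\<epsilon> / 2 + B0 * (\<Sum>v\<in>V. window_mass (\<nu> n) (e n j + v)))"
        by (rule power_integral_windowed_le[OF \<mu> \<nu> k f V(1) _ _ le]) (use assms B0 in auto)
      ultimately show ?thesis by linarith
    qed
    then have "(\<Sum>j\<in>J. \<bar>power_integral k (windowed (e n j) f) (\<mu> n \<Otimes>\<^sub>M \<nu> n)\<bar>) \<le> (\<Sum>j\<in>J. window_mass (\<mu> n) (e n j)) * \<epsilon>"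
      unfolding sum_distrib_right by (rule sum_mono)
    also have "(\<Sum>j\<in>J. window_mass (\<mu> n) (e n j)) \<le> 1"
    proof -
      have "inj_on (e n) J" using bij[of n] by (auto simp: bij_def intro: inj_on_subset)
      then have "(\<Sum>j\<in>J. window_mass (\<mu> n) (e n j)) = (\<Sum>q\<in>e n ` J. window_mass (\<mu> n) q)" by (simp add: sum.reindex)
      also have "\<dots> \<le> measure (\<mu> n) UNIV" by (rule sum_window_mass_le[OF prob_measuresD(5)[OF \<mu>]]) (use J in simp)
      also have "\<dots> \<le> 1" by (rule subprob_measuresD(4)[OF prob_measuresD(5)[OF \<mu>]])
      finally show ?thesis .
    qed
    finally show ?thesis using assms by simp
  qed
  then show ?thesis by blast
qed

text \<open>Expanded over windows by rank, the functional is a sum with convergent terms and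
  uniformly small tails. \<open>place_bij\<close> rearranges the limit by representatives and
  displacements; unplaced pairs add only zeros, and summing over all displacements restores the full
  functional of each profile.\<close>

lemma Lambda_tendsto_profiles:
  "(\<lambda>n. power_integral k f (\<mu> n \<Otimes>\<^sub>M \<nu> n)) \<longlonglongrightarrow> Lambda (k, f) (collection_of representatives \<alpha> \<beta>)"
proof -
  define I where "I n j = power_integral k (windowed (e n j) f) (\<mu> n \<Otimes>\<^sub>M \<nu> n)" for n j
  define H where "H = (\<lambda>(i, v). power_integral k (windowed v f) (\<alpha> i \<Otimes>\<^sub>M \<beta> i))"
  have S: "(I n has_sum power_integral k f (\<mu> n \<Otimes>\<^sub>M \<nu> n)) UNIV" for n
  proof -
    note pm = pair_subprob[OF prob_measuresD(5)[OF \<mu>] prob_measuresD(5)[OF \<nu>]]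
    show ?thesis
      using has_sum_windowed[OF pm(1,2) k f] has_sum_reindex_bij_betw[OF bij[of n], of "\<lambda>v. power_integral k (windowed v f) (\<mu> n \<Otimes>\<^sub>M \<nu> n)"]
      by (simp add: I_def[abs_def])
  qed
  have lim: "(\<lambda>n. I n j) \<longlonglongrightarrow> H (j, 0)" for j using windowed_tendsto[of j 0] by (simp add: I_def H_def)
  obtain T where T: "((\<lambda>j. H (j, 0)) has_sum T) UNIV" "(\<lambda>n. power_integral k f (\<mu> n \<Otimes>\<^sub>M \<nu> n)) \<longlonglongrightarrow> T"
    using tight_sums_tendsto[of I, OF S lim windowed_tail[folded I_def]] by blast
  have Hplaced: "H (place p, 0) = H p" if pl: "p \<in> placed" for p
  proof -
    obtain i v where p: "p = (i, v)" by (cases p)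
    obtain j where j: "position (i, v) j" using pl by (auto simp: placed_def p)
    have "\<forall>\<^sub>F n in sequentially. I n j = power_integral k (windowed (e n i + v) f) (\<mu> n \<Otimes>\<^sub>M \<nu> n)"
      using j unfolding position_def I_def by (auto elim: eventually_mono)
    then have "(\<lambda>n. I n j) \<longlonglongrightarrow> H (i, v)"
      using windowed_tendsto[of i v] by (simp add: H_def tendsto_cong)
    then show ?thesis using LIMSEQ_unique[OF lim] place_eq[OF j] p by metis
  qed
  \<comment> \<open>H is the limit of the contributions of windows whose rank tends to infinity, and
    those tend to 0 by \<open>windowed_small\<close>.\<close>
  have H0: "H p = 0" if "p \<in> representatives \<times> UNIV - placed" for p
  proof -
    obtain i v where p: "p = (i, v)" by (cases p)
    have "\<not> (\<exists>j. position (i, v) j)" using that by (auto simp: placed_def p)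
    then have r: "filterlim (\<lambda>n. inv (e n) (e n i + v)) at_top sequentially"
      using dichotomy[of i v] by (auto simp: position_def)
    obtain C where C: "\<And>n i. \<bar>power_integral k (windowed (e n i) f) (\<mu> n \<Otimes>\<^sub>M \<nu> n)\<bar> \<le> C / real (Suc i)" using windowed_small by blast
    have "(\<lambda>m. C * (1 / real (Suc m))) \<longlonglongrightarrow> C * 0" by (intro tendsto_mult tendsto_const LIMSEQ_Suc lim_1_over_n)
    then have z: "(\<lambda>m. C / real (Suc m)) \<longlonglongrightarrow> 0" by simp
    have "(\<lambda>n. C / real (Suc (inv (e n) (e n i + v)))) \<longlonglongrightarrow> 0" by (rule filterlim_compose[OF z r])
    moreover have "\<forall>\<^sub>F n in sequentially. norm (power_integral k (windowed (e n i + v) f) (\<mu> n \<Otimes>\<^sub>M \<nu> n)) \<le> C / real (Suc (inv (e n) (e n i + v)))"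
    proof (rule always_eventually, rule allI)
      fix n
      have "e n (inv (e n) (e n i + v)) = e n i + v" using bij[of n] by (simp add: bij_def surj_f_inv_f)
      then show "norm (power_integral k (windowed (e n i + v) f) (\<mu> n \<Otimes>\<^sub>M \<nu> n)) \<le> C / real (Suc (inv (e n) (e n i + v)))"
        using C[of n "inv (e n) (e n i + v)"] by simp
    qed
    ultimately have "(\<lambda>n. power_integral k (windowed (e n i + v) f) (\<mu> n \<Otimes>\<^sub>M \<nu> n)) \<longlonglongrightarrow> 0"
      by (rule Lim_null_comparison[rotated])
    then show ?thesis using LIMSEQ_unique[OF windowed_tendsto[of i v]] by (simp add: H_def p)
  qed
  have "((\<lambda>p. H (place p, 0)) has_sum T) placed"
    using T(1) has_sum_reindex_bij_betw[OF place_bij, of "\<lambda>j. H (j, 0)" T] by simp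
  then have "(H has_sum T) placed"
    by (rule has_sum_cong[THEN iffD1, rotated]) (rule Hplaced)
  then have HT: "(H has_sum T) (representatives \<times> UNIV)"
    by (rule has_sum_cong_neutral[THEN iffD1, rotated -1]) (use H0 in \<open>auto simp: placed_def\<close>)
  have "((\<lambda>i. power_integral k f (\<alpha> i \<Otimes>\<^sub>M \<beta> i)) has_sum T) representatives"
  proof (rule has_sum_Sigma'[OF HT])
    fix i
    note pm = pair_subprob[OF \<alpha>_subprob[of i] \<beta>_subprob[of i]]
    show "((\<lambda>v. H (i, v)) has_sum power_integral k f (\<alpha> i \<Otimes>\<^sub>M \<beta> i)) UNIV"
      using has_sum_windowed[OF pm(1,2) k f] by (simp add: H_def)
  qed
  then have "Lambda (k, f) (collection_of representatives \<alpha> \<beta>) = T"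
    by (simp add: Lambda_collection_of[OF representatives_family k f] infsumI)
  then show ?thesis using T(2) by simp
qed

end

end

section \<open>Choice of the subsequence\<close>

text \<open>The inverses of positive integers accumulate only at 0. If r does not tend to infinity,
  it is infinitely often below some M, so the limit is close to an isolated point of this set and
  the sequence must stay there.\<close>

lemma inverse_Suc_convergent_cases:
  fixes r :: "nat \<Rightarrow> nat"
  assumes "(\<lambda>n. 1 / real (Suc (r n))) \<longlonglongrightarrow> l"
  shows "(\<exists>j. \<forall>\<^sub>F n in sequentially. r n = j) \<or> filterlim r at_top sequentially"
proof (cases "filterlim r at_top sequentially")
  case False
  then obtain M where "\<not> (\<forall>\<^sub>F n in sequentially. M \<le> r n)" by (auto simp: filterlim_at_top)
  then have fr: "\<exists>\<^sub>F n in sequentially. r n < M" by (simp add: frequently_def not_less)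
  \<comment> \<open>Two values within \<delta> of the limit differ by less than 2 \<delta>, and 2
    \<delta> does not exceed the distance from 1 / y to any other inverse integer when y \<le>
    M.\<close>
  define \<delta> where "\<delta> = 1 / (4 * real (Suc M) * real (Suc M))"
  have \<delta>: "\<delta> > 0" by (simp add: \<delta>_def)
  have ev: "\<forall>\<^sub>F n in sequentially. \<bar>1 / real (Suc (r n)) - l\<bar> < \<delta>"
    using tendstoD[OF assms \<delta>] by (simp add: dist_real_def)
  from frequently_eventually_conj[OF fr ev] obtain n0 where n0: "r n0 < M" "\<bar>1 / real (Suc (r n0)) - l\<bar> < \<delta>"
    using frequently_ex by fastforce
  have "\<forall>\<^sub>F n in sequentially. r n = r n0"
    using ev
  proof eventually_elim
    case (elim n)
    define x y where "x = real (Suc (r n))" and "y = real (Suc (r n0))"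
    have xy: "x \<ge> 1" "y \<ge> 1" "y \<le> real M" using n0(1) by (auto simp: x_def y_def)
    have d: "\<bar>1 / x - 1 / y\<bar> < 2 * \<delta>" using elim n0(2) unfolding x_def y_def by linarith
    have "2 * \<delta> \<le> 1 / (2 * y * y)"
    proof -
      have "y * y \<le> real (Suc M) * real (Suc M)" using xy by (intro mult_mono) auto
      then have "1 / (2 * (real (Suc M) * real (Suc M))) \<le> 1 / (2 * (y * y))"
        using xy by (intro divide_left_mono) auto
      moreover have "2 * \<delta> = 1 / (2 * (real (Suc M) * real (Suc M)))"
        unfolding \<delta>_def by (simp only: mult.assoc) (simp add: field_simps del: of_nat_Suc)
      ultimately show ?thesis by (simp only: mult.assoc)
    qed
    then have "\<bar>1 / x - 1 / y\<bar> < 1 / (2 * y * y)" using d by linarith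
    moreover have "1 / x - 1 / y = (y - x) / (x * y)" using xy by (simp add: field_simps)
    ultimately have "\<bar>y - x\<bar> / (x * y) < 1 / (2 * y * y)" using xy by (simp add: abs_mult)
    then have lt: "\<bar>y - x\<bar> * (2 * y) < x" using xy by (simp add: field_simps)
    show ?case
    proof (rule ccontr)
      assume "r n \<noteq> r n0"
      then have "\<bar>y - x\<bar> \<ge> 1" unfolding x_def y_def by linarith
      then have "1 * y \<le> \<bar>y - x\<bar> * y" "\<bar>y - x\<bar> * 1 \<le> \<bar>y - x\<bar> * y"
        using xy by (intro mult_right_mono mult_left_mono; simp)+
      moreover define t where "t = \<bar>y - x\<bar> * y"
      moreover have "2 * t < x" using lt by (simp add: t_def mult.left_commute)
      moreover have "x \<le> y + \<bar>y - x\<bar>" by linarith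
      ultimately show False by simp
    qed
  qed
  then show ?thesis by blast
qed simp

text \<open>The data of \<open>profile_decomposition\<close> involve countably many limits: the
  vague limits seen from each rank, and the fate of the rank of each displaced cell. Each can be
  arranged along a subsequence, and a diagonal sequence arranges all of them.\<close>

theorem exists_convergent_subsequence:
  fixes \<mu> \<nu> :: "nat \<Rightarrow> (real^'d::finite) measure"
  assumes \<mu>: "\<And>n. \<mu> n \<in> prob_measures" and \<nu>: "\<And>n. \<nu> n \<in> prob_measures"
  shows "\<exists>s R \<alpha> \<beta>. strict_mono (s :: nat \<Rightarrow> nat) \<and> subprob_family R \<alpha> \<beta> \<and>
    (\<forall>k f. k \<ge> 1 \<longrightarrow> f \<in> test_functions k \<longrightarrow>
      (\<lambda>n. power_integral k f (\<mu> (s n) \<Otimes>\<^sub>M \<nu> (s n))) \<longlonglongrightarrow> Lambda (k, f) (collection_of R \<alpha> \<beta>))"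
proof -
  have "\<exists>e :: nat \<Rightarrow> int^'d. bij e \<and> (\<forall>i v. window_mass (\<mu> n) (e i + v) + window_mass (\<nu> n) (e i + v) \<le> 3 * 2 ^ Suc (to_nat v) / real (Suc i))" for n
  proof (rule exists_lattice_enumeration[OF infinite_UNIV_lattice])
    fix Q :: "(int^'d) set" assume Q: "finite Q"
    have "(\<Sum>q\<in>Q. window_mass (\<kappa> n) q) \<le> 1" if "\<And>n. \<kappa> n \<in> prob_measures" for \<kappa> :: "nat \<Rightarrow> (real^'d) measure"
      using sum_window_mass_le[OF prob_measuresD(5)[OF that[of n]] Q] subprob_measuresD(4)[OF prob_measuresD(5)[OF that[of n]]] by linarith
    from this[of \<mu>, OF \<mu>] this[of \<nu>, OF \<nu>]
    show "(\<Sum>q\<in>Q. window_mass (\<mu> n) q + window_mass (\<nu> n) q) \<le> 2" by (simp add: sum.distrib)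
  qed (simp add: window_mass_nonneg)
  then obtain e :: "nat \<Rightarrow> nat \<Rightarrow> int^'d" where e: "\<And>n. bij (e n)"
    "\<And>n i v. window_mass (\<mu> n) (e n i + v) + window_mass (\<nu> n) (e n i + v) \<le> 3 * 2 ^ Suc (to_nat v) / real (Suc i)" by metis
  define tr where "tr \<kappa> i n = distr (translate (- lattice_point (e n i)) (\<kappa> n)) borel code" for \<kappa> :: "nat \<Rightarrow> (real^'d) measure" and i n
  \<comment> \<open>Inverse ranks are bounded, so they converge along a subsequence even if the
    ranks do not; \<open>inverse_Suc_convergent_cases\<close> turns this into the dichotomy.\<close>
  define rk where "rk m n = (case from_nat m of (i, v) \<Rightarrow> 1 / real (Suc (inv (e n) (e n i + v))))" for m n
  define wc where "wc M \<longleftrightarrow> (\<exists>K. real_distribution K \<and> weak_conv_m M K)" for M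
  \<comment> \<open>The index m plays two parts: a rank for the recentred measures, and the code of
    a pair (i, v) for the displaced ranks.\<close>
  define P where "P m s \<longleftrightarrow> convergent (\<lambda>n. rk m (s n)) \<and> wc (\<lambda>n. tr \<mu> m (s n)) \<and> wc (\<lambda>n. tr \<nu> m (s n))" for m and s :: "nat \<Rightarrow> nat"
  have wc_sub: "wc (\<lambda>n. M (r n))" if r: "strict_mono r" and wcM: "wc M" for M and r :: "nat \<Rightarrow> nat"
  proof -
    obtain K where "real_distribution K" "weak_conv_m M K" using wcM by (auto simp: wc_def)
    then have "weak_conv_m (\<lambda>n. M (r n)) K"
      using LIMSEQ_subseq_LIMSEQ[OF _ r] by (auto simp: weak_conv_m_def weak_conv_def o_def)
    then show ?thesis using \<open>real_distribution K\<close> by (auto simp: wc_def)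
  qed
  have helly: "\<exists>r. strict_mono r \<and> wc (\<lambda>n. tr \<kappa> m (s (r n)))" if "\<And>n. \<kappa> n \<in> prob_measures" for \<kappa> m and s :: "nat \<Rightarrow> nat"
    using code_helly[of "\<lambda>n. translate (- lattice_point (e (s n) m)) (\<kappa> (s n))", OF translate_prob[OF that]]
    by (auto simp: tr_def wc_def)
  have "\<exists>s. strict_mono s \<and> (\<forall>m. P m s)"
  proof (rule diagonal_subsequence)
    fix m and s :: "nat \<Rightarrow> nat" assume "strict_mono s"
    obtain r1 where r1: "strict_mono r1" "wc (\<lambda>n. tr \<mu> m (s (r1 n)))" using helly[of \<mu> m s, OF \<mu>] by blast
    obtain r2 where r2: "strict_mono r2" "wc (\<lambda>n. tr \<nu> m (s (r1 (r2 n))))" using helly[of \<nu> m "\<lambda>n. s (r1 n)", OF \<nu>] by blast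
    have "bounded (range (\<lambda>n. rk m (s (r1 (r2 n)))))"
      by (rule boundedI[of _ 1]) (auto simp: rk_def split: prod.splits)
    then obtain l r3 where r3: "strict_mono (r3 :: nat \<Rightarrow> nat)" "((\<lambda>n. rk m (s (r1 (r2 n)))) \<circ> r3) \<longlonglongrightarrow> l"
      using bounded_imp_convergent_subsequence by blast
    let ?r = "\<lambda>n. r1 (r2 (r3 n))"
    have "strict_mono ?r" using r1(1) r2(1) r3(1) by (simp add: strict_mono_def)
    moreover have "wc (\<lambda>n. tr \<mu> m (s (?r n)))"
      using wc_sub[of "\<lambda>n. r2 (r3 n)", OF _ r1(2)] r2(1) r3(1) by (simp add: strict_mono_def)
    moreover have "wc (\<lambda>n. tr \<nu> m (s (?r n)))" using wc_sub[OF r3(1) r2(2)] .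
    moreover have "convergent (\<lambda>n. rk m (s (?r n)))" using r3(2) by (auto simp: convergent_def o_def)
    ultimately show "\<exists>r. strict_mono r \<and> P m (s \<circ> r)" by (intro exI[of _ ?r]) (simp add: P_def)
  next
    fix m s and r :: "nat \<Rightarrow> nat" assume r: "strict_mono r" and P: "P m s"
    then show "P m (s \<circ> r)"
      using convergent_subseq_convergent[of "\<lambda>n. rk m (s n)" r] wc_sub[OF r] by (auto simp: P_def o_def)
  next
    fix m s and d :: nat assume P: "P m (s \<circ> (+) d)"
    have shift: "wc M" if "wc (\<lambda>n. M (d + n))" for M
    proof -
      from that obtain K where K: "real_distribution K" "weak_conv_m (\<lambda>n. M (d + n)) K" by (auto simp: wc_def)
      have "(\<lambda>n. cdf (M n) x) \<longlonglongrightarrow> cdf K x" if "isCont (cdf K) x" for x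
        by (rule LIMSEQ_offset[where k=d])
          (use K(2) that in \<open>simp add: weak_conv_m_def weak_conv_def add.commute\<close>)
      then show ?thesis using K(1) by (auto simp: wc_def weak_conv_m_def weak_conv_def)
    qed
    show "P m s"
      using P shift[of "\<lambda>n. tr \<mu> m (s n)"] shift[of "\<lambda>n. tr \<nu> m (s n)"] convergent_ignore_initial_segment[of "\<lambda>n. rk m (s n)" d]
      by (auto simp: P_def o_def add.commute[of d])
  qed
  then obtain s where s: "strict_mono s" "\<And>m. P m s" by blast
  have ex: "\<exists>\<Omega> A Xs X. vague_coupling (\<lambda>n. translate (- lattice_point (e (s n) i)) (\<kappa> (s n))) \<Omega> A Xs X"
    if "\<And>n. \<kappa> n \<in> prob_measures" "wc (\<lambda>n. tr \<kappa> i (s n))" for \<kappa> :: "nat \<Rightarrow> (real^'d) measure" and i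
    using that(2) unfolding wc_def tr_def by (auto intro: exists_vague_coupling translate_prob that(1))
  have "\<forall>i::nat. \<exists>\<Omega> A Xs X. vague_coupling (\<lambda>n. translate (- lattice_point (e (s n) i)) (\<mu> (s n))) \<Omega> A Xs X"
    using ex[of \<mu>, OF \<mu>] s(2) by (auto simp: P_def)
  then obtain \<Omega> A Xs X where 1: "\<And>i::nat. vague_coupling (\<lambda>n. translate (- lattice_point (e (s n) i)) (\<mu> (s n))) (\<Omega> i) (A i) (Xs i) (X i)"
    by metis
  have "\<forall>i::nat. \<exists>\<Omega> A Xs X. vague_coupling (\<lambda>n. translate (- lattice_point (e (s n) i)) (\<nu> (s n))) \<Omega> A Xs X"
    using ex[of \<nu>, OF \<nu>] s(2) by (auto simp: P_def)
  then obtain \<Omega>' B Ys Y where 2: "\<And>i::nat. vague_coupling (\<lambda>n. translate (- lattice_point (e (s n) i)) (\<nu> (s n))) (\<Omega>' i) (B i) (Ys i) (Y i)"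
    by metis
  interpret profile_decomposition "\<lambda>n. \<mu> (s n)" "\<lambda>n. \<nu> (s n)" "\<lambda>n. e (s n)" \<Omega> \<Omega>' A B Xs Ys X Y
  proof
    fix i :: nat and v :: "int^'d"
    have "convergent (\<lambda>n. rk (to_nat (i, v)) (s n))" using s(2) by (simp add: P_def)
    then obtain l where "(\<lambda>n. 1 / real (Suc (inv (e (s n)) (e (s n) i + v)))) \<longlonglongrightarrow> l" by (auto simp: convergent_def rk_def)
    from inverse_Suc_convergent_cases[OF this]
    show "(\<exists>j. \<forall>\<^sub>F n in sequentially. e (s n) j = e (s n) i + v) \<or> filterlim (\<lambda>n. inv (e (s n)) (e (s n) i + v)) at_top sequentially"
    proof (elim disjE exE)
      fix j assume "\<forall>\<^sub>F n in sequentially. inv (e (s n)) (e (s n) i + v) = j"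
      then have "\<forall>\<^sub>F n in sequentially. e (s n) j = e (s n) i + v"
        by eventually_elim (metis e(1) bij_inv_eq_iff)
      then show ?thesis by blast
    qed simp
  qed (use \<mu> \<nu> e 1 2 in blast)+
  show ?thesis using s(1) representatives_family Lambda_tendsto_profiles by blast
qed

section \<open>Density of the orbits of probability measures\<close>

text \<open>The disjoint union of the pieces a l: the label keeps them apart, so that one map can
  move each piece separately and restriction to a label recovers it.\<close>

lemma exists_labelled_measure:
  fixes a :: "nat \<Rightarrow> (real^'d::finite) measure"
  assumes a: "\<And>l. a l \<in> subprob_measures" and sum: "(\<lambda>l. measure (a l) UNIV) sums 1"
  shows "\<exists>N. prob_space N \<and> sets N = sets (borel \<Otimes>\<^sub>M count_space (UNIV :: nat set)) \<and>
    (\<forall>l. distr (density N (indicator (UNIV \<times> {l}))) borel fst = a l)"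
proof -
  let ?S = "(borel :: (real^'d) measure) \<Otimes>\<^sub>M count_space (UNIV :: nat set)"
  define K where "K l = distr (a l) ?S (\<lambda>x. (x, l))" for l
  have as[measurable_cong]: "sets (a l) = sets borel" for l by (rule subprob_measuresD(2)[OF a])
  have asp: "space (a l) = UNIV" for l by (rule subprob_measuresD(3)[OF a])
  have m[measurable]: "(\<lambda>x. (x, l)) \<in> measurable (a l) ?S" for l by measurable
  have "subprob_space (K l)" for l
    unfolding K_def
    by (rule subprob_space.subprob_space_distr[OF _ m]) (use a[of l] in \<open>auto simp: subprob_measures_def space_pair_measure\<close>)
  then have K: "K \<in> measurable (count_space UNIV) (subprob_algebra ?S)"
    by (auto simp: space_subprob_algebra K_def)
  define N where "N = count_space UNIV \<bind> K"
  have sN: "sets N = sets ?S" unfolding N_def by (rule sets_bind) (auto simp: K_def)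
  have spN: "space N = UNIV" using sets_eq_imp_space_eq[OF sN] by (simp add: space_pair_measure)
  have em: "emeasure N U = (\<integral>\<^sup>+l. emeasure (a l) {x. (x, l) \<in> U} \<partial>count_space UNIV)" if U: "U \<in> sets ?S" for U
  proof -
    have "emeasure N U = (\<integral>\<^sup>+l. emeasure (K l) U \<partial>count_space UNIV)"
      unfolding N_def by (rule emeasure_bind[OF _ K U]) simp
    also have "\<dots> = (\<integral>\<^sup>+l. emeasure (a l) {x. (x, l) \<in> U} \<partial>count_space UNIV)"
      by (rule nn_integral_cong) (use U in \<open>simp add: K_def emeasure_distr asp vimage_def\<close>)
    finally show ?thesis .
  qed
  have "emeasure N (space N) = (\<integral>\<^sup>+l. ennreal (measure (a l) UNIV) \<partial>count_space UNIV)"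
    using em[of UNIV] sets.top[of ?S] by (simp add: spN space_pair_measure finite_measure.emeasure_eq_measure[OF subprob_measuresD(1)[OF a]])
  also have "\<dots> = (\<Sum>l. ennreal (measure (a l) UNIV))" by (rule nn_integral_count_space_nat)
  also have "\<dots> = ennreal (\<Sum>l. measure (a l) UNIV)"
    by (rule suminf_ennreal2) (use sum in \<open>auto simp: sums_iff\<close>)
  also have "\<dots> = 1" using sum by (simp add: sums_iff)
  finally have "prob_space N" by (rule prob_spaceI)
  moreover have "distr (density N (indicator (UNIV \<times> {l}))) borel fst = a l" for l
  proof (rule measure_eqI)
    fix U assume "U \<in> sets (distr (density N (indicator (UNIV \<times> {l}))) borel fst)"
    then have U[measurable]: "U \<in> sets borel" by simp
    have fst: "fst \<in> measurable N borel" using measurable_fst[of borel "count_space UNIV"] measurable_cong_sets[OF sN refl] by blast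
    have Ul: "U \<times> {l} \<in> sets ?S" by (intro pair_measureI) auto
    have "emeasure (distr (density N (indicator (UNIV \<times> {l}))) borel fst) U = emeasure N ((UNIV \<times> {l}) \<inter> (fst -` U \<inter> space N))"
      by (rule emeasure_distr_density[OF _ fst U]) (auto simp: sN intro!: pair_measureI)
    also have "(UNIV \<times> {l}) \<inter> (fst -` U \<inter> space N) = U \<times> {l}" by (auto simp: spN)
    also have "emeasure N (U \<times> {l}) = (\<integral>\<^sup>+l'. emeasure (a l') {x. (x, l') \<in> U \<times> {l}} \<partial>count_space UNIV)" by (rule em[OF Ul])
    also have "\<dots> = (\<integral>\<^sup>+l'. emeasure (a l) U * indicator {l} l' \<partial>count_space UNIV)"
      by (rule nn_integral_cong) (auto simp: indicator_def)
    also have "\<dots> = emeasure (a l) U"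
      by (subst nn_integral_cmult) (auto simp: one_ennreal_def[symmetric])
    finally show "emeasure (distr (density N (indicator (UNIV \<times> {l}))) borel fst) U = emeasure (a l) U" .
  qed (simp add: as)
  ultimately show ?thesis using sN by blast
qed

text \<open>Piece l is moved by n l u. A configuration whose labels all agree is translated
  diagonally, which f does not see; in any other the spread grows at least like n minus a constant
  and f tends to 0. Dominated convergence on the fixed labelled space leaves the sum over common
  labels.\<close>

lemma labelled_shift_tendsto:
  fixes a b :: "nat \<Rightarrow> (real^'d::finite) measure"
  assumes N: "prob_space N" "sets N = sets (borel \<Otimes>\<^sub>M count_space (UNIV :: nat set))"
    and N': "prob_space N'" "sets N' = sets (borel \<Otimes>\<^sub>M count_space (UNIV :: nat set))"
    and a: "\<And>l. distr (density N (indicator (UNIV \<times> {l}))) borel fst = a l"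
    and b: "\<And>l. distr (density N' (indicator (UNIV \<times> {l}))) borel fst = b l"
    and fam: "subprob_family UNIV a b" and k: "k \<ge> 1" and f: "f \<in> test_functions k" and u: "norm u = 1"
  defines "\<sigma> \<equiv> \<lambda>n (x, l). x + (real n * real l) *\<^sub>R u"
  shows "(\<lambda>n. power_integral k f (distr N borel (\<sigma> n) \<Otimes>\<^sub>M distr N' borel (\<sigma> n))) \<longlonglongrightarrow> (\<Sum>\<^sub>\<infinity>l. power_integral k f (a l \<Otimes>\<^sub>M b l))"
proof -
  note [measurable_cong] = N(2) N'(2)
  let ?Q = "N \<Otimes>\<^sub>M N'"
  let ?P = "PiM {..<k} (\<lambda>_::nat. ?Q)"
  interpret pp: pair_prob_space N N' using N N' by (simp add: pair_prob_space_def pair_sigma_finite_def prob_space_imp_sigma_finite)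
  have fin: "finite_measure N" "finite_measure N'" "finite_measure ?Q"
    using N(1) N'(1) by (auto intro: prob_space.finite_measure pp.P.finite_measure_axioms)
  interpret P: finite_measure ?P by (rule finite_measure_PiM_const[OF fin(3)])
  have sp: "space N = UNIV" "space N' = UNIV"
    using sets_eq_imp_space_eq[OF N(2)] sets_eq_imp_space_eq[OF N'(2)] by (simp_all add: space_pair_measure)
  have [measurable]: "\<sigma> n \<in> measurable (borel \<Otimes>\<^sub>M count_space UNIV) borel" for n unfolding \<sigma>_def by measurable
  have sm[measurable]: "\<sigma> n \<in> measurable N borel" "\<sigma> n \<in> measurable N' borel" for n by measurable
  have fm[measurable]: "fst \<in> measurable N borel" "fst \<in> measurable N' borel" by measurable
  have lN: "UNIV \<times> {l} \<in> sets N" "UNIV \<times> {l} \<in> sets N'" for l :: nat by (auto simp: N N' intro!: pair_measureI)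
  define Z where "Z n = (\<lambda>(p, q). (\<sigma> n p, \<sigma> n q))" for n
  define Z0 :: "((real^'d) \<times> nat) \<times> ((real^'d) \<times> nat) \<Rightarrow> 'd pt" where "Z0 = (\<lambda>(p, q). (fst p, fst q))"
  define E :: "nat \<Rightarrow> (((real^'d) \<times> nat) \<times> ((real^'d) \<times> nat)) set" where "E l = (UNIV \<times> {l}) \<times> (UNIV \<times> {l}) " for l :: nat
  have EQ: "E l \<in> sets ?Q" for l unfolding E_def by (intro pair_measureI lN)
  have Zm[measurable]: "Z n \<in> borel_measurable ?Q" for n unfolding Z_def borel_prod[symmetric] by measurable
  have Z0m[measurable]: "Z0 \<in> borel_measurable ?Q" unfolding Z0_def borel_prod[symmetric] by measurable
  have fmeas: "f \<in> borel_measurable (PiM {..<k} (\<lambda>_. borel))" by (rule test_function_measurable[OF f])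
  obtain B where B: "B > 0" "\<And>z. z \<in> configs k \<Longrightarrow> \<bar>f z\<bar> \<le> B" using test_function_bounded[OF f] by blast
  have cfg: "(\<lambda>i\<in>{..<k}. z i) \<in> configs k" for z :: "'d config" by (simp add: configs_def)
  have m: "(\<lambda>w. f (\<lambda>i\<in>{..<k}. W (w i))) \<in> borel_measurable ?P" if [measurable]: "W \<in> borel_measurable ?Q" for W
    by (rule measurable_compose[OF measurable_restrict fmeas]) measurable
  have eqn: "power_integral k f (distr N borel (\<sigma> n) \<Otimes>\<^sub>M distr N' borel (\<sigma> n)) = (\<integral>w. f (\<lambda>i\<in>{..<k}. Z n (w i)) \<partial>?P)" for n
  proof -
    have "distr (density N (indicator (space N))) borel (\<sigma> n) \<Otimes>\<^sub>M distr (density N' (indicator (space N'))) borel (\<sigma> n)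
      = distr (density ?Q (indicator (space N \<times> space N'))) (borel \<Otimes>\<^sub>M borel) (\<lambda>(p, q). (\<sigma> n p, \<sigma> n q))"
      by (rule pair_distr_density[OF fin(1,2) sets.top sets.top sm])
    then have "distr N borel (\<sigma> n) \<Otimes>\<^sub>M distr N' borel (\<sigma> n) = distr (density ?Q (indicator (space ?Q))) borel (Z n)"
      by (simp add: density_indicator_space space_pair_measure[symmetric] borel_prod Z_def)
    then show ?thesis
      unfolding power_integral_def
      by (simp only:) (subst integral_PiM_distr_density[OF fin(3) _ Zm _ fmeas],
          auto intro!: Bochner_Integration.integral_cong simp: space_PiM prod_indicator_eq PiE_iff)
  qed
  define G where "G l w = (\<Prod>i<k. indicator (E l) (w i)) * f (\<lambda>i\<in>{..<k}. Z0 (w i))" for l w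
  have eql: "power_integral k f (a l \<Otimes>\<^sub>M b l) = (\<integral>w. G l w \<partial>?P)" for l
  proof -
    have "a l \<Otimes>\<^sub>M b l = distr (density ?Q (indicator (E l))) borel Z0"
      unfolding a[symmetric] b[symmetric] E_def Z0_def borel_prod[symmetric]
      by (rule pair_distr_density[OF fin(1,2) lN fm])
    then show ?thesis
      unfolding power_integral_def G_def by (simp only:) (rule integral_PiM_distr_density[OF fin(3) EQ Z0m _ fmeas], simp)
  qed
  have Gm: "G l \<in> borel_measurable ?P" for l
  proof -
    have [measurable]: "(\<lambda>w. \<Prod>i<k. indicator (E l) (w i) :: real) \<in> borel_measurable ?P"
      using EQ[of l] by (intro borel_measurable_prod) simp
    show ?thesis unfolding G_def using m[OF Z0m] by measurable
  qed
  have G_eq: "G l w = (if \<forall>i<k. w i \<in> E l then f (\<lambda>i\<in>{..<k}. Z0 (w i)) else 0)" for l w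
    unfolding G_def by (subst prod_indicator_eq) (auto simp: indicator_def)
  \<comment> \<open>The label of x in the first pair; it is the only l for which
    \<open>G l w\<close> can be nonzero, so the sum over labels has a single term.\<close>
  define lab where "lab w = snd (fst (w 0))" for w :: "nat \<Rightarrow> ((real^'d) \<times> nat) \<times> ((real^'d) \<times> nat)"
  have G_0: "G l w = 0" if "l \<noteq> lab w" for l w
    using that k by (auto simp: G_eq lab_def E_def mem_Times_iff)
  have Gsum: "(\<Sum>l<n. G l w) = (if lab w < n then G (lab w) w else 0)" for n w
  proof -
    have "(\<Sum>l<n. G l w) = (\<Sum>l<n. if l = lab w then G (lab w) w else 0)"
      by (rule sum.cong) (use G_0 in auto)
    then show ?thesis by simp
  qed
  have Gb: "\<bar>G l w\<bar> \<le> B" for l w using B(2)[OF cfg] B(1) by (simp add: G_eq)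
  have Gint: "integrable ?P (G l)" for l
    by (rule P.integrable_const_bound[OF _ Gm, of _ B]) (use Gb in auto)
  have Glim: "(\<lambda>n. \<Sum>l<n. G l w) \<longlonglongrightarrow> G (lab w) w" for w
    by (rule tendsto_eventually, rule eventually_sequentiallyI[of "Suc (lab w)"]) (simp add: Gsum)
  have GLm: "(\<lambda>w. G (lab w) w) \<in> borel_measurable ?P"
  proof (rule borel_measurable_LIMSEQ_real)
    show "(\<lambda>n. \<Sum>l<n. G l w) \<longlonglongrightarrow> G (lab w) w" for w by (rule Glim)
    show "(\<lambda>w. \<Sum>l<n. G l w) \<in> borel_measurable ?P" for n using Gm by measurable
  qed
  have "(\<lambda>n. \<integral>w. (\<Sum>l<n. G l w) \<partial>?P) \<longlonglongrightarrow> (\<integral>w. G (lab w) w \<partial>?P)"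
  proof (rule integral_dominated_convergence[where w="\<lambda>_. B", OF GLm])
    show "(\<lambda>w. \<Sum>l<n. G l w) \<in> borel_measurable ?P" for n using Gm by measurable
    show "AE w in ?P. (\<lambda>n. \<Sum>l<n. G l w) \<longlonglongrightarrow> G (lab w) w"
      by (intro AE_I2 Glim)
    show "AE w in ?P. norm (\<Sum>l<n. G l w) \<le> B" for n
      using Gb B(1) by (intro AE_I2) (simp add: Gsum)
  qed simp
  then have "(\<lambda>l. power_integral k f (a l \<Otimes>\<^sub>M b l)) sums (\<integral>w. G (lab w) w \<partial>?P)"
    unfolding sums_def eql by (simp add: Bochner_Integration.integral_sum[OF Gint])
  moreover have "(\<lambda>l. power_integral k f (a l \<Otimes>\<^sub>M b l)) sums (\<Sum>\<^sub>\<infinity>l. power_integral k f (a l \<Otimes>\<^sub>M b l))"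
    by (rule has_sum_imp_sums[OF has_sum_infsum]) (rule summable_on_power_integral_family(1)[OF fam k less_imp_le[OF B(1)] B(2)])
  ultimately have lim: "(\<Sum>\<^sub>\<infinity>l. power_integral k f (a l \<Otimes>\<^sub>M b l)) = (\<integral>w. G (lab w) w \<partial>?P)" using sums_unique2 by blast
  have inv: "f (\<lambda>i\<in>{..<k}. (fst (z i) + c, snd (z i) + c)) = f z" if "z \<in> configs k" for z c
    using f that unfolding test_functions_def mem_Collect_eq by blast
  show ?thesis
    unfolding eqn lim
  proof (rule integral_dominated_convergence[where w="\<lambda>_. B", OF GLm m[OF Zm]])
    show "AE w in ?P. norm (f (\<lambda>i\<in>{..<k}. Z n (w i))) \<le> B" for n using B(2)[OF cfg] by simp
    show "AE w in ?P. (\<lambda>n. f (\<lambda>i\<in>{..<k}. Z n (w i))) \<longlonglongrightarrow> G (lab w) w"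
    proof (rule AE_I2)
      fix w assume "w \<in> space ?P"
      show "(\<lambda>n. f (\<lambda>i\<in>{..<k}. Z n (w i))) \<longlonglongrightarrow> G (lab w) w"
      proof (cases "\<forall>i<k. w i \<in> E (lab w)")
        case True
        have "f (\<lambda>i\<in>{..<k}. Z n (w i)) = G (lab w) w" for n
        proof -
          let ?z = "\<lambda>i\<in>{..<k}. Z0 (w i)" and ?c = "(real n * real (lab w)) *\<^sub>R u"
          have "(\<lambda>i\<in>{..<k}. Z n (w i)) = (\<lambda>i\<in>{..<k}. (fst (?z i) + ?c, snd (?z i) + ?c))"
            using True by (auto simp: fun_eq_iff Z_def Z0_def \<sigma>_def E_def case_prod_unfold mem_Times_iff)
          then show ?thesis using inv[OF cfg, of "\<lambda>i. Z0 (w i)" ?c] True by (simp add: G_eq)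
        qed
        then show ?thesis by simp
      next
        case False
        then obtain i where i: "i < k" "w i \<notin> E (lab w)" by blast
        \<comment> \<open>The displacements of two different labels differ by at least n, because u
          is a unit vector.\<close>
        have far: "norm ((x + (real n * real l) *\<^sub>R u) - (y + (real n * real l') *\<^sub>R u)) \<ge> real n - norm (x - y)" if "l \<noteq> l'" for x y :: "real^'d" and l l' n :: nat
        proof -
          have "(x + (real n * real l) *\<^sub>R u) - (y + (real n * real l') *\<^sub>R u) = (real n * (real l - real l')) *\<^sub>R u - (y - x)"
            by (simp add: algebra_simps)
          then have "norm ((x + (real n * real l) *\<^sub>R u) - (y + (real n * real l') *\<^sub>R u)) \<ge> norm ((real n * (real l - real l')) *\<^sub>R u) - norm (y - x)"
            by (simp only: norm_triangle_ineq2)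
          moreover have "\<bar>real l - real l'\<bar> \<ge> 1" using that by linarith
          then have "norm ((real n * (real l - real l')) *\<^sub>R u) \<ge> real n"
            using mult_left_mono[of 1 "\<bar>real l - real l'\<bar>" "real n"] by (simp add: u abs_mult)
          ultimately show ?thesis by (simp add: norm_minus_commute)
        qed
        have "\<exists>C. \<forall>n. spread k (\<lambda>i\<in>{..<k}. Z n (w i)) \<ge> real n - C"
        \<comment> \<open>A pair outside \<open>E (lab w)\<close> has a wrong label in its x or in
          its y; either way that point moves away from x of the first pair.\<close>
        proof (cases "snd (fst (w i)) = lab w")
          case True
          then have ne: "snd (fst (w 0)) \<noteq> snd (snd (w i))" using i(2) by (auto simp: E_def mem_Times_iff lab_def)
          show ?thesis
          proof (intro exI allI)
            fix n
            have "real n - norm (fst (fst (w 0)) - fst (snd (w i))) \<le> norm (fst (Z n (w 0)) - snd (Z n (w i)))"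
              using far[OF ne] by (simp add: Z_def \<sigma>_def case_prod_unfold)
            also have "\<dots> \<le> spread k (\<lambda>i\<in>{..<k}. Z n (w i))"
              using spread_ge(1)[of 0 k i "\<lambda>i\<in>{..<k}. Z n (w i)"] i(1) k by simp
            finally show "real n - norm (fst (fst (w 0)) - fst (snd (w i))) \<le> spread k (\<lambda>i\<in>{..<k}. Z n (w i))" .
          qed
        next
          case False
          then have ne: "snd (fst (w 0)) \<noteq> snd (fst (w i))" by (simp add: lab_def)
          show ?thesis
          proof (intro exI allI)
            fix n
            have "real n - norm (fst (fst (w 0)) - fst (fst (w i))) \<le> norm (fst (Z n (w 0)) - fst (Z n (w i)))"
              using far[OF ne] by (simp add: Z_def \<sigma>_def case_prod_unfold)
            also have "\<dots> \<le> spread k (\<lambda>i\<in>{..<k}. Z n (w i))"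
              using spread_ge(2)[of 0 k i "\<lambda>i\<in>{..<k}. Z n (w i)"] i(1) k by simp
            finally show "real n - norm (fst (fst (w 0)) - fst (fst (w i))) \<le> spread k (\<lambda>i\<in>{..<k}. Z n (w i))" .
          qed
        qed
        then obtain C where C: "\<And>n. spread k (\<lambda>i\<in>{..<k}. Z n (w i)) \<ge> real n - C" by blast
        have "(\<lambda>n. f (\<lambda>i\<in>{..<k}. Z n (w i))) \<longlonglongrightarrow> 0"
        proof (rule tendstoI)
          fix \<epsilon> :: real assume "\<epsilon> > 0"
          then obtain R where R: "\<And>z. z \<in> configs k \<Longrightarrow> spread k z \<ge> R \<Longrightarrow> \<bar>f z\<bar> < \<epsilon>"
            using f unfolding test_functions_def mem_Collect_eq by meson
          obtain n0 :: nat where n0: "real n0 \<ge> R + C" using real_arch_simple by blast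
          show "\<forall>\<^sub>F n in sequentially. dist (f (\<lambda>i\<in>{..<k}. Z n (w i))) 0 < \<epsilon>"
            using eventually_ge_at_top[of n0]
          proof eventually_elim
            case (elim n)
            then have "real n0 \<le> real n" by simp
            then have "spread k (\<lambda>i\<in>{..<k}. Z n (w i)) \<ge> R" using C[of n] n0 by linarith
            then show ?case using R[OF cfg] by simp
          qed
        qed
        moreover have "G (lab w) w = 0" using i by (auto simp: G_eq)
        ultimately show ?thesis by simp
      qed
    qed
  qed simp
qed

text \<open>The missing masses are put on two labels of their own, one for each marginal: a product measure with
  a vanishing factor contributes nothing.\<close>

definition with_dust :: "nat \<Rightarrow> nat set \<Rightarrow> (nat \<Rightarrow> (real^'d::finite) measure) \<Rightarrow> nat \<Rightarrow> (real^'d) measure" where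
  "with_dust j I \<alpha> l = (if l = j then density (return borel 0) (\<lambda>_. ennreal (1 - (\<Sum>\<^sub>\<infinity>i\<in>I. measure (\<alpha> i) UNIV)))
    else if l \<ge> 2 \<and> l - 2 \<in> I then \<alpha> (l - 2) else null_measure borel)"

text \<open>The family occupies the labels from 2 on, which leaves 0 and 1 free; the dust has
  exactly the mass that the family lacks.\<close>

lemma with_dust_properties:
  fixes \<alpha> :: "nat \<Rightarrow> (real^'d::finite) measure"
  assumes \<alpha>: "\<And>i. i \<in> I \<Longrightarrow> \<alpha> i \<in> subprob_measures" and le: "\<And>F. finite F \<Longrightarrow> F \<subseteq> I \<Longrightarrow> (\<Sum>i\<in>F. measure (\<alpha> i) UNIV) \<le> 1"
    and j: "j < 2"
  shows "with_dust j I \<alpha> l \<in> subprob_measures" "((\<lambda>l. measure (with_dust j I \<alpha> l) UNIV) has_sum 1) UNIV"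
proof -
  let ?s = "\<Sum>\<^sub>\<infinity>i\<in>I. measure (\<alpha> i) UNIV"
  have sm: "(\<lambda>i. measure (\<alpha> i) UNIV) summable_on I"
    by (rule nonneg_bdd_above_summable_on) (auto intro!: bdd_aboveI[of _ 1] le)
  have s1: "?s \<le> 1" by (rule infsum_le_finite_sums[OF sm le])
  have s0: "0 \<le> ?s" by (rule infsum_nonneg) simp
  let ?D = "density (return (borel :: (real^'d) measure) 0) (\<lambda>_. ennreal (1 - ?s))"
  have eD: "emeasure ?D UNIV = ennreal (1 - ?s)"
    by (simp add: emeasure_density nn_integral_return)
  have fD: "finite_measure ?D" by (rule finite_measureI) (simp add: eD)
  have mD: "measure ?D UNIV = 1 - ?s" using eD s1 by (simp add: measure_def)
  have "?D \<in> subprob_measures"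
    by (rule subprob_measuresI[OF fD]) (use mD s0 in auto)
  then show "with_dust j I \<alpha> l \<in> subprob_measures"
    unfolding with_dust_def using null_measure_subprob \<alpha> by auto
  have "((\<lambda>i. measure (\<alpha> i) UNIV) has_sum ?s) I" using sm by (rule has_sum_infsum)
  then have "((\<lambda>i. measure (with_dust j I \<alpha> (i + 2)) UNIV) has_sum ?s) I"
    by (rule has_sum_cong[THEN iffD1, rotated]) (use j in \<open>simp add: with_dust_def\<close>)
  then have "((\<lambda>l. measure (with_dust j I \<alpha> l) UNIV) has_sum ?s) ((\<lambda>i. i + 2) ` I)"
    by (subst has_sum_reindex) (auto simp: o_def inj_on_def)
  moreover have "((\<lambda>l. measure (with_dust j I \<alpha> l) UNIV) has_sum (1 - ?s)) {j}"
    by (rule has_sum_finiteI) (simp_all add: with_dust_def mD)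
  ultimately have "((\<lambda>l. measure (with_dust j I \<alpha> l) UNIV) has_sum (?s + (1 - ?s))) ((\<lambda>i. i + 2) ` I \<union> {j})"
    by (rule has_sum_Un_disjoint) (use j in auto)
  then have "((\<lambda>l. measure (with_dust j I \<alpha> l) UNIV) has_sum 1) ((\<lambda>i. i + 2) ` I \<union> {j})" by simp
  moreover have "measure (with_dust j I \<alpha> l) UNIV = 0" if "l \<notin> (\<lambda>i. i + 2) ` I \<union> {j}" for l
  proof -
    have "\<not> (l \<ge> 2 \<and> l - 2 \<in> I)"
    proof
      assume "l \<ge> 2 \<and> l - 2 \<in> I"
      then have "l \<in> (\<lambda>i. i + 2) ` I" by (intro image_eqI[of _ _ "l - 2"]) auto
      then show False using that by simp
    qed
    then show ?thesis using that by (auto simp: with_dust_def measure_def)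
  qed
  ultimately show "((\<lambda>l. measure (with_dust j I \<alpha> l) UNIV) has_sum 1) UNIV"
    by (subst has_sum_cong_neutral[where S=UNIV and T="(\<lambda>i. i + 2) ` I \<union> {j}"]) auto
qed

text \<open>The members of the collection, completed by dust, become the labelled pieces of two
  probability measures, and the same displacement of label l in both marginals keeps each pair
  together.\<close>

theorem exists_approximating_orbits:
  fixes \<xi> :: "'d::finite orbit_collection"
  assumes \<xi>: "\<xi> \<in> orbit_collections"
  shows "\<exists>\<mu> \<nu>. (\<forall>n::nat. \<mu> n \<in> prob_measures \<and> \<nu> n \<in> prob_measures) \<and>
    (\<forall>k f. k \<ge> 1 \<longrightarrow> f \<in> test_functions k \<longrightarrow> (\<lambda>n. power_integral k f (\<mu> n \<Otimes>\<^sub>M \<nu> n)) \<longlonglongrightarrow> Lambda (k, f) \<xi>)"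
proof -
  obtain I \<alpha> \<beta> where eq: "\<xi> = collection_of I \<alpha> \<beta>" and fam: "subprob_family I \<alpha> \<beta>"
    using \<xi> by (auto simp: orbit_collections_eq)
  define a where "a = with_dust 0 I \<alpha>"
  define b where "b = with_dust 1 I \<beta>"
  have a: "a l \<in> subprob_measures" "((\<lambda>l. measure (a l) UNIV) has_sum 1) UNIV" for l
    unfolding a_def by (rule with_dust_properties; use subprob_familyD[OF fam] in auto)+
  have b: "b l \<in> subprob_measures" "((\<lambda>l. measure (b l) UNIV) has_sum 1) UNIV" for l
    unfolding b_def by (rule with_dust_properties; use subprob_familyD[OF fam] in auto)+
  have fab: "subprob_family UNIV a b"
    unfolding subprob_family_def
    using a(1) b(1) finite_sum_le_has_sum[OF a(2)] finite_sum_le_has_sum[OF b(2)] by auto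
  obtain N where N: "prob_space N" "sets N = sets (borel \<Otimes>\<^sub>M count_space (UNIV :: nat set))"
    "\<And>l. distr (density N (indicator (UNIV \<times> {l}))) borel fst = a l"
    using exists_labelled_measure[OF a(1) has_sum_imp_sums[OF a(2)]] by blast
  obtain N' where N': "prob_space N'" "sets N' = sets (borel \<Otimes>\<^sub>M count_space (UNIV :: nat set))"
    "\<And>l. distr (density N' (indicator (UNIV \<times> {l}))) borel fst = b l"
    using exists_labelled_measure[OF b(1) has_sum_imp_sums[OF b(2)]] by blast
  define u :: "real^'d" where "u = axis (SOME i. True) 1"
  have u: "norm u = 1" by (simp add: u_def)
  define \<sigma> where "\<sigma> = (\<lambda>(n::nat) (x :: real^'d, l :: nat). x + (real n * real l) *\<^sub>R u)"
  have "\<sigma> n \<in> measurable (borel \<Otimes>\<^sub>M count_space UNIV) borel" for n unfolding \<sigma>_def by measurable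
  then have sm: "\<sigma> n \<in> measurable N borel" "\<sigma> n \<in> measurable N' borel" for n
    using measurable_cong_sets[OF N(2) refl] measurable_cong_sets[OF N'(2) refl] by blast+
  have pr: "distr N borel (\<sigma> n) \<in> prob_measures" "distr N' borel (\<sigma> n) \<in> prob_measures" for n
    using prob_space.prob_space_distr[OF N(1) sm(1)] prob_space.prob_space_distr[OF N'(1) sm(2)] by (auto simp: prob_measures_def)
  have "(\<lambda>n. power_integral k f (distr N borel (\<sigma> n) \<Otimes>\<^sub>M distr N' borel (\<sigma> n))) \<longlonglongrightarrow> Lambda (k, f) \<xi>"
    if k: "k \<ge> 1" and f: "f \<in> test_functions k" for k and f :: "'d config \<Rightarrow> real"
  proof -
    obtain B where B: "B > 0" "\<And>z. z \<in> configs k \<Longrightarrow> \<bar>f z\<bar> \<le> B" using test_function_bounded[OF f] by blast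
    have z: "power_integral k f (a l \<Otimes>\<^sub>M b l) = 0" if l: "l \<notin> (\<lambda>i. i + 2) ` I" for l
    proof -
      have "\<not> (l \<ge> 2 \<and> l - 2 \<in> I)"
      proof
        assume "l \<ge> 2 \<and> l - 2 \<in> I"
        then have "l \<in> (\<lambda>i. i + 2) ` I" by (intro image_eqI[of _ _ "l - 2"]) auto
        then show False using l by simp
      qed
      \<comment> \<open>Among these labels, a can carry mass only at 0 and b only at 1, so their
        product is always null.\<close>
      then have "measure (a l) UNIV * measure (b l) UNIV = 0"
        by (auto simp: a_def b_def with_dust_def measure_def)
      note m0 = this
      note pm = pair_subprob[OF a(1)[of l] b(1)[of l]]
      have "\<bar>power_integral k f (a l \<Otimes>\<^sub>M b l)\<bar> \<le> B * measure (a l \<Otimes>\<^sub>M b l) UNIV"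
        by (rule power_integral_bound) (use pm k B in auto)
      then have "\<bar>power_integral k f (a l \<Otimes>\<^sub>M b l)\<bar> \<le> 0" by (simp only: pm(3) m0 mult_zero_right)
      then show ?thesis by simp
    qed
    have "Lambda (k, f) \<xi> = (\<Sum>\<^sub>\<infinity>i\<in>I. power_integral k f (\<alpha> i \<Otimes>\<^sub>M \<beta> i))"
      unfolding eq by (rule Lambda_collection_of[OF fam k f])
    also have "\<dots> = (\<Sum>\<^sub>\<infinity>i\<in>I. power_integral k f (a (i + 2) \<Otimes>\<^sub>M b (i + 2)))"
      by (rule infsum_cong) (simp add: a_def b_def with_dust_def)
    also have "\<dots> = (\<Sum>\<^sub>\<infinity>l\<in>(\<lambda>i. i + 2) ` I. power_integral k f (a l \<Otimes>\<^sub>M b l))"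
      by (subst infsum_reindex) (auto simp: o_def inj_on_def)
    also have "\<dots> = (\<Sum>\<^sub>\<infinity>l. power_integral k f (a l \<Otimes>\<^sub>M b l))"
      by (rule infsum_cong_neutral) (use z in auto)
    finally show ?thesis
      using labelled_shift_tendsto[OF N(1,2) N'(1,2) N(3) N'(3) fab k f u] by (simp add: \<sigma>_def)
  qed
  then show ?thesis using pr
    by (intro exI[of _ "\<lambda>n. distr N borel (\<sigma> n)"] exI[of _ "\<lambda>n. distr N' borel (\<sigma> n)"]) simp
qed

section \<open>The compactification\<close>

context
  fixes F :: "nat \<Rightarrow> nat \<times> ('d::finite config \<Rightarrow> real)"
  assumes F: "dense_test_sequence F"
begin

text \<open>That distance 0 implies equality is the content of
  \<open>Lambda_separates\<close>.\<close>

lemma Metric_space_orbit_dist: "Metric_space orbit_collections (orbit_dist F)"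
proof
  fix \<xi>1 \<xi>2 \<xi>3 :: "'d orbit_collection"
  show "0 \<le> orbit_dist F \<xi>1 \<xi>2" by (rule orbit_dist_nonneg[OF F])
  show "orbit_dist F \<xi>1 \<xi>2 = orbit_dist F \<xi>2 \<xi>1" by (rule orbit_dist_commute[OF F])
  show "orbit_dist F \<xi>1 \<xi>2 = 0 \<longleftrightarrow> \<xi>1 = \<xi>2" if "\<xi>1 \<in> orbit_collections" "\<xi>2 \<in> orbit_collections"
  proof
    assume "orbit_dist F \<xi>1 \<xi>2 = 0"
    then show "\<xi>1 = \<xi>2" using Lambda_separates[OF that] orbit_dist_0_imp_Lambda_eq[OF F that] by blast
  qed (simp add: orbit_dist_def)
  show "orbit_dist F \<xi>1 \<xi>3 \<le> orbit_dist F \<xi>1 \<xi>2 + orbit_dist F \<xi>2 \<xi>3"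
    if "\<xi>1 \<in> orbit_collections" "\<xi>2 \<in> orbit_collections" "\<xi>3 \<in> orbit_collections"
    using that by (rule orbit_dist_triangle[OF F])
qed

interpretation X: Metric_space orbit_collections "orbit_dist F"
  by (rule Metric_space_orbit_dist)

lemma single_orbit_inj: "single_orbit p = single_orbit q \<longleftrightarrow> p = q"
  by (auto simp: single_orbit_def fun_eq_iff split: if_splits)

lemma Metric_space_prob_orbit_dist: "Metric_space (prob_orbits :: 'd orbit set) (prob_orbit_dist F)"
  unfolding prob_orbit_dist_def
  by standard (auto simp: X.nonneg X.commute single_orbit_inj single_orbit_in_orbit_collections intro: X.triangle)

interpretation P: Metric_space "prob_orbits :: 'd orbit set" "prob_orbit_dist F"
  by (rule Metric_space_prob_orbit_dist)

lemma exists_limit_orbit_collection: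
  fixes p :: "nat \<Rightarrow> 'd orbit"
  assumes p: "\<And>n. p n \<in> prob_orbits"
  shows "\<exists>s. strict_mono s \<and> (\<exists>\<xi>\<in>orbit_collections. limitin X.mtopology (\<lambda>n. single_orbit (p (s n))) \<xi> sequentially)"
proof -
  have "\<forall>n. \<exists>\<mu> \<nu>. \<mu> \<in> prob_measures \<and> \<nu> \<in> prob_measures \<and> p n = diag_orbit \<mu> \<nu>"
    using p unfolding prob_orbits_def by blast
  then obtain \<mu> \<nu> where \<mu>: "\<And>n. \<mu> n \<in> prob_measures" and \<nu>: "\<And>n. \<nu> n \<in> prob_measures" and pn: "\<And>n. p n = diag_orbit (\<mu> n) (\<nu> n)"
    by metis
  obtain s R \<alpha> \<beta> where s: "strict_mono (s :: nat \<Rightarrow> nat)" and fam: "subprob_family R \<alpha> \<beta>"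
    and conv: "\<And>k f. k \<ge> 1 \<Longrightarrow> f \<in> test_functions k \<Longrightarrow>
      (\<lambda>n. power_integral k f (\<mu> (s n) \<Otimes>\<^sub>M \<nu> (s n))) \<longlonglongrightarrow> Lambda (k, f) (collection_of R \<alpha> \<beta>)"
    using exists_convergent_subsequence[of \<mu> \<nu>, OF \<mu> \<nu>] by blast
  define \<xi> where "\<xi> = collection_of R \<alpha> \<beta>"
  have \<xi>: "\<xi> \<in> orbit_collections" using fam by (auto simp: orbit_collections_eq \<xi>_def)
  have so: "single_orbit (p n) \<in> orbit_collections" for n by (rule single_orbit_in_orbit_collections[OF p])
  have "(\<lambda>n. orbit_dist F (single_orbit (p (s n))) \<xi>) \<longlonglongrightarrow> 0"
    by (rule orbit_dist_tendsto_0[OF F so \<xi>]) (simp add: pn Lambda_single_orbit[OF \<mu> \<nu>] \<xi>_def conv)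
  then have "limitin X.mtopology (\<lambda>n. single_orbit (p (s n))) \<xi> sequentially"
    using \<xi> so by (simp add: X.limitin_metric_dist_null)
  then show ?thesis using s \<xi> by blast
qed

lemma exists_close_prob_orbit:
  assumes \<xi>: "\<xi> \<in> orbit_collections" and "\<epsilon> > 0"
  shows "\<exists>p\<in>prob_orbits. orbit_dist F (single_orbit p) \<xi> < \<epsilon>"
proof -
  obtain \<mu> \<nu> where \<mu>\<nu>: "\<And>n::nat. \<mu> n \<in> prob_measures" "\<And>n. \<nu> n \<in> prob_measures"
    and conv: "\<And>k f. k \<ge> 1 \<Longrightarrow> f \<in> test_functions k \<Longrightarrow> (\<lambda>n. power_integral k f (\<mu> n \<Otimes>\<^sub>M \<nu> n)) \<longlonglongrightarrow> Lambda (k, f) \<xi>"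
    using exists_approximating_orbits[OF \<xi>] by blast
  have p: "diag_orbit (\<mu> n) (\<nu> n) \<in> prob_orbits" for n using \<mu>\<nu> by (auto simp: prob_orbits_def)
  have "(\<lambda>n. orbit_dist F (single_orbit (diag_orbit (\<mu> n) (\<nu> n))) \<xi>) \<longlonglongrightarrow> 0"
    by (rule orbit_dist_tendsto_0[OF F single_orbit_in_orbit_collections[OF p] \<xi>])
      (simp add: Lambda_single_orbit[OF \<mu>\<nu>] conv)
  then have "\<forall>\<^sub>F n in sequentially. orbit_dist F (single_orbit (diag_orbit (\<mu> n) (\<nu> n))) \<xi> < \<epsilon>"
    using \<open>\<epsilon> > 0\<close> by (rule order_tendstoD)
  then obtain n where "orbit_dist F (single_orbit (diag_orbit (\<mu> n) (\<nu> n))) \<xi> < \<epsilon>"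
    by (meson eventually_sequentially order_refl)
  then show ?thesis using p by blast
qed

lemma closure_single_orbits: "X.mtopology closure_of (single_orbit ` (prob_orbits :: 'd orbit set)) = orbit_collections"
proof
  show "orbit_collections \<subseteq> X.mtopology closure_of (single_orbit ` (prob_orbits :: 'd orbit set))"
    unfolding X.metric_closure_of
  proof safe
    fix \<xi> :: "'d orbit_collection" and r :: real assume \<xi>: "\<xi> \<in> orbit_collections" and "r > 0"
    then obtain p where "p \<in> prob_orbits" "orbit_dist F (single_orbit p) \<xi> < r" using exists_close_prob_orbit by blast
    then show "\<exists>y\<in>single_orbit ` prob_orbits. y \<in> X.mball \<xi> r"
      using \<xi> by (intro bexI[of _ "single_orbit p"]) (auto simp: X.commute single_orbit_in_orbit_collections)
  qed
qed (simp add: X.metric_closure_of)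

text \<open>By density, the n-th member of a sequence of collections is replaced by an orbit within
  1 / (n + 1) of it; a convergent subsequence of these orbits carries its limit over to the original
  sequence.\<close>

lemma compact_space_orbit_collections: "compact_space X.mtopology"
  unfolding X.compact_space_sequentially
proof (intro allI impI)
  fix \<sigma> :: "nat \<Rightarrow> 'd orbit_collection" assume \<sigma>: "range \<sigma> \<subseteq> orbit_collections"
  have "\<exists>p\<in>prob_orbits. orbit_dist F (single_orbit p) (\<sigma> n) < inverse (real (Suc n))" for n
    using \<sigma> by (intro exists_close_prob_orbit) auto
  then obtain p where p: "\<And>n. p n \<in> prob_orbits" "\<And>n. orbit_dist F (single_orbit (p n)) (\<sigma> n) < inverse (real (Suc n))"
    by metis
  obtain s \<xi> where s: "strict_mono (s :: nat \<Rightarrow> nat)" and \<xi>: "\<xi> \<in> orbit_collections"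
    and lim: "limitin X.mtopology (\<lambda>n. single_orbit (p (s n))) \<xi> sequentially"
    using exists_limit_orbit_collection[of p, OF p(1)] by blast
  have d0: "(\<lambda>n. orbit_dist F (single_orbit (p (s n))) \<xi>) \<longlonglongrightarrow> 0" using lim by (simp add: X.limitin_metric_dist_null)
  have i0: "(\<lambda>n. inverse (real (Suc (s n)))) \<longlonglongrightarrow> 0"
    using LIMSEQ_subseq_LIMSEQ[OF LIMSEQ_inverse_real_of_nat s] by (simp add: o_def)
  have "orbit_dist F (\<sigma> (s n)) \<xi> \<le> inverse (real (Suc (s n))) + orbit_dist F (single_orbit (p (s n))) \<xi>" for n
    using X.triangle[of "\<sigma> (s n)" "single_orbit (p (s n))" \<xi>] p(2)[of "s n"] \<sigma> \<xi>
      single_orbit_in_orbit_collections[OF p(1)] X.commute[of "\<sigma> (s n)"] by (force simp: image_subset_iff)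
  then have "(\<lambda>n. orbit_dist F (\<sigma> (s n)) \<xi>) \<longlonglongrightarrow> 0"
    by (intro tendsto_sandwich[OF _ _ tendsto_const tendsto_add_zero[OF i0 d0]]) (auto intro: always_eventually)
  then have "limitin X.mtopology (\<sigma> \<circ> s) \<xi> sequentially"
    using \<xi> \<sigma> by (auto simp: X.limitin_metric_dist_null image_subset_iff)
  then show "\<exists>l r. l \<in> orbit_collections \<and> strict_mono r \<and> limitin X.mtopology (\<sigma> \<circ> r) l sequentially" using \<xi> s by blast
qed

text \<open>A subsequence that converges among the collections is Cauchy there, and
  \<open>single_orbit\<close> is isometric.\<close>

lemma mtotally_bounded_prob_orbits: "P.mtotally_bounded prob_orbits"
  unfolding P.mtotally_bounded_sequentially
proof (intro conjI allI impI)
  fix \<sigma> :: "nat \<Rightarrow> 'd orbit" assume \<sigma>: "range \<sigma> \<subseteq> prob_orbits"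
  then have \<sigma>n: "\<sigma> n \<in> prob_orbits" for n by auto
  obtain s \<xi> where s: "strict_mono (s :: nat \<Rightarrow> nat)"
    and lim: "limitin X.mtopology (\<lambda>n. single_orbit (\<sigma> (s n))) \<xi> sequentially"
    using exists_limit_orbit_collection[of \<sigma>, OF \<sigma>n] by blast
  have "X.MCauchy (\<lambda>n. single_orbit (\<sigma> (s n)))"
    by (rule X.convergent_imp_MCauchy[OF _ lim]) (auto simp: single_orbit_in_orbit_collections \<sigma>n)
  then have "P.MCauchy (\<sigma> \<circ> s)"
    using \<sigma> by (auto simp: X.MCauchy_def P.MCauchy_def prob_orbit_dist_def)
  then show "\<exists>r. strict_mono r \<and> P.MCauchy (\<sigma> \<circ> r)" using s by blast
qed simp

lemma embedding_single_orbit: "embedding_map P.mtopology X.mtopology single_orbit"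
proof -
  interpret Metric_space12 "prob_orbits :: 'd orbit set" "prob_orbit_dist F" orbit_collections "orbit_dist F" ..
  show ?thesis
    by (rule isometry_imp_embedding_map) (auto simp: single_orbit_in_orbit_collections prob_orbit_dist_def)
qed

lemma orbit_compactification:
  "is_compactification P.mtopology X.mtopology single_orbit"
  unfolding is_compactification_def
  using compact_space_orbit_collections X.Hausdorff_space_mtopology embedding_single_orbit closure_single_orbits by simp

text \<open>Completeness follows from compactness; density and isometry are already
  available.\<close>

lemma orbit_completion:
  "is_metric_completion (prob_orbits :: 'd orbit set) (prob_orbit_dist F) orbit_collections (orbit_dist F) single_orbit"
  unfolding is_metric_completion_def
  using Metric_space_prob_orbit_dist Metric_space_orbit_dist X.compact_space_imp_mcomplete[OF compact_space_orbit_collections]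
    closure_single_orbits
  by (auto simp: single_orbit_in_orbit_collections prob_orbit_dist_def)

end

theorem theorem2p1:
  fixes F :: "nat \<Rightarrow> nat \<times> ('d::finite config \<Rightarrow> real)"
  assumes "dense_test_sequence F"
  shows "Metric_space (orbit_collections :: 'd orbit_collection set) (orbit_dist F) \<and>
    (\<forall>p :: nat \<Rightarrow> 'd orbit. (\<forall>n. p n \<in> prob_orbits) \<longrightarrow>
       (\<exists>s. strict_mono s \<and> (\<exists>\<xi>\<in>orbit_collections.
          limitin (Metric_space.mtopology orbit_collections (orbit_dist F))
            (\<lambda>n. single_orbit (p (s n))) \<xi> sequentially))) \<and>
    Metric_space.mtopology orbit_collections (orbit_dist F)
       closure_of (single_orbit ` (prob_orbits :: 'd orbit set)) = orbit_collections \<and>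
    is_compactification
       (Metric_space.mtopology (prob_orbits :: 'd orbit set) (prob_orbit_dist F))
       (Metric_space.mtopology orbit_collections (orbit_dist F)) single_orbit \<and>
    Metric_space.mtotally_bounded (prob_orbits :: 'd orbit set) (prob_orbit_dist F) prob_orbits \<and>
    is_metric_completion (prob_orbits :: 'd orbit set) (prob_orbit_dist F)
       orbit_collections (orbit_dist F) single_orbit"
  using Metric_space_orbit_dist[OF assms] exists_limit_orbit_collection[OF assms] closure_single_orbits[OF assms]
    orbit_compactification[OF assms] mtotally_bounded_prob_orbits[OF assms] orbit_completion[OF assms]
  by blast

end
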